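(* Let $b\ge3$ be an integer, let $\rho(b)=\lfloor\frac{b-3}5\rfloor$, and suppose $D_1,D_2\subset\{0,1,\dots,b-1\}$ satisfy $\#D_j\ge b-\rho(b)$ for $j=1,2$. Then the pair $(D_1,D_2)$ is either degenerate, or else the associated Möbius maps $\{[F(A_i)]\}_{i=0}^{b-1}$ admit a common strictly invariant arc. If $(D_1,D_2)$ is non-degenerate, then there is $P\in\mathrm{GL}_2(\mathbb R)$ such that $B_i=PA_iP^{-1}$ is a positive matrix for every $0\le i\le b-1$, and, with $T$ and $\boldsymbol v$ the infinite matrix and vector associated with the positive family $\{B_i\}_{i=0}^{b-1}$ and uniform weights $w_i=1/b$, we have for Lebesgue-a.e. $t\in\mathbb R/\mathbb Z$ $$\dim_{\mathrm H}\big((K_1+t)\cap K_2\big)=\frac1{\log b}\sum_{n=0}^\infty\big(T^n\boldsymbol v\big)_0 .$$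
   Context: $\mathbb N_0=\{0,1,2,\dots\}$. A matrix is positive if all its entries are $>0$. $\dim_{\mathrm H}$ is Hausdorff dimension. Powers use the convention $0^0=1$. For $D_j\subset\{0,\dots,b-1\}$ ($j=1,2$) let $K_j=\{\sum_{n=1}^\infty d_nb^{-n}\mid d_n\in D_j\}\subset\mathbb R/\mathbb Z$. The associated $2\times2$ matrices $A_0,\dots,A_{b-1}$ have entries $$A_i(j,k)=\#\big((D_1+i+j)\cap(D_2+kb)\big),\qquad 0\le j,k\le1,$$ (row $j$, column $k$, sets taken in $\mathbb Z$). The pair $(D_1,D_2)$ is degenerate if some $A_i$, $0\le i\le b-1$, is singular; otherwise it is non-degenerate. $\mathrm{PGL}_2(\mathbb R)=\mathrm{GL}_2(\mathbb R)/\sim$, where $A\sim B$ iff $A=tB$ for some $t\in\mathbb R\setminus\{0\}$. The class $[M]$ of $M=\begin{pmatrix}\alpha&\beta\\ \gamma&\delta\end{pmatrix}$ is identified with the Möbius transformation $x\mapsto\frac{\alpha x+\beta}{\gamma x+\delta}$ of the Riemann sphere, which preserves $\widehat{\mathbb R}=\mathbb R\cup\{\widehat\infty\}$; for $f=[M]$ put $f^{\top}=[M^{\top}]$. Define $$F\begin{pmatrix}p&q\\ r&s\end{pmatrix}=\frac12\begin{pmatrix}p-q-r+s&p+q-r-s\\ p-q+r-s&p+q+r+s\end{pmatrix}.$$ A closed arc is a connected compact subset of $\widehat{\mathbb R}$ homeomorphic to $[0,1]$. Möbius maps $\{f_i\}$ admit a common strictly invariant arc if there is a closed arc $J$ with $f_i(J)\subset\mathring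 J$ for all $i$, where $\mathring J$ is the interior of $J$ in $\widehat{\mathbb R}$. $T$ and $\boldsymbol v$ associated with a finite family $\{B_i\}_{i\in I}$ of invertible positive $2\times2$ matrices and a probability vector $(w_i)_{i\in I}$: let $g_i=[F(B_i)]$. For $x,c\in\mathbb C$, $|x|\le1$, let $v(x;c)$ be the sequence indexed by $\mathbb N_0$ with $(v(x;c))_0=c$, $(v(x;c))_n=-\frac{(-x)^n}n$ for $n\ge1$. Then $\boldsymbol v=\sum_iw_i\,v\big(g_i(0);\tfrac12\log(\det F(B_i)/g_i'(0))\big)$ (the argument of the logarithm is positive), and $T=(b_{k,n})_{k,n\in\mathbb N_0}$ with $b_{k,0}=0$ for $k\ge0$, $b_{0,n}=\sum_iw_i(g_i^{\top}(0))^n$ for $n\ge1$, and for $k,n\ge1$ $$b_{k,n}=\sum_iw_i\sum_{\ell=1}^{\min\{k,n\}}\binom n\ell\binom{k-1}{\ell-1}(g_i^{\top}(0))^{n-\ell}(-g_i(0))^{k-\ell}(g_i'(0))^{\ell}.$$ $T$ acts by $(Tu)_k=\sum_{n\ge0}b_{k,n}u_n$; it is a well-defined linear operator on the linear span $V$ of all $v(x;c)$, $|x|\le 1$, so $T^n\boldsymbol v$ makes sense, and $(\cdot)_0$ is the $0$-th coordinate. *)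

theory Defs
  imports "HOL-Analysis.Analysis"
begin

section \<open>The circle \<open>\<real>/\<int>\<close>\<close>

quotient_type circle = real / "\<lambda>x y :: real. x - y \<in> \<int>"
  morphisms rep_circle to_circle
proof (rule equivpI)
  show "reflp (\<lambda>x y :: real. x - y \<in> \<int>)" by (simp add: reflp_def)
  show "symp (\<lambda>x y :: real. x - y \<in> \<int>)"
    by (metis (mono_tags, lifting) Ints_minus minus_diff_eq sympI)
  show "transp (\<lambda>x y :: real. x - y \<in> \<int>)"
    by (rule transpI) (metis (no_types, lifting) Ints_add add_diff_eq diff_add_cancel)
qed

lemma infdist_Ints_shift:
  fixes x y :: real
  assumes "x - y \<in> \<int>"
  shows "infdist x \<int> \<le> infdist y \<int>"
proof -
  obtain n where n: "n \<in> (\<int> :: real set)" "infdist y \<int> = dist y n"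
    using infdist_attains_inf[OF closed_Ints, of y] Ints_0 by blast
  have "n + (x - y) \<in> \<int>" using n assms by simp
  then have "infdist x \<int> \<le> dist x (n + (x - y))" by (rule infdist_le)
  also have "\<dots> = dist y n" by (simp add: dist_real_def)
  finally show ?thesis using n by simp
qed

lemma infdist_Ints_cong:
  fixes x y :: real
  assumes "x - y \<in> \<int>"
  shows "infdist x \<int> = infdist y \<int>"
  using assms infdist_Ints_shift[of x y] infdist_Ints_shift[of y x]
  by (metis Ints_minus minus_diff_eq order_antisym)

lemma infdist_Ints_minus: "infdist (- x :: real) \<int> \<le> infdist x \<int>"
proof -
  obtain n where n: "n \<in> (\<int> :: real set)" "infdist x \<int> = dist x n"
    using infdist_attains_inf[OF closed_Ints, of x] Ints_0 by blast
  have "infdist (- x) \<int> \<le> dist (- x) (- n)" using n by (intro infdist_le) simp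
  then show ?thesis using n by (simp add: dist_minus)
qed

lemma infdist_Ints_add: "infdist (x + y :: real) \<int> \<le> infdist x \<int> + infdist y \<int>"
proof -
  obtain m where m: "m \<in> (\<int> :: real set)" "infdist x \<int> = dist x m"
    using infdist_attains_inf[OF closed_Ints, of x] Ints_0 by blast
  obtain n where n: "n \<in> (\<int> :: real set)" "infdist y \<int> = dist y n"
    using infdist_attains_inf[OF closed_Ints, of y] Ints_0 by blast
  have "infdist (x + y) \<int> \<le> dist (x + y) (m + n)" using m n by (intro infdist_le) simp
  also have "\<dots> \<le> dist x m + dist y n" by (rule dist_triangle_add)
  finally show ?thesis using m n by simp
qed

instantiation circle :: ab_group_add
begin

lift_definition zero_circle :: circle is "0 :: real" .

lift_definition plus_circle :: "circle \<Rightarrow> circle \<Rightarrow> circle" is "(+)"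
  by (metis (no_types, lifting) Ints_add add_diff_add)

lift_definition uminus_circle :: "circle \<Rightarrow> circle" is uminus
  by (metis Ints_minus minus_diff_commute minus_diff_eq minus_diff_minus)

lift_definition minus_circle :: "circle \<Rightarrow> circle \<Rightarrow> circle" is "(-)"
proof -
  fix a b c d :: real
  assume "a - b \<in> \<int>" "c - d \<in> \<int>"
  then have "(a - b) - (c - d) \<in> \<int>" by (rule Ints_diff)
  then show "a - c - (b - d) \<in> \<int>" by (simp add: algebra_simps)
qed

instance
  by standard (transfer, simp add: algebra_simps)+

end

text \<open>The quotient metric: the distance of \<open>x - y\<close> to the nearest integer.\<close>

instantiation circle :: metric_space
begin

lift_definition dist_circle :: "circle \<Rightarrow> circle \<Rightarrow> real" is
  "\<lambda>x y. infdist (x - y) \<int>"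
proof -
  fix a b c d :: real
  assume "a - b \<in> \<int>" "c - d \<in> \<int>"
  then have "(a - b) - (c - d) \<in> \<int>" by (rule Ints_diff)
  then show "infdist (a - c) \<int> = infdist (b - d) \<int>"
    by (intro infdist_Ints_cong) (simp add: algebra_simps)
qed

definition uniformity_circle :: "(circle \<times> circle) filter" where
  "uniformity_circle = (INF e\<in>{0<..}. principal {(x, y). dist x y < e})"

definition open_circle :: "circle set \<Rightarrow> bool" where
  "open_circle U \<longleftrightarrow> (\<forall>x\<in>U. \<forall>\<^sub>F (x', y) in uniformity. x' = x \<longrightarrow> y \<in> U)"

instance
proof
  show "dist x y = 0 \<longleftrightarrow> x = y" for x y :: circle
    by transfer (metis Ints_0 closed_Ints empty_iff in_closed_iff_infdist_zero)
  show "dist x y \<le> dist x z + dist y z" for x y z :: circle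
  proof transfer
    fix x y z :: real
    have "infdist (x - y) \<int> \<le> infdist (x - z) \<int> + infdist (- (y - z)) \<int>"
      using infdist_Ints_add[of "x - z" "- (y - z)"] by simp
    also have "\<dots> \<le> infdist (x - z) \<int> + infdist (y - z) \<int>"
      using infdist_Ints_minus[of "y - z"] by simp
    finally show "infdist (x - y) \<int> \<le> infdist (x - z) \<int> + infdist (y - z) \<int>" .
  qed
qed (rule uniformity_circle_def open_circle_def)+

end

lemma dist_to_circle_le: "dist (to_circle x) (to_circle y) \<le> dist x y"
proof -
  have "infdist (x - y) \<int> \<le> dist (x - y) 0" by (rule infdist_le) simp
  then show ?thesis by (simp add: dist_circle.abs_eq dist_real_def)
qed

lemma continuous_on_to_circle: "continuous_on S to_circle"
  unfolding continuous_on_iff using dist_to_circle_le le_less_trans by blast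

definition lebesgue_circle :: "circle measure" where
  "lebesgue_circle = distr (restrict_space lborel {0..<1}) borel to_circle"

text \<open>The map is measurable, so \<^const>\<open>distr\<close> is the actual push-forward and not the zero
  measure.\<close>

lemma measurable_to_circle [measurable]:
  "to_circle \<in> restrict_space lborel {0..<1} \<rightarrow>\<^sub>M borel"
  by (intro measurable_restrict_space1)
    (simp add: borel_measurable_continuous_onI continuous_on_to_circle)

lemma emeasure_lebesgue_circle_UNIV: "emeasure lebesgue_circle UNIV = 1"
  unfolding lebesgue_circle_def
  by (subst emeasure_distr[OF measurable_to_circle])
    (auto simp: space_restrict_space emeasure_restrict_space)

section \<open>Hausdorff dimension\<close>

text \<open>Usual conventions: the empty set contributes \<open>0\<close>, and a nonempty set of diameter \<open>0\<close>
  contributes \<open>1\<close> when \<open>s = 0\<close> (whereas \<open>0 powr 0 = 0\<close>). Boundedness is required because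
  \<^const>\<open>diameter\<close> is unspecified on unbounded sets.\<close>

definition hausdorff_gauge :: "real \<Rightarrow> 'a::metric_space set \<Rightarrow> ennreal" where
  "hausdorff_gauge s U =
     (if U = {} then 0 else if s = 0 then 1 else ennreal (diameter U powr s))"

definition hausdorff_premeasure :: "real \<Rightarrow> real \<Rightarrow> 'a::metric_space set \<Rightarrow> ennreal" where
  "hausdorff_premeasure s \<delta> A =
     (INF U \<in> {U :: nat \<Rightarrow> 'a set. A \<subseteq> (\<Union>n. U n) \<and> (\<forall>n. bounded (U n) \<and> diameter (U n) \<le> \<delta>)}.
        \<Sum>n. hausdorff_gauge s (U n))"

definition hausdorff_measure :: "real \<Rightarrow> 'a::metric_space set \<Rightarrow> ennreal" where
  "hausdorff_measure s A = (SUP \<delta>\<in>{0<..}. hausdorff_premeasure s \<delta> A)"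

definition hausdorff_dim :: "'a::metric_space set \<Rightarrow> ereal" where
  "hausdorff_dim A = Inf {ereal s | s. 0 \<le> s \<and> hausdorff_measure s A = 0}"

section \<open>Digit sets and their matrices\<close>

definition digit_set_K :: "nat \<Rightarrow> int set \<Rightarrow> circle set" where
  "digit_set_K b D =
     {to_circle (\<Sum>n. real_of_int (d (Suc n)) / real b ^ Suc n) | d. \<forall>n\<ge>1. d n \<in> D}"

definition assoc_entry :: "nat \<Rightarrow> int set \<Rightarrow> int set \<Rightarrow> nat \<Rightarrow> nat \<Rightarrow> nat \<Rightarrow> nat" where
  "assoc_entry b D1 D2 i j k =
     card (((\<lambda>d. d + int i + int j) ` D1) \<inter> ((\<lambda>d. d + int k * int b) ` D2))"

text \<open>The entries are indexed by \<open>0, 1\<close> in \<open>assoc_entry\<close>, but by \<open>1, 2\<close> in a matrix of type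
  \<open>real ^ 2 ^ 2\<close>.\<close>

definition assoc_matrix :: "nat \<Rightarrow> int set \<Rightarrow> int set \<Rightarrow> nat \<Rightarrow> real^2^2" where
  "assoc_matrix b D1 D2 i =
     vector [vector [real (assoc_entry b D1 D2 i 0 0), real (assoc_entry b D1 D2 i 0 1)],
             vector [real (assoc_entry b D1 D2 i 1 0), real (assoc_entry b D1 D2 i 1 1)]]"

definition degenerate_pair :: "nat \<Rightarrow> int set \<Rightarrow> int set \<Rightarrow> bool" where
  "degenerate_pair b D1 D2 \<longleftrightarrow> (\<exists>i<b. \<not> invertible (assoc_matrix b D1 D2 i))"

definition positive_matrix :: "real^'n^'m \<Rightarrow> bool" where
  "positive_matrix M \<longleftrightarrow> (\<forall>j k. M $ j $ k > 0)"

section \<open>Moebius transformations\<close>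

text \<open>\<^term>\<open>None\<close> is the point at infinity. A class in \<open>PGL\<^sub>2\<close> is handled through a
  representing matrix: the map does not depend on the representative, see
  \<open>moebius_map_scaleR\<close> below.\<close>

definition moebius_fun :: "'a::field^2^2 \<Rightarrow> 'a \<Rightarrow> 'a" where
  "moebius_fun M x = (M$1$1 * x + M$1$2) / (M$2$1 * x + M$2$2)"

definition moebius_map :: "'a::field^2^2 \<Rightarrow> 'a option \<Rightarrow> 'a option" where
  "moebius_map M z = (case z of
       Some x \<Rightarrow> if M$2$1 * x + M$2$2 = 0 then None else Some (moebius_fun M x)
     | None \<Rightarrow> if M$2$1 = 0 then None else Some (M$1$1 / M$2$1))"

lemma moebius_fun_scaleR: "t \<noteq> 0 \<Longrightarrow> moebius_fun (t *\<^sub>R M) x = moebius_fun (M :: real^2^2) x"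
proof -
  assume "t \<noteq> 0"
  moreover have "moebius_fun (t *\<^sub>R M) x =
      (t * (M$1$1 * x + M$1$2)) / (t * (M$2$1 * x + M$2$2))"
    by (simp add: moebius_fun_def algebra_simps)
  ultimately show ?thesis by (simp add: moebius_fun_def)
qed

lemma moebius_map_scaleR: "t \<noteq> 0 \<Longrightarrow> moebius_map (t *\<^sub>R M) z = moebius_map (M :: real^2^2) z"
proof -
  assume t: "t \<noteq> 0"
  have "t * M$2$1 * x + t * M$2$2 = t * (M$2$1 * x + M$2$2)" for x
    by (simp add: algebra_simps)
  with t show ?thesis
    by (simp add: moebius_map_def moebius_fun_scaleR split: option.split)
qed

definition F_matrix :: "real^2^2 \<Rightarrow> real^2^2" where
  "F_matrix M = (let p = M$1$1; q = M$1$2; r = M$2$1; s = M$2$2 in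
     (1/2) *\<^sub>R vector [vector [p - q - r + s, p + q - r - s],
                     vector [p - q + r - s, p + q + r + s]])"

abbreviation real_hat :: "real option topology" where
  "real_hat \<equiv> Alexandroff_compactification euclideanreal"

definition closed_arc :: "real option set \<Rightarrow> bool" where
  "closed_arc J \<longleftrightarrow> connectedin real_hat J \<and> compactin real_hat J \<and>
     subtopology real_hat J homeomorphic_space top_of_set {0..1::real}"

definition common_strictly_invariant_arc ::
    "'i set \<Rightarrow> ('i \<Rightarrow> real option \<Rightarrow> real option) \<Rightarrow> bool" where
  "common_strictly_invariant_arc I f \<longleftrightarrow>
     (\<exists>J. closed_arc J \<and> (\<forall>i\<in>I. f i ` J \<subseteq> real_hat interior_of J))"

section \<open>The infinite matrix and the vector of a positive family\<close>

text \<open>With \<open>g = [F(B)]\<close>: \<open>at0\<close>, \<open>at0_tr\<close> and \<open>deriv0\<close> are \<open>g(0)\<close>, \<open>g\<^sup>\<top>(0)\<close> and \<open>g'(0)\<close>.\<close>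

definition at0 :: "real^2^2 \<Rightarrow> real" where
  "at0 B = moebius_fun (F_matrix B) 0"

definition at0_tr :: "real^2^2 \<Rightarrow> real" where
  "at0_tr B = moebius_fun (transpose (F_matrix B)) 0"

definition deriv0 :: "real^2^2 \<Rightarrow> real" where
  "deriv0 B = deriv (moebius_fun (F_matrix B)) 0"

definition v_seq :: "'a::field \<Rightarrow> 'a \<Rightarrow> nat \<Rightarrow> 'a" where
  "v_seq x c n = (if n = 0 then c else - ((- x) ^ n / of_nat n))"

definition assoc_vector :: "'i set \<Rightarrow> ('i \<Rightarrow> real) \<Rightarrow> ('i \<Rightarrow> real^2^2) \<Rightarrow> nat \<Rightarrow> real" where
  "assoc_vector I w B n =
     (\<Sum>i\<in>I. w i * v_seq (at0 (B i)) (1/2 * ln (det (F_matrix (B i)) / deriv0 (B i))) n)"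

definition assoc_operator ::
    "'i set \<Rightarrow> ('i \<Rightarrow> real) \<Rightarrow> ('i \<Rightarrow> real^2^2) \<Rightarrow> nat \<Rightarrow> nat \<Rightarrow> real" where
  "assoc_operator I w B k n =
     (if n = 0 then 0
      else if k = 0 then \<Sum>i\<in>I. w i * at0_tr (B i) ^ n
      else \<Sum>i\<in>I. w i * (\<Sum>l=1..min k n. real (n choose l) * real ((k - 1) choose (l - 1)) *
             at0_tr (B i) ^ (n - l) * (- at0 (B i)) ^ (k - l) * deriv0 (B i) ^ l))"

definition mat_apply :: "(nat \<Rightarrow> nat \<Rightarrow> real) \<Rightarrow> (nat \<Rightarrow> real) \<Rightarrow> nat \<Rightarrow> real" where
  "mat_apply T u k = (\<Sum>n. T k n * u n)"

end

theory Submission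
  imports Defs
begin

text \<open>
  Writing the base-\<open>b\<close> addition \<open>x + t = y\<close> with carries shows that the number of admissible
  prefixes of length \<open>n\<close> is a sum of entries of \<open>A\<^bsub>t\<^sub>n\<^esub> \<cdots> A\<^bsub>t\<^sub>1\<^esub>\<close>. All \<open>A\<^sub>i\<close> map the cone spanned by
  \<open>(3, 1)\<close> and \<open>(1, 3)\<close> strictly into itself, which gives the arc \<open>[-1/2, 1/2]\<close> and a conjugation
  making every matrix positive. The resulting Moebius maps contract, so the mean logarithmic growth
  converges geometrically to the Lyapunov exponent; since the operator \<open>T\<close> acts on \<open>v(x; c)\<close> through
  the orbit of \<open>x\<close>, the partial sums of \<open>(T\<^sup>n v)\<^sub>0\<close> telescope to exactly this mean growth. Exponential
  moments and Borel-Cantelli turn mean growth into almost sure growth. Counting prefixes gives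
  covers by \<open>b\<close>-adic intervals, hence the upper bound for the dimension. For the lower bound, the cone
  condition says that each cylinder of level \<open>n\<close> has at most a constant multiple of the average
  number of descendants, so an efficient cover misses a path of every length, and by Koenig's lemma an
  infinite one.
\<close>

section \<open>Moebius cocycles and their mean growth\<close>

text \<open>In the homogeneous coordinates \<open>(1 + x, 1 - x)\<close>, \<open>F_matrix M\<close>
  is the action of \<open>M\<close> on \<open>x\<close>; this is why the cone spanned by
  \<open>(3, 1)\<close> and \<open>(1, 3)\<close> becomes the arc \<open>[-1/2, 1/2]\<close>.
  Conjugation by \<open>cone_matrix\<close> doubles \<open>x\<close>, hence the factors 1/2 wherever
  counts for the original matrices are read off from the conjugated cocycle on
  \<open>[-1, 1]\<close>. The 5 in rho(b) is the price of the cone inequalities: in the estimates a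
  missing digit is charged five times against a reserve of \<open>2 * b\<close>. Since the entries
  are integers, strict inclusion comes with slack 1, and this yields an explicit contraction ratio
  \<open>1 - 1 / (8 * b)\<close>. The series speaks of an average over all words, the dimension of
  one digit sequence at a time. Both meet in the number \<open>lyap\<close>. Two bounded errors link
  them: \<open>log_Q\<close> is additive under concatenation up to a constant, and its mean over
  words of length \<open>n\<close> is \<open>n * lyap\<close> up to a constant. Together they make
  exponential moments over one long block small enough to be iterated, which takes the place of an
  ergodic theorem.\<close>

fun avg :: "nat \<Rightarrow> nat \<Rightarrow> (nat list \<Rightarrow> real) \<Rightarrow> real" where
  "avg b 0 f = f []"
| "avg b (Suc n) f = (\<Sum>i<b. avg b n (\<lambda>w. f (i # w))) / real b"

lemma avg_cong: "(\<And>w. length w = n \<Longrightarrow> f w = g w) \<Longrightarrow> avg b n f = avg b n g"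
proof (induction n arbitrary: f g)
  case (Suc n)
  have "avg b n (\<lambda>w. f (i # w)) = avg b n (\<lambda>w. g (i # w))" for i
    by (rule Suc.IH) (simp add: Suc.prems)
  then show ?case by simp
qed simp

lemma avg_mono: "(\<And>w. length w = n \<Longrightarrow> f w \<le> g w) \<Longrightarrow> avg b n f \<le> avg b n g"
proof (induction n arbitrary: f g)
  case (Suc n)
  have "avg b n (\<lambda>w. f (i # w)) \<le> avg b n (\<lambda>w. g (i # w))" for i
    by (rule Suc.IH) (simp add: Suc.prems)
  then show ?case by (simp add: divide_right_mono sum_mono)
qed simp

lemma avg_add: "avg b n (\<lambda>w. f w + g w) = avg b n f + avg b n g"
  by (induction n arbitrary: f g) (simp_all add: sum.distrib add_divide_distrib)

lemma avg_cmult: "avg b n (\<lambda>w. c * f w) = c * avg b n f"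
  by (induction n arbitrary: f) (simp_all add: sum_distrib_left)

lemma avg_diff: "avg b n (\<lambda>w. f w - g w) = avg b n f - avg b n g"
  using avg_add[of b n f "\<lambda>w. (-1) * g w"] avg_cmult[of b n "-1" g] by simp

lemma avg_const [simp]: "b > 0 \<Longrightarrow> avg b n (\<lambda>w. c) = c"
  by (induction n) simp_all

lemma avg_sum: "avg b n (\<lambda>w. \<Sum>i\<in>I. f i w) = (\<Sum>i\<in>I. avg b n (f i))"
proof (induction n arbitrary: f)
  case (Suc n)
  then show ?case by (simp add: sum_divide_distrib) (rule sum.swap)
qed simp

lemma avg_append: "avg b (m + n) f = avg b m (\<lambda>u. avg b n (\<lambda>v. f (u @ v)))"
  by (induction m arbitrary: f) simp_all

lemma avg_abs_le:
  assumes "b > 0" "\<And>w. length w = n \<Longrightarrow> \<bar>f w\<bar> \<le> C"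
  shows "\<bar>avg b n f\<bar> \<le> C"
proof -
  have "avg b n f \<le> avg b n (\<lambda>w. C)" "avg b n (\<lambda>w. - C) \<le> avg b n f"
    by (intro avg_mono, use assms(2) in \<open>force simp: abs_le_iff\<close>)+
  then show ?thesis using assms(1) by (simp add: abs_le_iff)
qed

lemma avg_Suc_right:
  "avg b (Suc n) f = avg b n (\<lambda>w. (\<Sum>j<b. f (w @ [j])) / real b)"
  using avg_append[of b n 1 f] by simp

lemma sums_avg:
  assumes "\<And>w. length w = n \<Longrightarrow> (\<lambda>m. f m w) sums g w"
  shows "(\<lambda>m. avg b n (f m)) sums avg b n g"
  using assms
proof (induction n arbitrary: f g)
  case (Suc n)
  have "(\<lambda>m. avg b n (\<lambda>w. f m (i # w))) sums avg b n (\<lambda>w. g (i # w))" for i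
    by (rule Suc.IH) (simp add: Suc.prems)
  then show ?case by (simp add: sums_divide sums_sum)
qed simp

text \<open>\<open>r\<close> expresses that every map sends \<open>[-1, 1]\<close> into
  \<open>[-r, r]\<close>; multiplied out by the denominator the condition is affine in
  \<open>x\<close> and can be verified at the two end points. \<open>lo\<close> and
  \<open>hi\<close> keep the logarithms of denominators bounded. Demanding the bounds for all
  natural indices spares a side condition on every word.\<close>

locale moebius_cocycle =
  fixes b :: nat and \<alpha> \<beta> \<gamma> \<delta> :: "nat \<Rightarrow> real" and r lo hi :: real
  assumes b_pos: "b > 0" and r_nonneg: "0 \<le> r" and r_less: "r < 1" and lo_pos: "0 < lo"
    and contr: "\<And>i x. \<bar>x\<bar> \<le> 1 \<Longrightarrow> \<bar>\<alpha> i * x + \<beta> i\<bar> \<le> r * (\<gamma> i * x + \<delta> i)"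
    and den_ge: "\<And>i x. \<bar>x\<bar> \<le> 1 \<Longrightarrow> lo \<le> \<gamma> i * x + \<delta> i"
    and den_le: "\<And>i x. \<bar>x\<bar> \<le> 1 \<Longrightarrow> \<gamma> i * x + \<delta> i \<le> hi"
begin

definition num :: "nat \<Rightarrow> real \<Rightarrow> real" where "num i x = \<alpha> i * x + \<beta> i"
definition den :: "nat \<Rightarrow> real \<Rightarrow> real" where "den i x = \<gamma> i * x + \<delta> i"
definition g :: "nat \<Rightarrow> real \<Rightarrow> real" where "g i x = num i x / den i x"

fun Z :: "nat list \<Rightarrow> real \<Rightarrow> real" where
  "Z [] x = x" | "Z (i # w) x = g i (Z w x)"

text \<open>The automorphy factor: the matrix product along \<open>w\<close> sends
  \<open>(x, 1)\<close> to \<open>Q w x\<close> times \<open>(Z w x, 1)\<close>. It retains the size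
  of the product, which the orbit \<open>Z\<close> forgets.\<close>

fun Q :: "nat list \<Rightarrow> real \<Rightarrow> real" where
  "Q [] x = 1" | "Q (i # w) x = den i (Z w x) * Q w x"

lemma den_pos: "\<bar>x\<bar> \<le> 1 \<Longrightarrow> den i x > 0"
  using den_ge lo_pos unfolding den_def by (meson less_le_trans)

lemma hi_pos: "hi > 0"
  using den_ge[of 0 0] den_le[of 0 0] lo_pos by simp

lemma g_bound: "\<bar>x\<bar> \<le> 1 \<Longrightarrow> \<bar>g i x\<bar> \<le> r"
  using contr[of x i] den_pos[of x i] unfolding g_def num_def
  by (simp add: abs_divide pos_divide_le_eq den_def)

lemma Z_bound: "\<bar>x\<bar> \<le> 1 \<Longrightarrow> \<bar>Z w x\<bar> \<le> 1"
proof (induction w)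
  case (Cons i w)
  then show ?case using g_bound[of "Z w x" i] r_less by simp
qed simp

lemma Z_bound_r: "\<bar>x\<bar> \<le> r \<Longrightarrow> \<bar>Z w x\<bar> \<le> r"
  using r_less Z_bound[of x] by (cases w) (auto intro!: g_bound)

lemma Q_pos: "\<bar>x\<bar> \<le> 1 \<Longrightarrow> Q w x > 0"
  by (induction w) (simp_all add: den_pos Z_bound)

lemma Z_append: "Z (u @ v) x = Z u (Z v x)"
  by (induction u) simp_all

lemma Q_append: "Q (u @ v) x = Q u (Z v x) * Q v x"
  by (induction u) (simp_all add: Z_append)

text \<open>\<open>Q w x * Z w x\<close> and \<open>Q w x\<close> are the two components of a matrix
  product applied to \<open>(x, 1)\<close>, hence affine in \<open>x\<close>. The induction carries
  both, since a further letter mixes them.\<close>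

lemma Q_affine:
  "\<exists>c d a e. \<forall>x. \<bar>x\<bar> \<le> 1 \<longrightarrow> Q w x = c * x + d \<and> Q w x * Z w x = a * x + e"
proof (induction w)
  case Nil
  show ?case by (rule exI[of _ 0], rule exI[of _ 1], rule exI[of _ 1], rule exI[of _ 0]) simp
next
  case (Cons i w)
  then obtain c d a e where IH: "\<And>x. \<bar>x\<bar> \<le> 1 \<Longrightarrow> Q w x = c * x + d"
    "\<And>x. \<bar>x\<bar> \<le> 1 \<Longrightarrow> Q w x * Z w x = a * x + e" by blast
  have 1: "Q (i # w) x = (\<gamma> i * a + \<delta> i * c) * x + (\<gamma> i * e + \<delta> i * d)" if "\<bar>x\<bar> \<le> 1" for x
  proof -
    have "Q (i # w) x = \<gamma> i * (Q w x * Z w x) + \<delta> i * Q w x"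
      by (simp add: den_def algebra_simps)
    then show ?thesis unfolding IH(2)[OF that] unfolding IH(1)[OF that] by (simp add: algebra_simps)
  qed
  have 2: "Q (i # w) x * Z (i # w) x = (\<alpha> i * a + \<beta> i * c) * x + (\<alpha> i * e + \<beta> i * d)"
    if "\<bar>x\<bar> \<le> 1" for x
  proof -
    have "Q (i # w) x * Z (i # w) x = num i (Z w x) * Q w x"
      using den_pos[OF Z_bound[OF that], of i w] by (simp add: g_def)
    also have "\<dots> = \<alpha> i * (Q w x * Z w x) + \<beta> i * Q w x"
      by (simp add: num_def algebra_simps)
    finally show ?thesis unfolding IH(2)[OF that] unfolding IH(1)[OF that] by (simp add: algebra_simps)
  qed
  show ?case using 1 2 by blast
qed

text \<open>An affine function that is positive at 1 and at -1 has a slope whose absolute value is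
  at most its value at 0.\<close>

lemma Q_bounds:
  assumes "\<bar>x\<bar> \<le> r"
  shows "(1 - r) * Q w 0 \<le> Q w x" "Q w x \<le> (1 + r) * Q w 0"
proof -
  obtain c d where cd: "\<And>x. \<bar>x\<bar> \<le> 1 \<Longrightarrow> Q w x = c * x + d"
    using Q_affine[of w] by blast
  have d: "Q w 0 = d" using cd[of 0] by simp
  have "\<bar>c\<bar> \<le> d"
    using Q_pos[of 1 w] Q_pos[of "-1" w] cd[of 1] cd[of "-1"] by (simp add: abs_le_iff)
  then have "\<bar>c * x\<bar> \<le> d * r"
    using assms r_nonneg unfolding abs_mult by (intro mult_mono) auto
  moreover have "Q w x = c * x + d" using cd assms r_less by simp
  ultimately show "(1 - r) * Q w 0 \<le> Q w x" "Q w x \<le> (1 + r) * Q w 0"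
    unfolding d by (auto simp: algebra_simps abs_le_iff)
qed

definition log_Q :: "nat list \<Rightarrow> real" where "log_Q w = ln (Q w 0)"

definition \<kappa> :: real where "\<kappa> = - ln (1 - r)"

text \<open>By the cocycle identity the error is the logarithm of the ratio of \<open>Q u\<close> at
  \<open>Z v 0\<close> and at 0, and \<open>Z v 0\<close> lies in \<open>[-r, r]\<close>. One
  constant serves both signs because \<open>(1 + r) * (1 - r) \<le> 1\<close>.\<close>

lemma log_Q_append: "\<bar>log_Q (u @ v) - log_Q u - log_Q v\<bar> \<le> \<kappa>"
proof -
  have Z: "\<bar>Z v 0\<bar> \<le> r" using Z_bound_r[of 0 v] r_nonneg by simp
  have p: "Q u 0 > 0" "Q v 0 > 0" "Q u (Z v 0) > 0" using Q_pos Z_bound by simp_all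
  have "log_Q (u @ v) - log_Q u - log_Q v = ln (Q u (Z v 0)) - ln (Q u 0)"
    using p by (simp add: log_Q_def Q_append ln_mult)
  also have "\<dots> = ln (Q u (Z v 0) / Q u 0)" using p by (simp add: ln_div)
  finally have *: "log_Q (u @ v) - log_Q u - log_Q v = ln (Q u (Z v 0) / Q u 0)" .
  have q: "1 - r \<le> Q u (Z v 0) / Q u 0" "Q u (Z v 0) / Q u 0 \<le> 1 + r"
    using Q_bounds[OF Z, of u] p by (simp_all add: pos_le_divide_eq pos_divide_le_eq)
  have "ln (1 - r) \<le> ln (Q u (Z v 0) / Q u 0)" using q r_less p by simp
  moreover have "ln (Q u (Z v 0) / Q u 0) \<le> ln (1 + r)" using q r_nonneg p by simp
  moreover have "ln (1 + r) \<le> - ln (1 - r)"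
  proof -
    have "ln (1 + r) + ln (1 - r) = ln ((1 + r) * (1 - r))"
      using r_nonneg r_less by (simp add: ln_mult)
    also have "\<dots> \<le> 0"
    proof -
      have "(1 + r) * (1 - r) = 1 - r * r" by (simp add: algebra_simps)
      moreover have "r * r < 1" using r_nonneg r_less mult_strict_mono[of r 1 r 1] by simp
      ultimately show ?thesis using r_nonneg by simp
    qed
    finally show ?thesis by simp
  qed
  ultimately show ?thesis unfolding * \<kappa>_def by (simp add: abs_le_iff)
qed

definition M :: real where "M = max \<bar>ln lo\<bar> \<bar>ln hi\<bar>"

lemma ln_den_bound: "\<bar>x\<bar> \<le> 1 \<Longrightarrow> \<bar>ln (den i x)\<bar> \<le> M"
proof -
  assume x: "\<bar>x\<bar> \<le> 1"
  have "ln lo \<le> ln (den i x)" "ln (den i x) \<le> ln hi"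
    using den_ge[OF x, of i] den_le[OF x, of i] den_pos[OF x, of i] lo_pos hi_pos
    by (simp_all add: den_def)
  then show ?thesis unfolding M_def by linarith
qed

lemma log_Q_Cons: "log_Q (i # w) = ln (den i (Z w 0)) + log_Q w"
  unfolding log_Q_def using Q_pos[of 0 w] den_pos[OF Z_bound, of 0 i w] by (simp add: ln_mult)

lemma log_Q_bound: "\<bar>log_Q w\<bar> \<le> real (length w) * M"
proof (induction w)
  case (Cons i w)
  then show ?case using ln_den_bound[OF Z_bound, of 0 i w] by (simp add: log_Q_Cons algebra_simps)
qed (simp add: log_Q_def)

text \<open>The pseudo-hyperbolic distance \<open>\<bar>x - y\<bar> / (1 - x * y)\<close> between
  \<open>r\<close> and \<open>-r\<close>, the ends of the interval that contains all images; it
  turns out to be a contraction factor for that distance.\<close>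

definition \<theta> :: real where "\<theta> = 2 * r / (1 + r\<^sup>2)"

lemma theta: "0 \<le> \<theta>" "\<theta> < 1"
proof -
  have p: "1 + r\<^sup>2 > 0" by (simp add: add_pos_nonneg)
  show "0 \<le> \<theta>" using r_nonneg p by (simp add: \<theta>_def)
  have "(1 - r)\<^sup>2 > 0" using r_less by simp
  then have "2 * r < 1 + r\<^sup>2" by (simp add: power2_eq_square algebra_simps)
  then show "\<theta> < 1" using p by (simp add: \<theta>_def pos_divide_less_eq)
qed

text \<open>Both sides are affine in \<open>x\<close> and in \<open>y\<close>, so only the corners of the square need checking.\<close>

lemma schwarz_pick_bilinear:
  assumes "\<bar>x\<bar> \<le> 1" "\<bar>y\<bar> \<le> 1"
  shows "\<bar>\<alpha> i * \<delta> i - \<beta> i * \<gamma> i\<bar> * (1 - x * y) \<le> \<theta> * (den i x * den i y - num i x * num i y)"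
proof -
  define D where "D = \<bar>\<alpha> i * \<delta> i - \<beta> i * \<gamma> i\<bar>"
  define f where "f = (\<lambda>x y. \<theta> * (den i x * den i y - num i x * num i y) - D * (1 - x * y))"
  define s1 s2 d1 d2 where "s1 = den i 1" "s2 = den i (-1)" "d1 = num i 1" "d2 = num i (-1)"
  note defs = this
  have b1: "s1 > 0" "s2 > 0" "\<bar>d1\<bar> \<le> r * s1" "\<bar>d2\<bar> \<le> r * s2"
    using contr[of 1 i] contr[of "-1" i] den_pos[of 1 i] den_pos[of "-1" i]
    by (simp_all add: defs den_def num_def)
  have b2: "\<bar>d1\<bar> \<le> s1" "\<bar>d2\<bar> \<le> s2"
    using b1 r_less mult_right_mono[of r 1 s1] mult_right_mono[of r 1 s2] by linarith+
  have sq: "\<bar>d1\<bar> * \<bar>d1\<bar> \<le> s1 * s1" "\<bar>d2\<bar> * \<bar>d2\<bar> \<le> s2 * s2"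
    using b2 by (auto intro!: mult_mono simp del: abs_mult_self_eq)
  \<comment> \<open>At these corners \<open>1 - x * y = 0\<close>, and the claim reduces to
    \<open>\<bar>num\<bar> \<le> den\<close>.\<close>
  have "f 1 1 \<ge> 0" "f (-1) (-1) \<ge> 0"
    using sq theta unfolding f_def defs by (simp_all flip: abs_mult)
  \<comment> \<open>This is for the corner \<open>(1, -1)\<close>, where twice the determinant is
    \<open>d1 * s2 - d2 * s1\<close>. Either sign of it is covered, by exchanging the two end
    points.\<close>
  have key: "(1 + r\<^sup>2) * (e1 * t2 - e2 * t1) \<le> 2 * r * (t1 * t2 - e1 * e2)"
    if "t1 > 0" "t2 > 0" "\<bar>e1\<bar> \<le> r * t1" "\<bar>e2\<bar> \<le> r * t2" for e1 e2 t1 t2 :: real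
  proof -
    have "2 * r * (t1 * t2 - e1 * e2) - (1 + r\<^sup>2) * (e1 * t2 - e2 * t1)
        = (r * t1 - e1) * (t2 * (1 + r\<^sup>2) + 2 * r * e2) + (1 - r\<^sup>2) * t1 * (r * t2 + e2)"
      by (simp add: algebra_simps power2_eq_square)
    moreover have "t2 * (1 + r\<^sup>2) + 2 * r * e2 \<ge> 0"
    proof -
      have "r * \<bar>e2\<bar> \<le> r * (r * t2)" using that r_nonneg by (intro mult_left_mono) auto
      moreover have "r * r * t2 \<le> t2"
        using r_nonneg r_less that by (simp add: mult_le_one)
      moreover have "- (r * \<bar>e2\<bar>) \<le> r * e2" using r_nonneg 
        using mult_left_mono[of "- \<bar>e2\<bar>" e2 r] by simp
      ultimately show ?thesis by (simp add: algebra_simps power2_eq_square)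
    qed
    moreover have "1 - r\<^sup>2 \<ge> 0" using r_nonneg r_less by (simp add: power_le_one)
    moreover have "r * t1 - e1 \<ge> 0" "r * t2 + e2 \<ge> 0" using that by (auto simp: abs_le_iff)
    ultimately have "0 \<le> 2 * r * (t1 * t2 - e1 * e2) - (1 + r\<^sup>2) * (e1 * t2 - e2 * t1)"
      using that(1) by simp
    then show ?thesis by simp
  qed
  have p: "1 + r\<^sup>2 > 0" by (simp add: add_pos_nonneg)
  have "(1 + r\<^sup>2) * (2 * D) \<le> 2 * r * (s1 * s2 - d1 * d2)"
  proof -
    have "d1 * s2 - d2 * s1 = 2 * (\<alpha> i * \<delta> i - \<beta> i * \<gamma> i)"
      by (simp add: defs den_def num_def algebra_simps)
    then have "2 * D = \<bar>d1 * s2 - d2 * s1\<bar>"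
      by (simp only: D_def abs_mult)
    then consider "2 * D = d1 * s2 - d2 * s1" | "2 * D = d2 * s1 - d1 * s2" by linarith
    then show ?thesis
    proof cases
      case 1
      then show ?thesis using key[OF b1] by simp
    next
      case 2
      then show ?thesis using key[OF b1(2,1,4,3)] by (simp add: mult.commute)
    qed
  qed
  then have "2 * D \<le> \<theta> * (s1 * s2 - d1 * d2)"
    using p by (simp add: \<theta>_def field_simps)
  then have "f 1 (-1) \<ge> 0" unfolding f_def defs by simp
  \<comment> \<open>Bilinear interpolation between the corners; \<open>f\<close> is symmetric, so
    the two mixed corners share one value.\<close>
  have "4 * f x y = (1 + x) * (1 + y) * f 1 1 + ((1 + x) * (1 - y) + (1 - x) * (1 + y)) * f 1 (-1)
      + (1 - x) * (1 - y) * f (-1) (-1)"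
    unfolding f_def den_def num_def by (simp add: algebra_simps)
  also have "\<dots> \<ge> 0"
    using assms \<open>f 1 1 \<ge> 0\<close> \<open>f (-1) (-1) \<ge> 0\<close> \<open>f 1 (-1) \<ge> 0\<close>
    by (auto simp: abs_le_iff intro!: add_nonneg_nonneg mult_nonneg_nonneg)
  finally have "f x y \<ge> 0" by simp
  then show ?thesis unfolding f_def D_def by simp
qed

text \<open>The difference \<open>g i x - g i y\<close> is the determinant times
  \<open>x - y\<close> over both denominators, and \<open>schwarz_pick_bilinear\<close> controls the
  determinant. The distance is kept in multiplied form, as a bound \<open>c\<close> next to
  \<open>1 - x * y\<close>, because \<open>1 - x * y\<close> vanishes for
  \<open>x = y = 1\<close>.\<close>

lemma g_contract:
  assumes "\<bar>x\<bar> \<le> 1" "\<bar>y\<bar> \<le> 1" "c \<ge> 0" "\<bar>x - y\<bar> \<le> c * (1 - x * y)"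
  shows "\<bar>g i x - g i y\<bar> \<le> \<theta> * c * (1 - g i x * g i y)"
proof -
  let ?D = "\<alpha> i * \<delta> i - \<beta> i * \<gamma> i"
  have p: "den i x > 0" "den i y > 0" using assms den_pos by auto
  have "g i x - g i y = ?D * (x - y) / (den i x * den i y)"
  proof -
    have "g i x - g i y = (num i x * den i y - num i y * den i x) / (den i x * den i y)"
      using p by (simp add: g_def divide_simps)
    also have "num i x * den i y - num i y * den i x = ?D * (x - y)"
      by (simp add: num_def den_def algebra_simps)
    finally show ?thesis .
  qed
  then have "\<bar>g i x - g i y\<bar> = \<bar>?D\<bar> * \<bar>x - y\<bar> / (den i x * den i y)"
    using p by (simp add: abs_mult)
  also have "\<dots> \<le> c * (\<theta> * (den i x * den i y - num i x * num i y)) / (den i x * den i y)"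
  proof (intro divide_right_mono)
    have "\<bar>?D\<bar> * \<bar>x - y\<bar> \<le> \<bar>?D\<bar> * (c * (1 - x * y))"
      using assms(4) by (intro mult_left_mono) auto
    also have "\<dots> = c * (\<bar>?D\<bar> * (1 - x * y))" by simp
    also have "\<dots> \<le> c * (\<theta> * (den i x * den i y - num i x * num i y))"
      using assms by (intro mult_left_mono schwarz_pick_bilinear) auto
    finally show "\<bar>?D\<bar> * \<bar>x - y\<bar> \<le> c * (\<theta> * (den i x * den i y - num i x * num i y))" .
  qed (use p in simp)
  also have "\<dots> = \<theta> * c * (1 - g i x * g i y)"
    using p by (simp add: g_def field_simps)
  finally show ?thesis .
qed

lemma Z_contract:
  assumes "\<bar>x\<bar> \<le> 1"
  shows "\<bar>Z w x - Z w 0\<bar> \<le> \<theta> ^ length w * (1 - Z w x * Z w 0)"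
proof (induction w)
  case (Cons i w)
  show ?case using g_contract[OF Z_bound Z_bound _ Cons] assms theta by simp
qed (use assms in simp)

section \<open>Mean growth and the Lyapunov exponent\<close>

definition \<Lambda> :: "nat \<Rightarrow> real" where "\<Lambda> n = avg b n log_Q"
definition growth :: "nat \<Rightarrow> real" where "growth n = \<Lambda> (Suc n) - \<Lambda> n"

text \<open>A new head letter multiplies \<open>Q\<close> by a single denominator at the current
  orbit point, so the increment is the average of a function of \<open>Z w 0\<close> alone.\<close>

lemma growth_eq: "growth n = avg b n (\<lambda>w. (\<Sum>i<b. ln (den i (Z w 0))) / real b)"
proof -
  have "\<Lambda> (Suc n) = (\<Sum>i<b. avg b n (\<lambda>w. ln (den i (Z w 0)))) / real b + \<Lambda> n"
    using b_pos by (simp add: \<Lambda>_def log_Q_Cons avg_add sum.distrib add_divide_distrib)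
  moreover have "avg b n (\<lambda>w. (\<Sum>i<b. ln (den i (Z w 0))) / real b)
      = (\<Sum>i<b. avg b n (\<lambda>w. ln (den i (Z w 0)))) / real b"
    using avg_cmult[of b n "1 / real b" "\<lambda>w. \<Sum>i<b. ln (den i (Z w 0))"]
    by (simp add: avg_sum)
  ultimately show ?thesis by (simp add: growth_def)
qed

lemma ln_den_diff:
  assumes "\<bar>x\<bar> \<le> 1" "\<bar>y\<bar> \<le> 1"
  shows "\<bar>ln (den i x) - ln (den i y)\<bar> \<le> hi / lo * \<bar>x - y\<bar>"
proof -
  have gam: "\<bar>\<gamma> i\<bar> \<le> hi"
    using den_le[of 1 i] den_le[of "-1" i] den_ge[of 1 i] den_ge[of "-1" i] lo_pos
    by (simp add: abs_le_iff)
  have *: "ln (den i x) - ln (den i y) \<le> hi / lo * \<bar>x - y\<bar>" if "\<bar>x\<bar> \<le> 1" "\<bar>y\<bar> \<le> 1" for x y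
  proof -
    have p: "den i x > 0" "den i y > 0" using that den_pos by auto
    have "ln (den i x) - ln (den i y) = ln (den i x / den i y)" using p by (simp add: ln_div)
    also have "\<dots> \<le> den i x / den i y - 1" using p by (intro ln_le_minus_one) simp
    also have "\<dots> = \<gamma> i * (x - y) / den i y" using p by (simp add: den_def field_simps)
    also have "\<dots> \<le> hi * \<bar>x - y\<bar> / lo"
    proof (intro frac_le)
      have "\<gamma> i * (x - y) \<le> \<bar>\<gamma> i\<bar> * \<bar>x - y\<bar>" by (metis abs_ge_self abs_mult)
      also have "\<dots> \<le> hi * \<bar>x - y\<bar>" using gam by (intro mult_right_mono) auto
      finally show "\<gamma> i * (x - y) \<le> hi * \<bar>x - y\<bar>" .
    qed (use lo_pos hi_pos den_ge[of y i] that in \<open>auto simp: den_def\<close>)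
    finally show ?thesis by simp
  qed
  show ?thesis using *[of x y] *[of y x] assms by (auto simp: abs_le_iff abs_minus_commute)
qed

definition C1 :: real where "C1 = 2 * hi / lo"

text \<open>The additional letter of the longer words is split off at the innermost end. There it
  merely moves the starting point from 0 to \<open>g j 0\<close>, which the outer letters forget at
  rate \<open>\<theta> ^ n\<close>.\<close>

lemma growth_diff: "\<bar>growth (Suc n) - growth n\<bar> \<le> C1 * \<theta> ^ n"
proof -
  define h where "h = (\<lambda>x. (\<Sum>i<b. ln (den i x)) / real b)"
  have hdiff: "\<bar>h x - h y\<bar> \<le> hi / lo * \<bar>x - y\<bar>" if "\<bar>x\<bar> \<le> 1" "\<bar>y\<bar> \<le> 1" for x y
  proof -
    have "\<bar>h x - h y\<bar> = \<bar>\<Sum>i<b. ln (den i x) - ln (den i y)\<bar> / real b"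
      using b_pos by (simp add: h_def sum_subtractf diff_divide_distrib[symmetric])
    also have "\<dots> \<le> (\<Sum>i<b. \<bar>ln (den i x) - ln (den i y)\<bar>) / real b"
      by (intro divide_right_mono sum_abs) simp
    also have "\<dots> \<le> (\<Sum>i<b. hi / lo * \<bar>x - y\<bar>) / real b"
      using that by (intro divide_right_mono sum_mono ln_den_diff) auto
    also have "\<dots> = hi / lo * \<bar>x - y\<bar>" using b_pos by simp
    finally show ?thesis .
  qed
  have "growth (Suc n) - growth n = avg b n (\<lambda>w. (\<Sum>j<b. h (Z (w @ [j]) 0)) / real b - h (Z w 0))"
    unfolding avg_diff growth_eq avg_Suc_right h_def by simp
  also have "\<bar>\<dots>\<bar> \<le> C1 * \<theta> ^ n"
  proof (rule avg_abs_le[OF b_pos])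
    fix w :: "nat list" assume len: "length w = n"
    have "\<bar>(\<Sum>j<b. h (Z (w @ [j]) 0)) / real b - h (Z w 0)\<bar>
        = \<bar>\<Sum>j<b. h (Z (w @ [j]) 0) - h (Z w 0)\<bar> / real b"
      using b_pos by (simp add: sum_subtractf field_simps)
    also have "\<dots> \<le> (\<Sum>j<b. \<bar>h (Z (w @ [j]) 0) - h (Z w 0)\<bar>) / real b"
      by (intro divide_right_mono sum_abs) simp
    also have "\<dots> \<le> (\<Sum>j<b. C1 * \<theta> ^ n) / real b"
    proof (intro divide_right_mono sum_mono)
      fix j
      have gj: "\<bar>g j 0\<bar> \<le> 1" using g_bound[of 0 j] r_less by simp
      have Zb: "\<bar>Z w (g j 0)\<bar> \<le> 1" "\<bar>Z w 0\<bar> \<le> 1" using gj Z_bound by auto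
      then have "\<bar>Z w (g j 0) * Z w 0\<bar> \<le> 1" by (simp add: abs_mult mult_le_one)
      then have "1 - Z w (g j 0) * Z w 0 \<le> 2" by (simp add: abs_le_iff)
      then have "\<bar>Z w (g j 0) - Z w 0\<bar> \<le> \<theta> ^ n * 2"
        using Z_contract[OF gj, of w] len theta
        by (intro order_trans[OF Z_contract[OF gj]]) (simp add: mult_left_mono)
      then have "hi / lo * \<bar>Z w (g j 0) - Z w 0\<bar> \<le> hi / lo * (\<theta> ^ n * 2)"
        using hi_pos lo_pos by (intro mult_left_mono) auto
      then show "\<bar>h (Z (w @ [j]) 0) - h (Z w 0)\<bar> \<le> C1 * \<theta> ^ n"
        using hdiff[OF Zb] unfolding Z_append C1_def Z.simps by argo
    qed simp
    also have "\<dots> = C1 * \<theta> ^ n" using b_pos by simp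
    finally show "\<bar>(\<Sum>j<b. h (Z (w @ [j]) 0)) / real b - h (Z w 0)\<bar> \<le> C1 * \<theta> ^ n" .
  qed
  finally show ?thesis .
qed

definition lyap :: real where "lyap = lim growth"

lemma growth_increment_summable: "summable (\<lambda>n. growth (Suc n) - growth n)"
proof (rule summable_comparison_test'[where N = 0])
  show "summable (\<lambda>n. C1 * \<theta> ^ n)" using theta by (intro summable_mult summable_geometric) simp
qed (use growth_diff in simp)

lemma growth_tendsto: "growth \<longlonglongrightarrow> lyap"
proof -
  have "(\<lambda>n. \<Sum>k<n. growth (Suc k) - growth k) \<longlonglongrightarrow> (\<Sum>n. growth (Suc n) - growth n)"
    using growth_increment_summable by (rule summable_LIMSEQ)
  then have "(\<lambda>n. growth n - growth 0 + growth 0) \<longlonglongrightarrow> (\<Sum>n. growth (Suc n) - growth n) + growth 0"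
    unfolding sum_lessThan_telescope by (rule tendsto_add) simp
  then have "growth \<longlonglongrightarrow> (\<Sum>n. growth (Suc n) - growth n) + growth 0" by simp
  then show ?thesis unfolding lyap_def by (simp add: limI)
qed

definition C2 :: real where "C2 = C1 / (1 - \<theta>) / (1 - \<theta>)"

lemma growth_lyap: "\<bar>growth n - lyap\<bar> \<le> C1 / (1 - \<theta>) * \<theta> ^ n"
proof -
  have "\<bar>growth (n + m) - growth n\<bar> \<le> C1 / (1 - \<theta>) * \<theta> ^ n" for m
  proof -
    have "growth (n + m) - growth n = (\<Sum>k<m. growth (Suc (n + k)) - growth (n + k))"
      using sum_lessThan_telescope[of "\<lambda>k. growth (n + k)" m] by simp
    also have "\<bar>\<dots>\<bar> \<le> (\<Sum>k<m. C1 * \<theta> ^ (n + k))"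
      by (rule order_trans[OF sum_abs]) (intro sum_mono growth_diff)
    also have "\<dots> = C1 * \<theta> ^ n * (\<Sum>k<m. \<theta> ^ k)"
      by (simp add: sum_distrib_left power_add mult.assoc)
    also have "\<dots> \<le> C1 * \<theta> ^ n * (1 / (1 - \<theta>))"
    proof (intro mult_left_mono)
      show "(\<Sum>k<m. \<theta> ^ k) \<le> 1 / (1 - \<theta>)"
        using theta sum_le_suminf[of "\<lambda>k. \<theta> ^ k" "{..<m}"] suminf_geometric[of \<theta>]
        by (simp add: summable_geometric)
      show "0 \<le> C1 * \<theta> ^ n" using theta hi_pos lo_pos by (simp add: C1_def)
    qed
    finally show ?thesis by simp
  qed
  moreover have "(\<lambda>m. \<bar>growth (n + m) - growth n\<bar>) \<longlonglongrightarrow> \<bar>lyap - growth n\<bar>"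
    using LIMSEQ_ignore_initial_segment[OF growth_tendsto, of n]
    by (intro tendsto_intros) (simp add: add.commute)
  ultimately have "\<bar>lyap - growth n\<bar> \<le> C1 / (1 - \<theta>) * \<theta> ^ n"
    by (intro LIMSEQ_le_const2) auto
  then show ?thesis by (simp add: abs_minus_commute)
qed

text \<open>Geometric errors sum to a bound independent of \<open>n\<close>. As the linear term of
  an exponential moment, this bias becomes negligible per letter on long blocks.\<close>

lemma Lambda_lyap: "\<bar>\<Lambda> n - real n * lyap\<bar> \<le> C2"
proof -
  have "\<Lambda> 0 = 0" by (simp add: \<Lambda>_def log_Q_def)
  then have "\<Lambda> n - real n * lyap = (\<Sum>k<n. growth k - lyap)"
    using sum_lessThan_telescope[of \<Lambda> n] by (simp add: growth_def sum_subtractf)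
  also have "\<bar>\<dots>\<bar> \<le> (\<Sum>k<n. C1 / (1 - \<theta>) * \<theta> ^ k)"
    by (rule order_trans[OF sum_abs]) (intro sum_mono growth_lyap)
  also have "\<dots> = C1 / (1 - \<theta>) * (\<Sum>k<n. \<theta> ^ k)" by (simp add: sum_distrib_left)
  also have "\<dots> \<le> C1 / (1 - \<theta>) * (1 / (1 - \<theta>))"
  proof (intro mult_left_mono)
    show "(\<Sum>k<n. \<theta> ^ k) \<le> 1 / (1 - \<theta>)"
      using theta sum_le_suminf[of "\<lambda>k. \<theta> ^ k" "{..<n}"] suminf_geometric[of \<theta>]
      by (simp add: summable_geometric)
    show "0 \<le> C1 / (1 - \<theta>)" using theta hi_pos lo_pos by (simp add: C1_def)
  qed
  finally show ?thesis by (simp add: C2_def)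
qed

end

section \<open>The operator on logarithmic series\<close>

lemma negative_binomial_sums:
  fixes y :: real
  assumes "\<bar>y\<bar> < 1"
  shows "(\<lambda>m. real (m + l choose l) * y ^ m) sums (1 / (1 - y) ^ Suc l)"
proof -
  have "(\<lambda>n. (- real (Suc l) gchoose n) * (- y) ^ n) sums (1 + - y) powr (- real (Suc l))"
    using assms by (intro gen_binomial_real) simp
  moreover have "(- real (Suc l) gchoose n) * (- y) ^ n = real (n + l choose l) * y ^ n" for n
  proof -
    have "(- real (Suc l) gchoose n) = (- 1) ^ n * ((real (Suc l) + real n - 1) gchoose n)"
      by (rule gbinomial_minus)
    moreover
    have "(real (Suc l) + real n - 1) gchoose n = real (n + l choose n)"
      by (simp add: binomial_gbinomial algebra_simps)
    moreover have "n + l choose n = n + l choose l"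
      using binomial_symmetric[of n "n + l"] by simp
    moreover have "(- 1) ^ n * (- y) ^ n = y ^ n" by (simp flip: power_mult_distrib)
    ultimately show ?thesis by (simp add: mult_ac)
  qed
  moreover have "(1 + - y) powr (- real (Suc l)) = 1 / (1 - y) ^ Suc l"
    using assms by (simp add: powr_minus divide_inverse powr_realpow flip: of_nat_Suc del: power_Suc of_nat_Suc)
  ultimately show ?thesis by simp
qed

text \<open>The identity \<open>(m choose l) / m = (m - 1 choose l - 1) / l\<close> reduces this to
  the negative binomial series, shifted by \<open>l\<close> because the terms with
  \<open>m < l\<close> vanish.\<close>

lemma binomial_log_sums:
  fixes a x :: real
  assumes "\<bar>a * x\<bar> < 1" "l > 0"
  shows "(\<lambda>m. real (m choose l) * a ^ (m - l) * v_seq x 0 m) sums (- ((- x / (1 + a * x)) ^ l / real l))"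
proof -
  obtain l' where l: "l = Suc l'" using assms(2) by (cases l) auto
  have "(\<lambda>m. (- ((- x) ^ l / real l)) * (real (m + l' choose l') * (- (a * x)) ^ m)) sums
      ((- ((- x) ^ l / real l)) * (1 / (1 - (- (a * x))) ^ Suc l'))"
    using assms by (intro sums_mult negative_binomial_sums) simp
  moreover have "(- ((- x) ^ l / real l)) * (real (m + l' choose l') * (- (a * x)) ^ m)
      = real (m + l choose l) * a ^ (m + l - l) * v_seq x 0 (m + l)" for m
  proof -
    have "l * (m + l choose l) = (m + l) * (m + l' choose l')"
      using times_binomial_minus1_eq[of l "m + l"] l by simp
    then have "real l * real (m + l choose l) = real (m + l) * real (m + l' choose l')"
      unfolding of_nat_mult[symmetric] by (simp only:)
    moreover have nz: "real l \<noteq> 0" "real (m + l) \<noteq> 0" using assms(2) by simp_all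
    ultimately have "real (m + l' choose l') / real l = real (m + l choose l) / real (m + l)"
      unfolding nonzero_divide_eq_eq[OF nz(1)] using nz(2)
      by (simp add: mult.commute del: of_nat_add)
    moreover have "(- (a * x)) ^ m = a ^ m * (- x) ^ m" by (metis mult_minus_right power_mult_distrib)
    ultimately show ?thesis
      using assms(2) by (simp add: v_seq_def power_add divide_simps mult_ac del: of_nat_add)
  qed
  ultimately have "(\<lambda>m. real (m + l choose l) * a ^ (m + l - l) * v_seq x 0 (m + l)) sums
      (- ((- x) ^ l / real l) * (1 / (1 - (- (a * x))) ^ Suc l'))" by simp
  moreover have "- ((- x) ^ l / real l) * (1 / (1 - (- (a * x))) ^ Suc l')
      = - ((- x / (1 + a * x)) ^ l / real l)"
  proof -
    have "(- x / (1 + a * x)) ^ l = (- x) ^ l / (1 + a * x) ^ l" by (rule power_divide)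
    then show ?thesis by (simp add: l del: power_Suc of_nat_Suc)
  qed
  ultimately show ?thesis
    by (subst sums_zero_iff_shift[of l, symmetric]) (auto simp: binomial_eq_0)
qed

lemma log_sums:
  fixes a x :: real
  assumes "\<bar>a * x\<bar> < 1"
  shows "(\<lambda>m. (if m = 0 then 0 else a ^ m) * v_seq x c m) sums ln (1 + a * x)"
proof -
  have "(\<lambda>m. - ((- (a * x)) ^ m) / of_nat m) sums ln (1 + a * x)"
    using assms by (rule ln_series')
  moreover have "- ((- (a * x)) ^ m) / of_nat m = (if m = 0 then 0 else a ^ m) * v_seq x c m" for m
  proof -
    have "(- (a * x)) ^ m = a ^ m * (- x) ^ m" by (metis mult_minus_right power_mult_distrib)
    then show ?thesis by (simp add: v_seq_def)
  qed
  ultimately show ?thesis by simp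
qed

text \<open>In \<open>g(x) = c + d * x / (1 + a * x)\<close> the parameters \<open>c\<close>,
  \<open>d\<close>, \<open>a\<close> are \<open>g(0)\<close>, \<open>g'(0)\<close> and
  \<open>g\<^sup>\<top>(0)\<close>. Summing over \<open>m\<close> for fixed \<open>l\<close> gives
  powers of \<open>t = - x / (1 + a * x)\<close>; since
  \<open>(k - 1 choose l - 1) / l = (k choose l) / k\<close>, the sum over \<open>l\<close> is the
  binomial expansion of \<open>(d * t - c) ^ k\<close> without its term \<open>l = 0\<close>, and
  that term is the subtracted \<open>v_seq c\<close>. The constants \<open>c'\<close>,
  \<open>e\<close>, \<open>e'\<close> are arbitrary because no 0-th coordinate contributes.\<close>

lemma v_seq_moebius_sums:
  fixes a c d x :: real
  assumes "\<bar>a * x\<bar> < 1" "k > 0"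
  shows "(\<lambda>m. (if m = 0 then 0 else \<Sum>l=1..min k m. real (m choose l) * real ((k - 1) choose (l - 1)) *
             a ^ (m - l) * (- c) ^ (k - l) * d ^ l) * v_seq x c' m)
         sums (v_seq (c + d * x / (1 + a * x)) e k - v_seq c e' k)"
proof -
  define t where "t = - x / (1 + a * x)"
  have "(\<lambda>m. \<Sum>l=1..k. (real ((k - 1) choose (l - 1)) * (- c) ^ (k - l) * d ^ l) *
           (real (m choose l) * a ^ (m - l) * v_seq x 0 m))
      sums (\<Sum>l=1..k. (real ((k - 1) choose (l - 1)) * (- c) ^ (k - l) * d ^ l) * (- (t ^ l / real l)))"
    unfolding t_def using assms by (intro sums_sum sums_mult binomial_log_sums) auto
  moreover have "(\<Sum>l=1..k. (real ((k - 1) choose (l - 1)) * (- c) ^ (k - l) * d ^ l) *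
           (real (m choose l) * a ^ (m - l) * v_seq x 0 m))
       = (if m = 0 then 0 else \<Sum>l=1..min k m. real (m choose l) * real ((k - 1) choose (l - 1)) *
             a ^ (m - l) * (- c) ^ (k - l) * d ^ l) * v_seq x c' m" for m
  proof (cases "m = 0")
    case True
    then show ?thesis by (simp add: v_seq_def)
  next
    case False
    have "(\<Sum>l=1..k. (real ((k - 1) choose (l - 1)) * (- c) ^ (k - l) * d ^ l) *
           (real (m choose l) * a ^ (m - l) * v_seq x 0 m))
        = (\<Sum>l=1..min k m. (real ((k - 1) choose (l - 1)) * (- c) ^ (k - l) * d ^ l) *
           (real (m choose l) * a ^ (m - l) * v_seq x 0 m))"
      by (rule sum.mono_neutral_right) (auto simp: binomial_eq_0)
    also have "\<dots> = (\<Sum>l=1..min k m. real (m choose l) * real ((k - 1) choose (l - 1)) *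
             a ^ (m - l) * (- c) ^ (k - l) * d ^ l * v_seq x c' m)"
      using False by (intro sum.cong refl) (simp add: v_seq_def)
    finally show ?thesis using False by (simp add: sum_distrib_right)
  qed
  moreover have "(\<Sum>l=1..k. (real ((k - 1) choose (l - 1)) * (- c) ^ (k - l) * d ^ l) * (- (t ^ l / real l)))
      = v_seq (c + d * x / (1 + a * x)) e k - v_seq c e' k"
  proof -
    have "(real ((k - 1) choose (l - 1)) * (- c) ^ (k - l) * d ^ l) * (- (t ^ l / real l))
        = - (1 / real k) * (real (k choose l) * (d * t) ^ l * (- c) ^ (k - l))"
      if "l \<in> {1..k}" for l
    proof -
      have lk: "l > 0" "real l \<noteq> 0" "real k \<noteq> 0" using that assms(2) by auto
      have "l * (k choose l) = k * ((k - 1) choose (l - 1))"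
        using times_binomial_minus1_eq[of l k] lk(1) by simp
      then have "real l * real (k choose l) = real k * real (k - 1 choose (l - 1))"
        unfolding of_nat_mult[symmetric] by (simp only:)
      then have "real (k - 1 choose (l - 1)) / real l = real (k choose l) / real k"
        using lk(2,3) unfolding nonzero_divide_eq_eq[OF lk(2)] by (simp add: mult.commute)
      then have "real (k - 1 choose (l - 1)) / real l * ((- c) ^ (k - l) * (d * t) ^ l)
          = real (k choose l) / real k * ((- c) ^ (k - l) * (d * t) ^ l)" by simp
      then show ?thesis by (simp add: power_mult_distrib mult_ac)
    qed
    then have "(\<Sum>l=1..k. (real ((k - 1) choose (l - 1)) * (- c) ^ (k - l) * d ^ l) * (- (t ^ l / real l)))
        = - (1 / real k) * (\<Sum>l=1..k. real (k choose l) * (d * t) ^ l * (- c) ^ (k - l))"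
      unfolding sum_distrib_left by (rule sum.cong[OF refl])
    also have "(\<Sum>l=1..k. real (k choose l) * (d * t) ^ l * (- c) ^ (k - l))
        = (\<Sum>l\<le>k. real (k choose l) * (d * t) ^ l * (- c) ^ (k - l)) - (- c) ^ k"
      by (simp add: sum.atMost_shift atLeast1_atMost_eq_remove0 sum_diff1 atMost_atLeast0)
    also have "(\<Sum>l\<le>k. real (k choose l) * (d * t) ^ l * (- c) ^ (k - l)) = (d * t + - c) ^ k"
      by (rule binomial_ring[symmetric])
    also have "d * t + - c = - (c + d * x / (1 + a * x))"
      by (simp add: t_def)
    finally show ?thesis using assms(2)
      by (simp add: v_seq_def right_diff_distrib)
  qed
  ultimately show ?thesis by simp
qed

section \<open>The operator of a positive family along Moebius orbits\<close>

locale moebius_operator = moebius_cocycle +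
  fixes B :: "nat \<Rightarrow> real^2^2"
  assumes F_B: "\<And>i. F_matrix (B i) $ 1 $ 1 = \<alpha> i" "\<And>i. F_matrix (B i) $ 1 $ 2 = \<beta> i"
      "\<And>i. F_matrix (B i) $ 2 $ 1 = \<gamma> i" "\<And>i. F_matrix (B i) $ 2 $ 2 = \<delta> i"
    and det_nz: "\<And>i. \<alpha> i * \<delta> i - \<beta> i * \<gamma> i \<noteq> 0"
begin

lemma delta_pos: "\<delta> i > 0"
  using den_pos[of 0 i] by (simp add: den_def)

lemma at0_B: "at0 (B i) = \<beta> i / \<delta> i"
  by (simp add: at0_def moebius_fun_def F_B)

lemma at0_tr_B: "at0_tr (B i) = \<gamma> i / \<delta> i"
  by (simp add: at0_tr_def moebius_fun_def transpose_def F_B)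

lemma deriv0_B: "deriv0 (B i) = (\<alpha> i * \<delta> i - \<beta> i * \<gamma> i) / (\<delta> i)\<^sup>2"
proof -
  have "((\<lambda>x. (\<alpha> i * x + \<beta> i) / (\<gamma> i * x + \<delta> i)) has_field_derivative
      (\<alpha> i * \<delta> i - \<beta> i * \<gamma> i) / (\<delta> i)\<^sup>2) (at 0)"
    using delta_pos[of i] by (auto intro!: derivative_eq_intros simp: power2_eq_square)
  then show ?thesis
    unfolding deriv0_def moebius_fun_def[abs_def] F_B by (rule DERIV_imp_deriv)
qed

text \<open>\<open>deriv0 (B i)\<close> is the determinant divided by the square of
  \<open>\<delta> i\<close>. The nonzero determinant makes the quotient that square and not 0 /
  0.\<close>

lemma log_const_B: "1/2 * ln (det (F_matrix (B i)) / deriv0 (B i)) = ln (\<delta> i)"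
proof -
  have "det (F_matrix (B i)) / deriv0 (B i) = (\<delta> i)\<^sup>2"
    using det_nz[of i] delta_pos[of i] by (simp add: det_2 F_B deriv0_B)
  then show ?thesis using delta_pos[of i] by (simp add: ln_realpow)
qed

text \<open>Positive denominators at 1 and -1 give
  \<open>\<bar>\<gamma> i\<bar> < \<delta> i\<close>, so the series converge even at the end points
  of \<open>[-1, 1]\<close>.\<close>

lemma tr_bound: "\<bar>x\<bar> \<le> 1 \<Longrightarrow> \<bar>\<gamma> i / \<delta> i * x\<bar> < 1"
proof -
  assume x: "\<bar>x\<bar> \<le> 1"
  have "\<bar>\<gamma> i\<bar> < \<delta> i"
    using den_pos[of 1 i] den_pos[of "-1" i] by (simp add: den_def abs_less_iff)
  then have "\<bar>\<gamma> i\<bar> / \<delta> i < 1" using delta_pos[of i] by simp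
  moreover have "\<bar>\<gamma> i / \<delta> i * x\<bar> \<le> \<bar>\<gamma> i\<bar> / \<delta> i * 1"
    unfolding abs_mult using x delta_pos[of i] by (intro mult_mono) auto
  ultimately show ?thesis by simp
qed

lemma g_expand: "\<bar>x\<bar> \<le> 1 \<Longrightarrow> \<beta> i / \<delta> i + deriv0 (B i) * x / (1 + \<gamma> i / \<delta> i * x) = g i x"
proof -
  assume x: "\<bar>x\<bar> \<le> 1"
  have d: "\<delta> i > 0" "\<gamma> i * x + \<delta> i > 0" using delta_pos den_pos[OF x, of i] by (auto simp: den_def)
  have "1 + \<gamma> i / \<delta> i * x = (\<gamma> i * x + \<delta> i) / \<delta> i" using d by (simp add: field_simps)
  then have "\<beta> i / \<delta> i + deriv0 (B i) * x / (1 + \<gamma> i / \<delta> i * x)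
      = \<beta> i / \<delta> i + (\<alpha> i * \<delta> i - \<beta> i * \<gamma> i) * x / (\<delta> i * (\<gamma> i * x + \<delta> i))"
    using d by (simp add: deriv0_B power2_eq_square)
  also have "\<dots> = (\<beta> i * (\<gamma> i * x + \<delta> i) + (\<alpha> i * \<delta> i - \<beta> i * \<gamma> i) * x) / (\<delta> i * (\<gamma> i * x + \<delta> i))"
    using d by (simp add: add_divide_distrib)
  also have "\<dots> = (\<delta> i * (\<alpha> i * x + \<beta> i)) / (\<delta> i * (\<gamma> i * x + \<delta> i))"
    by (simp add: algebra_simps)
  also have "\<dots> = g i x" using d by (simp add: g_def num_def den_def)
  finally show ?thesis .
qed

definition T :: "nat \<Rightarrow> nat \<Rightarrow> real" where "T = assoc_operator {..<b} (\<lambda>i. 1 / real b) B"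
definition v :: "nat \<Rightarrow> real" where "v = assoc_vector {..<b} (\<lambda>i. 1 / real b) B"

definition lc :: "nat \<Rightarrow> real \<Rightarrow> real" where "lc i x = ln (den i x) - ln (\<delta> i)"

text \<open>Coordinates \<open>k > 0\<close> follow from \<open>v_seq_moebius_sums\<close>;
  coordinate 0 is the series of \<open>ln (1 + \<gamma> i / \<delta> i * x)\<close>, the logarithm
  of the normalised denominator. The result does not contain \<open>c\<close>, because column 0 of
  \<open>T\<close> is zero.\<close>

lemma T_v_seq_sums:
  assumes x: "\<bar>x\<bar> \<le> 1"
  shows "(\<lambda>m. T k m * v_seq x c m) sums
    ((\<Sum>i<b. v_seq (g i x) (lc i x) k - v_seq (g i 0) 0 k) / real b)"
proof (cases "k = 0")
  case True
  have "(\<lambda>m. (if m = 0 then 0 else (\<gamma> i / \<delta> i) ^ m) * v_seq x c m) sums lc i x" for i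
  proof -
    have "1 + \<gamma> i / \<delta> i * x = den i x / \<delta> i"
      using delta_pos[of i] by (simp add: den_def field_simps)
    then show ?thesis using log_sums[OF tr_bound[OF x], of i c] den_pos[OF x, of i] delta_pos[of i]
      by (simp add: lc_def ln_div)
  qed
  then have "(\<lambda>m. (\<Sum>i<b. (if m = 0 then 0 else (\<gamma> i / \<delta> i) ^ m) * v_seq x c m) / real b) sums
     ((\<Sum>i<b. lc i x) / real b)"
    by (intro sums_divide sums_sum)
  moreover have "(\<Sum>i<b. (if m = 0 then 0 else (\<gamma> i / \<delta> i) ^ m) * v_seq x c m) / real b
      = T k m * v_seq x c m" for m
    using True by (auto simp: T_def assoc_operator_def at0_tr_B sum_distrib_right sum_divide_distrib)
  ultimately show ?thesis using True by (simp add: v_seq_def)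
next
  case False
  have "(\<lambda>m. (if m = 0 then 0 else \<Sum>l=1..min k m. real (m choose l) * real ((k - 1) choose (l - 1)) *
             (\<gamma> i / \<delta> i) ^ (m - l) * (- (\<beta> i / \<delta> i)) ^ (k - l) * deriv0 (B i) ^ l) * v_seq x c m)
     sums (v_seq (g i x) (lc i x) k - v_seq (g i 0) 0 k)" for i
    using v_seq_moebius_sums[OF tr_bound[OF x], of k i "\<beta> i / \<delta> i" "deriv0 (B i)" c "lc i x" 0] False
    unfolding g_expand[OF x] by (simp add: g_def num_def den_def)
  then have "(\<lambda>m. (\<Sum>i<b. (if m = 0 then 0 else \<Sum>l=1..min k m. real (m choose l) * real ((k - 1) choose (l - 1)) *
             (\<gamma> i / \<delta> i) ^ (m - l) * (- (\<beta> i / \<delta> i)) ^ (k - l) * deriv0 (B i) ^ l) * v_seq x c m) / real b)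
    sums ((\<Sum>i<b. v_seq (g i x) (lc i x) k - v_seq (g i 0) 0 k) / real b)"
    by (intro sums_divide sums_sum)
  moreover have "(\<Sum>i<b. (if m = 0 then 0 else \<Sum>l=1..min k m. real (m choose l) * real ((k - 1) choose (l - 1)) *
             (\<gamma> i / \<delta> i) ^ (m - l) * (- (\<beta> i / \<delta> i)) ^ (k - l) * deriv0 (B i) ^ l) * v_seq x c m) / real b
      = T k m * v_seq x c m" for m
    using False by (auto simp: T_def assoc_operator_def at0_tr_B at0_B sum_distrib_right sum_divide_distrib)
  ultimately show ?thesis by simp
qed

text \<open>Each application of \<open>T\<close> discards the previous 0-th coordinate, so only the
  contribution of the outermost letter survives.\<close>

fun hc :: "nat list \<Rightarrow> real" where "hc [] = 0" | "hc (i # w) = lc i (Z w 0)"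

definition U :: "nat \<Rightarrow> nat \<Rightarrow> real" where "U n k = avg b n (\<lambda>w. v_seq (Z w 0) (hc w) k)"

lemma U_0: "U 0 k = 0"
  by (simp add: U_def v_seq_def)

text \<open>An affine recursion: \<open>T\<close> sends \<open>U n\<close> to
  \<open>U (Suc n)\<close> minus the fixed source \<open>U 1\<close>, which collects the images of
  0. Hence \<open>T\<close> sends each difference of consecutive \<open>U n\<close> to the next
  difference.\<close>

lemma T_U_sums: "(\<lambda>m. T k m * U n m) sums (U (Suc n) k - U 1 k)"
proof -
  have "(\<lambda>m. avg b n (\<lambda>w. T k m * v_seq (Z w 0) (hc w) m)) sums
     avg b n (\<lambda>w. (\<Sum>i<b. v_seq (g i (Z w 0)) (lc i (Z w 0)) k - v_seq (g i 0) 0 k) / real b)"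
    by (intro sums_avg T_v_seq_sums Z_bound) simp
  moreover have "avg b n (\<lambda>w. T k m * v_seq (Z w 0) (hc w) m) = T k m * U n m" for m
    by (simp add: avg_cmult U_def)
  moreover have "avg b n (\<lambda>w. (\<Sum>i<b. v_seq (g i (Z w 0)) (lc i (Z w 0)) k - v_seq (g i 0) 0 k) / real b)
      = U (Suc n) k - U 1 k"
  proof -
    have "avg b n (\<lambda>w. (\<Sum>i<b. v_seq (g i (Z w 0)) (lc i (Z w 0)) k - v_seq (g i 0) 0 k) / real b)
        = (\<Sum>i<b. avg b n (\<lambda>w. v_seq (g i (Z w 0)) (lc i (Z w 0)) k)) / real b
          - (\<Sum>i<b. v_seq (g i 0) 0 k) / real b"
      using avg_cmult[of b n "1 / real b" "\<lambda>w. \<Sum>i<b. v_seq (g i (Z w 0)) (lc i (Z w 0)) k - v_seq (g i 0) 0 k"]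
        b_pos by (simp add: avg_sum avg_diff sum_subtractf diff_divide_distrib)
    moreover have "lc i 0 = 0" for i by (simp add: lc_def den_def)
    ultimately show ?thesis by (simp add: U_def)
  qed
  ultimately show ?thesis by simp
qed

definition mean_log :: real where "mean_log = (\<Sum>i<b. ln (\<delta> i)) / real b"

lemma v_eq: "v k = U 1 k + (if k = 0 then mean_log else 0)"
proof -
  have 1: "lc i 0 = 0" for i by (simp add: lc_def den_def)
  have "v k = (\<Sum>i<b. v_seq (g i 0) (ln (\<delta> i)) k) / real b"
    unfolding v_def assoc_vector_def log_const_B at0_B
    by (simp add: g_def num_def den_def sum_divide_distrib)
  moreover have "v_seq (g i 0) (ln (\<delta> i)) k = v_seq (g i 0) 0 k + (if k = 0 then ln (\<delta> i) else 0)" for i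
    by (simp add: v_seq_def)
  ultimately show ?thesis
    by (simp add: U_def 1 mean_log_def sum.distrib add_divide_distrib)
qed

lemma T_apply_sums:
  "(\<lambda>m. T k m * (U (Suc n) m - U n m + (if n = 0 \<and> m = 0 then mean_log else 0)))
     sums (U (Suc (Suc n)) k - U (Suc n) k)"
proof -
  have "(\<lambda>m. T k m * U (Suc n) m - T k m * U n m) sums
     ((U (Suc (Suc n)) k - U 1 k) - (U (Suc n) k - U 1 k))"
    by (intro sums_diff T_U_sums)
  moreover have "T k 0 = 0" by (simp add: T_def assoc_operator_def)
  then have "T k m * U (Suc n) m - T k m * U n m =
      T k m * (U (Suc n) m - U n m + (if n = 0 \<and> m = 0 then mean_log else 0))" for m
    by (auto simp: algebra_simps)
  ultimately show ?thesis by simp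
qed

text \<open>\<open>v\<close> is \<open>U 1\<close> plus \<open>mean_log\<close> in coordinate 0, and
  \<open>T\<close> annihilates the 0-th unit vector; so the correction is seen for
  \<open>n = 0\<close> only.\<close>

lemma T_iterate:
  "(mat_apply T ^^ n) v = (\<lambda>k. U (Suc n) k - U n k + (if n = 0 \<and> k = 0 then mean_log else 0))"
proof (induction n)
  case 0
  show ?case by (auto simp: v_eq U_0)
next
  case (Suc n)
  have "(mat_apply T ^^ Suc n) v k = (\<Sum>m. T k m * (mat_apply T ^^ n) v m)" for k
    by (simp add: mat_apply_def)
  then show ?case unfolding Suc by (simp add: sums_unique[OF T_apply_sums, symmetric] fun_eq_iff)
qed

lemma T_summable: "summable (\<lambda>m. T k m * (mat_apply T ^^ n) v m)"
  unfolding T_iterate by (rule sums_summable[OF T_apply_sums])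

lemma U_growth: "U (Suc n) 0 = growth n - mean_log"
proof -
  have "growth n = (\<Sum>i<b. avg b n (\<lambda>w. ln (den i (Z w 0)))) / real b"
    using avg_cmult[of b n "1 / real b" "\<lambda>w. \<Sum>i<b. ln (den i (Z w 0))"]
    by (simp add: growth_eq avg_sum)
  moreover have "U (Suc n) 0 = (\<Sum>i<b. avg b n (\<lambda>w. ln (den i (Z w 0))) - ln (\<delta> i)) / real b"
    using b_pos by (simp add: U_def v_seq_def lc_def avg_diff)
  ultimately show ?thesis by (simp add: mean_log_def sum_subtractf diff_divide_distrib)
qed

text \<open>The partial sums telescope, and \<open>mean_log\<close> restores the factors
  \<open>\<delta> i\<close> by which the denominators in \<open>U\<close> were normalised, so that
  exactly \<open>growth N\<close> remains.\<close>

theorem T_series_sums: "(\<lambda>n. (mat_apply T ^^ n) v 0) sums lyap"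
proof -
  have "(\<Sum>n<Suc N. (mat_apply T ^^ n) v 0) = growth N" for N
    unfolding T_iterate by (induction N) (simp_all add: U_growth U_0)
  then have "(\<lambda>N. \<Sum>n<Suc N. (mat_apply T ^^ n) v 0) \<longlonglongrightarrow> lyap"
    using growth_tendsto by (simp only:)
  then show ?thesis unfolding sums_def by (rule LIMSEQ_imp_Suc)
qed

end

section \<open>Almost sure growth\<close>

lemma exp_le_quadratic:
  fixes x :: real
  assumes "\<bar>x\<bar> \<le> 1"
  shows "exp x \<le> 1 + x + x\<^sup>2"
proof (cases "x \<ge> 0")
  case True
  then show ?thesis using assms by (intro exp_bound) auto
next
  case False
  have "1 - x \<le> exp (- x)" using exp_ge_add_one_self[of "- x"] by simp
  then have "1 / exp (- x) \<le> 1 / (1 - x)" using False by (intro frac_le) auto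
  then have "exp x \<le> 1 / (1 - x)" by (simp add: exp_minus inverse_eq_divide)
  also have "\<dots> \<le> 1 + x + x\<^sup>2"
  proof -
    have "(1 + x + x\<^sup>2) * (1 - x) = 1 + x\<^sup>2 * (- x)" by (simp add: algebra_simps power2_eq_square)
    moreover have "x\<^sup>2 * (- x) \<ge> 0" using False by (intro mult_nonneg_nonneg) auto
    ultimately show ?thesis using False by (simp add: pos_divide_le_eq)
  qed
  finally show ?thesis .
qed

text \<open>The least significant digit comes first, so that the head of a word acts last.\<close>

fun dig :: "nat \<Rightarrow> nat \<Rightarrow> nat \<Rightarrow> nat list" where
  "dig b 0 m = []"
| "dig b (Suc n) m = (m mod b) # dig b n (m div b)"

lemma length_dig [simp]: "length (dig b n m) = n"
  by (induction n arbitrary: m) simp_all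

lemma avg_eq_sum_dig:
  assumes "b > 0"
  shows "avg b n f = (\<Sum>m<b ^ n. f (dig b n m)) / real b ^ n"
proof (induction n arbitrary: f)
  case (Suc n)
  have "(\<Sum>m<b ^ Suc n. f (dig b (Suc n) m)) = (\<Sum>m<b ^ n. \<Sum>i<b. f (dig b (Suc n) (i + m * b)))"
    using sum_mult_product[of "\<lambda>m. f (dig b (Suc n) m)" "b ^ n" b] by (simp add: mult.commute)
  also have "\<dots> = (\<Sum>m<b ^ n. \<Sum>i<b. f (i # dig b n m))"
    using assms by simp
  also have "\<dots> = (\<Sum>i<b. \<Sum>m<b ^ n. f (i # dig b n m))" by (rule sum.swap)
  finally show ?case by (simp add: Suc sum_divide_distrib mult.commute)
qed simp

text \<open>The word of \<open>\<tau>\<close> is constant on each interval \<open>I m\<close>, so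
  the set is a finite union of intervals of length \<open>1 / b ^ n\<close>, and averaging over
  words is averaging over \<open>m < b ^ n\<close>. Borel-Cantelli requires only this upper
  bound.\<close>

lemma badic_measure:
  assumes b: "b > 0"
  shows "{\<tau> \<in> {0..<1::real}. P (dig b n (nat \<lfloor>real b ^ n * \<tau>\<rfloor>))} \<in> sets lborel" (is "?S \<in> _")
    and "emeasure lborel {\<tau> \<in> {0..<1::real}. P (dig b n (nat \<lfloor>real b ^ n * \<tau>\<rfloor>))}
        \<le> ennreal (avg b n (\<lambda>w. if P w then 1 else 0))"
proof -
  define I where "I = (\<lambda>m::nat. {real m / real b ^ n ..< (real m + 1) / real b ^ n})"
  define K where "K = {m. m < b ^ n \<and> P (dig b n m)}"
  have bn: "real b ^ n > 0" using b by simp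
  have floor: "nat \<lfloor>real b ^ n * \<tau>\<rfloor> = m" if "\<tau> \<in> I m" for \<tau> m
  proof -
    have "real m \<le> real b ^ n * \<tau>" "real b ^ n * \<tau> < real m + 1"
      using that bn by (simp_all add: I_def pos_divide_le_eq pos_less_divide_eq mult.commute)
    then have "\<lfloor>real b ^ n * \<tau>\<rfloor> = int m" by (intro floor_unique) auto
    then show ?thesis by simp
  qed
  have S: "?S = (\<Union>m\<in>K. I m)"
  proof (intro equalityI subsetI)
    fix \<tau> assume \<tau>: "\<tau> \<in> ?S"
    define m where "m = nat \<lfloor>real b ^ n * \<tau>\<rfloor>"
    have nn: "0 \<le> real b ^ n * \<tau>" using \<tau> bn by simp
    have m: "real m \<le> real b ^ n * \<tau>" "real b ^ n * \<tau> < real m + 1"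
      unfolding m_def using nn by (auto simp: of_nat_nat)
    have "real b ^ n * \<tau> < real b ^ n" using \<tau> bn by simp
    then have "real m < real b ^ n" using m(1) by linarith
    then have "real m < real (b ^ n)" by (simp only: of_nat_power)
    then have "m < b ^ n" by (simp only: of_nat_less_iff)
    then have "m \<in> K" using \<tau> by (simp add: K_def m_def)
    moreover have "\<tau> \<in> I m"
      using m bn by (simp add: I_def pos_divide_le_eq pos_less_divide_eq mult.commute)
    ultimately show "\<tau> \<in> (\<Union>m\<in>K. I m)" by blast
  next
    fix \<tau> assume "\<tau> \<in> (\<Union>m\<in>K. I m)"
    then obtain m where m: "m \<in> K" "\<tau> \<in> I m" by blast
    then have "real m + 1 \<le> real (b ^ n)" by (simp add: K_def del: of_nat_power)
    then have "(real m + 1) / real b ^ n \<le> 1" using bn by simp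
    moreover have "0 \<le> real m / real b ^ n" using bn by simp
    ultimately have "\<tau> \<in> {0..<1}"
      using m(2) unfolding I_def atLeastLessThan_iff by linarith
    then show "\<tau> \<in> ?S" using floor[OF m(2)] m(1) by (simp add: K_def)
  qed
  have fin: "finite K" by (simp add: K_def)
  show "?S \<in> sets lborel" unfolding S I_def by (intro sets.finite_UN fin) auto
  have "emeasure lborel ?S \<le> (\<Sum>m\<in>K. emeasure lborel (I m))"
    unfolding S by (intro emeasure_subadditive_finite fin) (auto simp: I_def)
  also have "\<dots> = (\<Sum>m\<in>K. ennreal (1 / real b ^ n))"
  proof (intro sum.cong refl)
    fix m
    have "(real m + 1) / real b ^ n - real m / real b ^ n = 1 / real b ^ n"
      by (simp add: diff_divide_distrib[symmetric])
    moreover have "real m / real b ^ n \<le> (real m + 1) / real b ^ n"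
      using bn by (intro divide_right_mono) auto
    ultimately show "emeasure lborel (I m) = ennreal (1 / real b ^ n)"
      by (simp add: I_def)
  qed
  also have "\<dots> = ennreal (\<Sum>m\<in>K. 1 / real b ^ n)" using bn by (intro sum_ennreal) simp
  also have "(\<Sum>m\<in>K. 1 / real b ^ n) = avg b n (\<lambda>w. if P w then 1 else 0)"
  proof -
    have "(\<Sum>m<b ^ n. if P (dig b n m) then 1 else 0) = (\<Sum>m\<in>K. 1::real)"
      unfolding K_def by (subst sum.inter_filter[symmetric]) auto
    then show ?thesis by (simp add: avg_eq_sum_dig[OF b])
  qed
  finally show "emeasure lborel ?S \<le> ennreal (avg b n (\<lambda>w. if P w then 1 else 0))" .
qed

section \<open>Exponential moments of the centred cocycle\<close>

context moebius_cocycle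
begin

definition Y :: "nat list \<Rightarrow> real" where "Y w = log_Q w - real (length w) * lyap"
definition exp_moment :: "real \<Rightarrow> nat \<Rightarrow> real" where "exp_moment s n = avg b n (\<lambda>w. exp (s * Y w))"
definition M' :: real where "M' = M + \<bar>lyap\<bar>"

lemma M'_nonneg: "M' \<ge> 0"
  by (simp add: M'_def M_def)

lemma exp_moment_nonneg: "exp_moment s n \<ge> 0"
  using avg_mono[of n "\<lambda>w. 0" "\<lambda>w. exp (s * Y w)" b] b_pos by (simp add: exp_moment_def)

lemma Y_bound: "\<bar>Y w\<bar> \<le> real (length w) * M'"
proof -
  have "\<bar>Y w\<bar> \<le> \<bar>log_Q w\<bar> + \<bar>real (length w) * lyap\<bar>" by (simp add: Y_def)
  also have "\<dots> \<le> real (length w) * M'"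
    using log_Q_bound[of w] by (simp add: M'_def abs_mult algebra_simps)
  finally show ?thesis .
qed

text \<open>Centring does not affect the concatenation error, so moments are submultiplicative up to
  a constant independent of both lengths.\<close>

lemma exp_moment_append: "exp_moment s (m + n) \<le> exp (\<bar>s\<bar> * \<kappa>) * exp_moment s m * exp_moment s n"
proof -
  have "exp_moment s (m + n) = avg b m (\<lambda>u. avg b n (\<lambda>v. exp (s * Y (u @ v))))"
    by (simp add: exp_moment_def avg_append)
  also have "\<dots> \<le> avg b m (\<lambda>u. avg b n (\<lambda>v. exp (\<bar>s\<bar> * \<kappa>) * exp (s * Y u) * exp (s * Y v)))"
  proof (intro avg_mono)
    fix u v :: "nat list"
    have "s * (Y (u @ v) - Y u - Y v) \<le> \<bar>s\<bar> * \<bar>Y (u @ v) - Y u - Y v\<bar>"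
      by (metis abs_ge_self abs_mult)
    also have "\<dots> \<le> \<bar>s\<bar> * \<kappa>"
      using log_Q_append[of u v] by (intro mult_left_mono) (auto simp: Y_def algebra_simps)
    finally have "s * Y (u @ v) \<le> \<bar>s\<bar> * \<kappa> + s * Y u + s * Y v" by (simp add: algebra_simps)
    then show "exp (s * Y (u @ v)) \<le> exp (\<bar>s\<bar> * \<kappa>) * exp (s * Y u) * exp (s * Y v)"
      by (simp flip: exp_add)
  qed
  also have "\<dots> = avg b m (\<lambda>u. (exp (\<bar>s\<bar> * \<kappa>) * exp_moment s n) * exp (s * Y u))"
    by (simp add: avg_cmult exp_moment_def mult_ac)
  also have "\<dots> = exp (\<bar>s\<bar> * \<kappa>) * exp_moment s m * exp_moment s n"
    unfolding avg_cmult by (simp add: exp_moment_def mult_ac)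
  finally show ?thesis .
qed

text \<open>A second order bound for \<open>exp\<close>: the linear term is the mean of
  \<open>Y\<close>, at most \<open>C2\<close> in absolute value by \<open>Lambda_lyap\<close>, and
  the quadratic term uses the crude bound \<open>n * M'\<close> on \<open>Y\<close>.\<close>

lemma exp_moment_small:
  assumes "\<bar>s\<bar> * (real n * M') \<le> 1"
  shows "exp_moment s n \<le> exp (\<bar>s\<bar> * C2 + (s * (real n * M'))\<^sup>2)"
proof -
  have "exp_moment s n \<le> avg b n (\<lambda>w. 1 + s * Y w + (s * (real n * M'))\<^sup>2)"
    unfolding exp_moment_def
  proof (intro avg_mono)
    fix w :: "nat list" assume "length w = n"
    then have *: "\<bar>s * Y w\<bar> \<le> \<bar>s\<bar> * (real n * M')"
      using Y_bound[of w] by (simp add: abs_mult mult_left_mono)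
    then have "exp (s * Y w) \<le> 1 + s * Y w + (s * Y w)\<^sup>2"
      using assms by (intro exp_le_quadratic) simp
    moreover have "(s * Y w)\<^sup>2 \<le> (s * (real n * M'))\<^sup>2"
      using * M'_nonneg by (intro power2_le_iff_abs_le[THEN iffD2] abs_le_square_iff[THEN iffD1]) (simp_all add: abs_mult)
    ultimately show "exp (s * Y w) \<le> 1 + s * Y w + (s * (real n * M'))\<^sup>2" by simp
  qed
  also have "\<dots> = 1 + s * avg b n Y + (s * (real n * M'))\<^sup>2"
    using b_pos by (simp add: avg_add avg_cmult)
  also have "\<dots> \<le> 1 + \<bar>s\<bar> * C2 + (s * (real n * M'))\<^sup>2"
  proof -
    have "avg b n Y = \<Lambda> n - real n * lyap"
    proof -
      have "avg b n Y = avg b n (\<lambda>w. log_Q w - real n * lyap)"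
        by (rule avg_cong) (simp add: Y_def)
      then show ?thesis using b_pos by (simp add: avg_diff \<Lambda>_def)
    qed
    then have "\<bar>s * avg b n Y\<bar> \<le> \<bar>s\<bar> * C2"
      using Lambda_lyap[of n] by (simp add: abs_mult mult_left_mono)
    then show ?thesis by (simp add: abs_le_iff)
  qed
  also have "\<dots> \<le> exp (\<bar>s\<bar> * C2 + (s * (real n * M'))\<^sup>2)"
    using exp_ge_add_one_self[of "\<bar>s\<bar> * C2 + (s * (real n * M'))\<^sup>2"] by (simp only: add.assoc)
  finally show ?thesis .
qed

lemma exp_moment_growth:
  assumes "\<epsilon> > 0"
  obtains s C where "s > 0" "C > 0" "\<And>n. exp_moment s n \<le> C * exp (s * \<epsilon> * real n)"
    "\<And>n. exp_moment (- s) n \<le> C * exp (s * \<epsilon> * real n)"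
proof -
  \<comment> \<open>In a block of this length the allowance \<open>\<epsilon> * L\<close> pays for
    the concatenation cost \<open>\<kappa>\<close>, the bias \<open>C2\<close> and a unit reserved
    for the quadratic term.\<close>
  define L where "L = nat \<lceil>(\<kappa> + C2 + 1) / \<epsilon>\<rceil> + 1"
  define a where "a = real L * M'"
  \<comment> \<open>Small enough for \<open>s * a \<le> 1\<close> and
    \<open>s * a\<^sup>2 \<le> 1\<close>; the quadratic term \<open>(s * a)\<^sup>2\<close> is then
    at most \<open>s\<close>.\<close>
  define s where "s = 1 / (a\<^sup>2 + a + 1)"
  have L: "L > 0" by (simp add: L_def)
  have "(\<kappa> + C2 + 1) / \<epsilon> \<le> real L" unfolding L_def by linarith
  then have Leps: "\<kappa> + C2 + 1 \<le> \<epsilon> * real L" using assms by (simp add: pos_divide_le_eq mult.commute)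
  have a: "a \<ge> 0" using M'_nonneg by (simp add: a_def)
  have den: "a\<^sup>2 + a + 1 > 0" using a by (simp add: add_nonneg_pos)
  have s: "s > 0" using den by (simp add: s_def)
  have sa: "s * a \<le> 1" "s * a\<^sup>2 \<le> 1" using a den by (simp_all add: s_def)
  have step: "exp_moment t (L + n) \<le> exp (s * \<epsilon> * real L) * exp_moment t n" if t: "\<bar>t\<bar> = s" for t n
  proof -
    have t2: "t\<^sup>2 = s\<^sup>2" using t by (metis power2_abs)
    have "exp_moment t L \<le> exp (s * C2 + (t * a)\<^sup>2)"
      using exp_moment_small[of t L] t sa by (simp add: a_def)
    also have "(t * a)\<^sup>2 = s * (s * a\<^sup>2)" unfolding power_mult_distrib t2 by (simp add: power2_eq_square)
    also have "exp (s * C2 + s * (s * a\<^sup>2)) \<le> exp (s * C2 + s * 1)"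
      using sa s by (simp only: exp_le_cancel_iff) (intro add_left_mono mult_left_mono; simp)
    finally have "exp (s * \<kappa>) * exp_moment t L \<le> exp (s * \<kappa>) * exp (s * C2 + s * 1)"
      by (rule mult_left_mono) simp
    also have "\<dots> = exp (s * (\<kappa> + C2 + 1))" by (simp flip: exp_add add: algebra_simps)
    also have "\<dots> \<le> exp (s * (\<epsilon> * real L))"
      using Leps s by (simp only: exp_le_cancel_iff) (intro mult_left_mono; simp)
    finally have "exp (s * \<kappa>) * exp_moment t L \<le> exp (s * \<epsilon> * real L)" by (simp add: mult.assoc)
    then have "exp (s * \<kappa>) * exp_moment t L * exp_moment t n \<le> exp (s * \<epsilon> * real L) * exp_moment t n"
      using exp_moment_nonneg by (rule mult_right_mono)
    then show ?thesis using exp_moment_append[of t L n] t by simp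
  qed
  \<comment> \<open>Absorbs the remainder shorter than \<open>L\<close> that is left after whole
    blocks.\<close>
  define C where "C = 1 + (\<Sum>k<L. exp_moment s k + exp_moment (- s) k)"
  have C: "C > 0" by (simp add: C_def add_pos_nonneg sum_nonneg exp_moment_nonneg)
  have bd: "exp_moment t n \<le> C * exp (s * \<epsilon> * real n)" if t: "t = s \<or> t = - s" for t n
  proof (induction n rule: less_induct)
    case (less n)
    show ?case
    proof (cases "n < L")
      case True
      have "exp_moment s n + exp_moment (- s) n \<le> (\<Sum>k<L. exp_moment s k + exp_moment (- s) k)"
        using True by (intro member_le_sum) (auto simp: exp_moment_nonneg)
      then have "exp_moment t n \<le> C" using t exp_moment_nonneg[of s n] exp_moment_nonneg[of "- s" n] by (auto simp: C_def)
      also have "\<dots> \<le> C * exp (s * \<epsilon> * real n)" using C s assms by simp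
      finally show ?thesis .
    next
      case False
      then obtain m where m: "n = L + m" using le_Suc_ex not_less by blast
      have "exp_moment t n \<le> exp (s * \<epsilon> * real L) * exp_moment t m" unfolding m using t s by (intro step) auto
      also have "\<dots> \<le> exp (s * \<epsilon> * real L) * (C * exp (s * \<epsilon> * real m))"
        using less[of m] L m by (intro mult_left_mono) auto
      also have "\<dots> = C * exp (s * \<epsilon> * real n)"
        by (simp add: m algebra_simps exp_add)
      finally show ?thesis .
    qed
  qed
  show ?thesis using that[OF s C] bd by blast
qed

text \<open>Markov's inequality for \<open>exp (s * Y)\<close> and \<open>exp (- s * Y)\<close>. The
  moments are taken with \<open>\<epsilon> / 2\<close>, so half of the exponent
  \<open>s * \<epsilon> * n\<close> is left as decay.\<close>

lemma deviation_bound: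
  assumes "\<epsilon> > 0"
  obtains c C where "c > 0"
    "\<And>n. avg b n (\<lambda>w. if \<bar>Y w\<bar> \<ge> \<epsilon> * real n then 1 else 0) \<le> C * exp (- c * real n)"
proof -
  obtain s C where s: "s > 0" "C > 0" and exp_moment: "\<And>n. exp_moment s n \<le> C * exp (s * (\<epsilon> / 2) * real n)"
    "\<And>n. exp_moment (- s) n \<le> C * exp (s * (\<epsilon> / 2) * real n)"
    using exp_moment_growth[of "\<epsilon> / 2"] assms by auto
  have "avg b n (\<lambda>w. if \<bar>Y w\<bar> \<ge> \<epsilon> * real n then 1 else 0) \<le> 2 * C * exp (- (s * \<epsilon> / 2) * real n)" for n
  proof -
    have "avg b n (\<lambda>w. if \<bar>Y w\<bar> \<ge> \<epsilon> * real n then 1 else 0)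
      \<le> avg b n (\<lambda>w. exp (- s * \<epsilon> * real n) * (exp (s * Y w) + exp (- s * Y w)))"
    proof (intro avg_mono)
      fix w :: "nat list"
      show "(if \<bar>Y w\<bar> \<ge> \<epsilon> * real n then 1 else 0)
         \<le> exp (- s * \<epsilon> * real n) * (exp (s * Y w) + exp (- s * Y w))"
      proof (cases "\<bar>Y w\<bar> \<ge> \<epsilon> * real n")
        case True
        have "s * (\<epsilon> * real n) \<le> s * \<bar>Y w\<bar>" using True s by (intro mult_left_mono) auto
        then have "exp (s * \<epsilon> * real n) \<le> exp (s * \<bar>Y w\<bar>)" by (simp add: mult.assoc)
        also have "\<dots> \<le> exp (s * Y w) + exp (- s * Y w)" by (auto simp: abs_if)
        finally have "exp (- s * \<epsilon> * real n) * exp (s * \<epsilon> * real n)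
            \<le> exp (- s * \<epsilon> * real n) * (exp (s * Y w) + exp (- s * Y w))"
          by (rule mult_left_mono) simp
        then show ?thesis using True by (simp flip: exp_add)
      qed (simp add: add_nonneg_nonneg)
    qed
    also have "\<dots> = exp (- s * \<epsilon> * real n) * (exp_moment s n + exp_moment (- s) n)"
      by (simp add: avg_cmult avg_add exp_moment_def)
    also have "\<dots> \<le> exp (- s * \<epsilon> * real n) * (2 * C * exp (s * (\<epsilon> / 2) * real n))"
      using exp_moment[of n] by (intro mult_left_mono) auto
    also have "\<dots> = 2 * C * exp (- (s * \<epsilon> / 2) * real n)"
      by (simp flip: exp_add)
    finally show ?thesis .
  qed
  then show ?thesis using that[of "s * \<epsilon> / 2" "2 * C"] s assms by auto
qed

definition word :: "real \<Rightarrow> nat \<Rightarrow> nat list" where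
  "word \<tau> n = dig b n (nat \<lfloor>real b ^ n * \<tau>\<rfloor>)"

lemma AE_deviation:
  assumes "\<epsilon> > 0"
  shows "AE \<tau> in lborel. \<tau> \<in> {0..<1} \<longrightarrow> (\<forall>\<^sub>F n in sequentially. \<bar>Y (word \<tau> n)\<bar> < \<epsilon> * real n)"
proof -
  define A where "A = (\<lambda>n. {\<tau> \<in> {0..<1::real}. \<bar>Y (word \<tau> n)\<bar> \<ge> \<epsilon> * real n})"
  obtain c C where c: "c > 0"
    and bd: "\<And>n. avg b n (\<lambda>w. if \<bar>Y w\<bar> \<ge> \<epsilon> * real n then 1 else 0) \<le> C * exp (- c * real n)"
    using deviation_bound[OF assms] by metis
  have sets: "A n \<in> sets lborel" for n
    unfolding A_def word_def by (rule badic_measure(1)[OF b_pos])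
  have le: "emeasure lborel (A n) \<le> ennreal (C * exp (- c * real n))" for n
  proof -
    have "emeasure lborel (A n) \<le> ennreal (avg b n (\<lambda>w. if \<bar>Y w\<bar> \<ge> \<epsilon> * real n then 1 else 0))"
      unfolding A_def word_def by (rule badic_measure(2)[OF b_pos])
    also have "\<dots> \<le> ennreal (C * exp (- c * real n))" using bd by (rule ennreal_leI)
    finally show ?thesis .
  qed
  have sm: "summable (\<lambda>n. C * exp (- c * real n))"
  proof -
    have "exp (- c * real n) = exp (- c) ^ n" for n by (metis exp_of_nat2_mult)
    then show ?thesis using c by (simp add: summable_mult summable_geometric)
  qed
  have "AE \<tau> in lborel. \<forall>\<^sub>F n in sequentially. \<tau> \<in> space lborel - A n"
  proof (rule borel_cantelli_AE1[OF sets])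
    show "emeasure lborel (A n) < \<infinity>" for n using le[of n] by (simp add: order_le_less_trans)
    show "summable (\<lambda>n. measure lborel (A n))"
    proof (rule summable_comparison_test'[OF sm])
      fix n
      have "avg b n (\<lambda>w. 0) \<le> avg b n (\<lambda>w. if \<bar>Y w\<bar> \<ge> \<epsilon> * real n then 1 else 0)"
        by (rule avg_mono) simp
      then have "0 \<le> C * exp (- c * real n)" using bd[of n] b_pos by simp
      then show "norm (measure lborel (A n)) \<le> C * exp (- c * real n)"
        using enn2real_mono[OF le[of n]] by (simp add: measure_def)
    qed
  qed
  then show ?thesis
  proof (eventually_elim, intro impI)
    fix \<tau> :: real assume "\<forall>\<^sub>F n in sequentially. \<tau> \<in> space lborel - A n" and "\<tau> \<in> {0..<1}"
    then show "\<forall>\<^sub>F n in sequentially. \<bar>Y (word \<tau> n)\<bar> < \<epsilon> * real n"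
      by (auto simp: A_def elim!: eventually_mono)
  qed
qed

lemma AE_strong_law:
  "AE \<tau> in lborel. \<tau> \<in> {0..<1} \<longrightarrow> (\<forall>\<epsilon>>0. \<forall>\<^sub>F n in sequentially. \<bar>Y (word \<tau> n)\<bar> < \<epsilon> * real n)"
proof -
  have "AE \<tau> in lborel. \<forall>k. \<tau> \<in> {0..<1} \<longrightarrow>
      (\<forall>\<^sub>F n in sequentially. \<bar>Y (word \<tau> n)\<bar> < inverse (real (Suc k)) * real n)"
    unfolding AE_all_countable using AE_deviation by simp
  then show ?thesis
  proof (eventually_elim, intro impI allI)
    fix \<tau> \<epsilon> :: real
    assume *: "\<forall>k. \<tau> \<in> {0..<1} \<longrightarrow>
      (\<forall>\<^sub>F n in sequentially. \<bar>Y (word \<tau> n)\<bar> < inverse (real (Suc k)) * real n)"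
      and \<tau>: "\<tau> \<in> {0..<1}" and "\<epsilon> > 0"
    obtain k where "inverse (real (Suc k)) < \<epsilon>" using \<open>\<epsilon> > 0\<close> reals_Archimedean by blast
    then have "inverse (real (Suc k)) * real n \<le> \<epsilon> * real n" for n
      by (intro mult_right_mono) auto
    with *[rule_format, OF \<tau>, of k] show "\<forall>\<^sub>F n in sequentially. \<bar>Y (word \<tau> n)\<bar> < \<epsilon> * real n"
      by (auto elim!: eventually_mono intro: less_le_trans)
  qed
qed

end

section \<open>Carries and counting of prefixes\<close>

text \<open>Digit strings are encoded as the integers they represent, the last digit being the
  remainder modulo \<open>b\<close>; addition with carries is then ordinary integer
  arithmetic.\<close>

primrec digs :: "nat \<Rightarrow> int set \<Rightarrow> nat \<Rightarrow> int set" where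
  "digs b D 0 = {0}"
| "digs b D (Suc n) = {X. X div int b \<in> digs b D n \<and> X mod int b \<in> D}"

lemma digs_append:
  "X \<in> digs b D (n + m) \<longleftrightarrow> X div int b ^ m \<in> digs b D n \<and> X mod int b ^ m \<in> digs b D m"
proof (induction m arbitrary: X)
  case (Suc m)
  have 1: "X mod int b ^ Suc m = int b * (X div int b mod int b ^ m) + X mod int b"
    by (simp add: zmod_zmult2_eq)
  have 2: "X mod int b ^ Suc m mod int b = X mod int b"
    by (simp add: mod_mod_cancel)
  have 3: "X mod int b ^ Suc m div int b = X div int b mod int b ^ m"
  proof (cases "b = 0")
    case False
    then have "X mod int b div int b = 0" by (intro div_pos_pos_trivial) auto
    then show ?thesis unfolding 1 using False by simp
  qed simp
  have "X div int b ^ Suc m = X div int b div int b ^ m" by (simp add: zdiv_zmult2_eq)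
  then show ?case using Suc[of "X div int b"] 2 3 by (auto simp del: power_Suc)
qed simp

locale digit_pair =
  fixes b :: nat and D1 D2 :: "int set"
  assumes b2: "b \<ge> 2" and D1: "D1 \<subseteq> {0..int b - 1}" and D2: "D2 \<subseteq> {0..int b - 1}"
begin

lemma digs_range:
  assumes "D \<subseteq> {0..int b - 1}"
  shows "digs b D n \<subseteq> {0..<int b ^ n}"
proof (induction n)
  case (Suc n)
  show ?case
  proof
    fix X assume "X \<in> digs b D (Suc n)"
    then have "X div int b \<in> {0..<int b ^ n}" using Suc by auto
    then have *: "0 \<le> X div int b" "X div int b + 1 \<le> int b ^ n" by auto
    have b: "int b > 0" using b2 by simp
    have "0 \<le> X" using *(1) b by (simp add: pos_imp_zdiv_nonneg_iff)
    moreover have "X = int b * (X div int b) + X mod int b" by simp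
    moreover have "X mod int b < int b" using b by simp
    moreover have "int b * (X div int b + 1) \<le> int b * int b ^ n" using * b by (intro mult_left_mono) auto
    moreover have "int b * (X div int b + 1) = int b * (X div int b) + int b"
      by (simp only: distrib_left mult_1_right)
    ultimately have "X < int b * int b ^ n" by linarith
    then show "X \<in> {0..<int b ^ Suc n}" using \<open>0 \<le> X\<close> by simp
  qed
qed simp

lemma digs_finite: "D \<subseteq> {0..int b - 1} \<Longrightarrow> finite (digs b D n)"
  by (rule finite_subset[OF digs_range]) auto

text \<open>\<open>j\<close> is the carry into the last digit and \<open>k\<close> the carry out of the first one.\<close>

definition nodes :: "nat \<Rightarrow> nat \<Rightarrow> int \<Rightarrow> int \<Rightarrow> (int \<times> int) set" where
  "nodes n t j k = {(X, Y). X \<in> digs b D1 n \<and> Y \<in> digs b D2 n \<and> X + int t + j = Y + int b ^ n * k}"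

lemma nodes_finite: "finite (nodes n t j k)"
  by (rule finite_subset[of _ "digs b D1 n \<times> digs b D2 n"]) (auto simp: nodes_def digs_finite D1 D2)

lemma of_nat_div_mod_pow: "int t = int b ^ m * int (t div b ^ m) + int (t mod b ^ m)"
proof -
  have "t = b ^ m * (t div b ^ m) + t mod b ^ m" by simp
  then have "int t = int (b ^ m * (t div b ^ m) + t mod b ^ m)" by (simp only:)
  then show ?thesis by (simp only: of_nat_add of_nat_mult of_nat_power)
qed

text \<open>\<open>l\<close> is the carry from the lower \<open>m\<close> digits into the upper
  \<open>n\<close>. The ranges of the lower parts place \<open>B * l\<close> strictly between
  \<open>- B\<close> and \<open>2 * B\<close>, which leaves 0 and 1.\<close>

lemma nodes_div_mod:
  assumes XY: "(X, Y) \<in> nodes (n + m) t j k" and j: "j \<in> {0, 1}"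
  defines "B \<equiv> int b ^ m"
  defines "l \<equiv> (X mod B + int (t mod b ^ m) + j - Y mod B) div B"
  shows "l \<in> {0, 1}" "(X mod B, Y mod B) \<in> nodes m (t mod b ^ m) j l"
    "(X div B, Y div B) \<in> nodes n (t div b ^ m) l k"
proof -
  have B: "B > 0" using b2 by (simp add: B_def)
  let ?t' = "t mod b ^ m" and ?t'' = "t div b ^ m"
  have t': "0 \<le> int ?t'" "int ?t' < B"
    unfolding B_def using b2 by (simp_all flip: of_nat_power)
  have "X + int t + j = Y + B * int b ^ n * k"
    using XY by (simp add: nodes_def B_def power_add)
  moreover have "X = B * (X div B) + X mod B" "Y = B * (Y div B) + Y mod B" by simp_all
  ultimately have "X mod B + int ?t' + j - Y mod B = B * (Y div B + int b ^ n * k - X div B - int ?t'')"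
    unfolding of_nat_div_mod_pow[of t m] B_def[symmetric] by (simp add: algebra_simps)
  then have lval: "l = Y div B + int b ^ n * k - X div B - int ?t''"
    and Bl: "X mod B + int ?t' + j - Y mod B = B * l"
    using B by (simp_all add: l_def)
  have "0 \<le> X mod B" "X mod B < B" "0 \<le> Y mod B" "Y mod B < B" using B by simp_all
  moreover have "0 \<le> j" "j \<le> 1" using j by auto
  ultimately have "B * (-1) < B * l" "B * l < B * 2" using Bl t' by linarith+
  then have "-1 < l" "l < 2" using B by (simp_all only: mult_less_cancel_left_pos)
  then show "l \<in> {0,1}" by auto
  have mem: "X div B \<in> digs b D1 n" "X mod B \<in> digs b D1 m" "Y div B \<in> digs b D2 n" "Y mod B \<in> digs b D2 m"
    using XY unfolding B_def nodes_def by (auto simp: digs_append)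
  then show "(X mod B, Y mod B) \<in> nodes m ?t' j l"
    using Bl by (simp add: nodes_def B_def)
  show "(X div B, Y div B) \<in> nodes n ?t'' l k"
    using mem lval by (simp add: nodes_def)
qed

text \<open>Cutting paths at a level gives the rule for a matrix product. As \<open>R\<close> looks
  at the upper digits only, the same bijection counts the descendants of selected prefixes.\<close>

lemma nodes_split_filter:
  assumes j: "j \<in> {0, 1}"
  shows "card {p \<in> nodes (n + m) t j k. R (snd p div int b ^ m)}
    = (\<Sum>l\<in>{0,1}. card (nodes m (t mod b ^ m) j l) * card {p \<in> nodes n (t div b ^ m) l k. R (snd p)})"
proof -
  define B where "B = int b ^ m"
  have B: "B > 0" using b2 by (simp add: B_def)
  define t' t'' where "t' = t mod b ^ m" and "t'' = t div b ^ m"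
  define N where "N = (\<lambda>l. {p \<in> nodes n t'' l k. R (snd p)})"
  define A where "A = {p \<in> nodes (n + m) t j k. R (snd p div B)}"
  define S where "S = (SIGMA l:{0,1::int}. nodes m t' j l \<times> N l)"
  define F where "F = (\<lambda>(l::int, (X', Y'), (X, Y)). (B * X + X', B * Y + Y'))"
  define G where "G = (\<lambda>(X, Y). ((X mod B + int t' + j - Y mod B) div B, (X mod B, Y mod B), (X div B, Y div B)))"
  have r1: "digs b D1 m \<subseteq> {0..<B}" "digs b D2 m \<subseteq> {0..<B}"
    unfolding B_def using digs_range D1 D2 by auto
  have md: "(B * x + x') div B = x" "(B * x + x') mod B = x'" if "x' \<in> {0..<B}" for x x'
    using that B by auto
  have "bij_betw F S A"
  proof (rule bij_betw_byWitness[where f' = G])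
    show "\<forall>a\<in>S. G (F a) = a"
    proof
      fix a assume "a \<in> S"
      then obtain l X' Y' X Y where a: "a = (l, (X', Y'), (X, Y))" and p': "(X', Y') \<in> nodes m t' j l"
        by (auto simp: S_def)
      have "X' \<in> {0..<B}" "Y' \<in> {0..<B}" using p' r1 by (auto simp: nodes_def)
      moreover have "X' + int t' + j - Y' = B * l" using p' by (simp add: nodes_def B_def)
      then have "(X' + int t' + j - Y') div B = l" using B by simp
      ultimately show "G (F a) = a" by (simp only: a F_def G_def md prod.case)
    qed
    show "\<forall>a\<in>A. F (G a) = a"
      by (simp add: F_def G_def split: prod.split)
    show "F ` S \<subseteq> A"
    proof
      fix p assume "p \<in> F ` S"
      then obtain a where a: "a \<in> S" "p = F a" by blast
      obtain l X' Y' X Y where "a = (l, (X', Y'), (X, Y))" by (metis surj_pair)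
      with a have l: "l \<in> {0,1}" and p': "(X', Y') \<in> nodes m t' j l"
        and p'': "(X, Y) \<in> nodes n t'' l k" "R Y" and p: "p = (B * X + X', B * Y + Y')"
        by (simp_all add: S_def F_def N_def)
      have rr: "X' \<in> {0..<B}" "Y' \<in> {0..<B}" using p' r1 by (auto simp: nodes_def)
      have "B * X + X' \<in> digs b D1 (n + m)" "B * Y + Y' \<in> digs b D2 (n + m)"
        using p' p'' unfolding digs_append B_def[symmetric] md[OF rr(1)] md[OF rr(2)]
        by (simp_all add: nodes_def)
      moreover have "B * X + X' + int t + j = B * Y + Y' + int b ^ (n + m) * k"
      proof -
        have 1: "X' + int t' + j = Y' + B * l" and "X + int t'' + l = Y + int b ^ n * k"
          using p' p'' by (auto simp: nodes_def B_def)
        then have "B * (X + int t'' + l) = B * (Y + int b ^ n * k)" by simp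
        moreover have "int b ^ (n + m) = B * int b ^ n" by (simp add: B_def power_add)
        moreover have "int t = B * int t'' + int t'"
          unfolding B_def t'_def t''_def by (rule of_nat_div_mod_pow)
        ultimately show ?thesis using 1 by (simp add: algebra_simps)
      qed
      ultimately show "p \<in> A" using p''(2) md(1)[OF rr(2)] by (simp add: nodes_def p A_def)
    qed
    show "G ` A \<subseteq> S"
    proof
      fix p assume "p \<in> G ` A"
      then obtain X Y where XY: "(X, Y) \<in> nodes (n + m) t j k" "R (Y div B)" and p: "p = G (X, Y)"
        by (auto simp: A_def)
      show "p \<in> S"
        using nodes_div_mod[OF XY(1) j] XY(2)
        by (simp add: p G_def S_def N_def B_def t'_def t''_def)
    qed
  qed
  then have "card A = card S" by (simp add: bij_betw_same_card)
  also have "\<dots> = (\<Sum>l\<in>{0,1}. card (nodes m t' j l \<times> N l))"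
    unfolding S_def by (intro card_SigmaI) (auto simp: nodes_finite N_def)
  finally show ?thesis by (simp add: card_cartesian_product t'_def t''_def A_def B_def N_def)
qed

lemma nodes_split:
  assumes "j \<in> {0, 1}"
  shows "card (nodes (n + m) t j k)
    = (\<Sum>l\<in>{0,1}. card (nodes m (t mod b ^ m) j l) * card (nodes n (t div b ^ m) l k))"
  using nodes_split_filter[OF assms, of n m t k "\<lambda>_. True"] by simp

lemma assoc_entry_nodes:
  assumes "i < b"
  shows "assoc_entry b D1 D2 i j k = card (nodes 1 i (int j) (int k))"
proof -
  have dg: "digs b D 1 = D" if "D \<subseteq> {0..int b - 1}" for D
  proof -
    have "x div int b = 0 \<and> x mod int b \<in> D \<longleftrightarrow> x \<in> D" for x
    proof
      assume "x \<in> D"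
      then have "0 \<le> x" "x < int b" using that by auto
      then show "x div int b = 0 \<and> x mod int b \<in> D" using \<open>x \<in> D\<close> by simp
    next
      assume *: "x div int b = 0 \<and> x mod int b \<in> D"
      then have "x = x mod int b" by (metis add_0 mult_zero_right mult_div_mod_eq)
      then show "x \<in> D" using * by simp
    qed
    then show ?thesis by auto
  qed
  have "bij_betw (\<lambda>(X, Y). Y + int k * int b) (nodes 1 i (int j) (int k))
     ((\<lambda>d. d + int i + int j) ` D1 \<inter> (\<lambda>d. d + int k * int b) ` D2)"
  proof (rule bij_betw_byWitness[where f' = "\<lambda>z. (z - int i - int j, z - int k * int b)"])
    note nd = nodes_def dg[OF D1] dg[OF D2]
    show "\<forall>a\<in>nodes 1 i (int j) (int k).
        (\<lambda>z. (z - int i - int j, z - int k * int b)) ((\<lambda>(X, Y). Y + int k * int b) a) = a"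
      unfolding nd by (auto simp: algebra_simps)
    show "(\<lambda>(X, Y). Y + int k * int b) ` nodes 1 i (int j) (int k)
      \<subseteq> (\<lambda>d. d + int i + int j) ` D1 \<inter> (\<lambda>d. d + int k * int b) ` D2"
    proof
      fix z assume "z \<in> (\<lambda>(X, Y). Y + int k * int b) ` nodes 1 i (int j) (int k)"
      then obtain X Y where "X \<in> D1" "Y \<in> D2" "z = Y + int k * int b" "z = X + int i + int j"
        unfolding nd by (auto simp: algebra_simps)
      then show "z \<in> (\<lambda>d. d + int i + int j) ` D1 \<inter> (\<lambda>d. d + int k * int b) ` D2" by blast
    qed
    show "(\<lambda>z. (z - int i - int j, z - int k * int b)) `
        ((\<lambda>d. d + int i + int j) ` D1 \<inter> (\<lambda>d. d + int k * int b) ` D2)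
      \<subseteq> nodes 1 i (int j) (int k)"
    proof
      fix w assume "w \<in> (\<lambda>z. (z - int i - int j, z - int k * int b)) `
        ((\<lambda>d. d + int i + int j) ` D1 \<inter> (\<lambda>d. d + int k * int b) ` D2)"
      then obtain d e where "d \<in> D1" "e \<in> D2" "d + int i + int j = e + int k * int b" "w = (d, e)"
        by auto
      then show "w \<in> nodes 1 i (int j) (int k)" unfolding nd by (simp add: mult.commute)
    qed
  qed auto
  then show ?thesis unfolding assoc_entry_def by (simp add: bij_betw_same_card)
qed

text \<open>For \<open>t < b ^ n\<close> this is component \<open>j\<close> of the product of the
  associated matrices along the digits of \<open>t\<close>, applied to
  \<open>(1, 1)\<close>.\<close>

definition row :: "nat \<Rightarrow> nat \<Rightarrow> int \<Rightarrow> real" where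
  "row n t j = (\<Sum>k\<in>{0,1}. real (card (nodes n t j k)))"

lemma row_split:
  assumes "j \<in> {0, 1}"
  shows "row (n + m) t j = (\<Sum>l\<in>{0,1}. real (card (nodes m (t mod b ^ m) j l)) * row n (t div b ^ m) l)"
  unfolding row_def nodes_split[OF assms] by (simp add: algebra_simps)

lemma row_0: "t = 0 \<Longrightarrow> j \<in> {0,1} \<Longrightarrow> row 0 t j = 1"
proof -
  assume "t = 0" "j \<in> {0,1}"
  then have "nodes 0 t j k = (if k = j then {(0, 0)} else {})" for k by (auto simp: nodes_def)
  then show ?thesis using \<open>j \<in> {0,1}\<close> by (auto simp: row_def)
qed

section \<open>Missing digits and the cone inequalities\<close>

definition defect :: "nat" where "defect = (b - card D1) + (b - card D2)"

lemma card_le: "card D1 \<le> b" "card D2 \<le> b"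
  using card_mono[OF _ D1] card_mono[OF _ D2] by simp_all

text \<open>The first two bounds count the integers available below and above \<open>b\<close>. For
  the third, an element of the shifted \<open>D1\<close> is lost to both columns only if its residue
  modulo \<open>b\<close> is missing from \<open>D2\<close>, and distinct lost elements have
  distinct residues.\<close>

lemma entry_bounds:
  assumes ij: "i + j \<le> b"
  shows "assoc_entry b D1 D2 i j 0 \<le> b - (i + j)" "assoc_entry b D1 D2 i j 1 \<le> i + j"
    "b \<le> assoc_entry b D1 D2 i j 0 + assoc_entry b D1 D2 i j 1 + defect"
proof -
  have fin: "finite D1" "finite D2" using D1 D2 by (auto intro: finite_subset)
  have rng: "0 \<le> d \<and> d < int b" if "d \<in> D1 \<or> d \<in> D2" for d using that D1 D2 by force
  have "(\<lambda>d. d + int i + int j) ` D1 \<inter> (\<lambda>d. d + int 0 * int b) ` D2 \<subseteq> {int (i + j)..<int b}"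
  proof
    fix z assume "z \<in> (\<lambda>d. d + int i + int j) ` D1 \<inter> (\<lambda>d. d + int 0 * int b) ` D2"
    then obtain d e where "d \<in> D1" "z = d + int i + int j" "e \<in> D2" "z = e" by auto
    then show "z \<in> {int (i + j)..<int b}" using rng[of d] rng[of e] by auto
  qed
  then have "assoc_entry b D1 D2 i j 0 \<le> card {int (i + j)..<int b}"
    unfolding assoc_entry_def by (rule card_mono[rotated]) simp
  also have "\<dots> = b - (i + j)" by simp
  finally show "assoc_entry b D1 D2 i j 0 \<le> b - (i + j)" .
  have "(\<lambda>d. d + int i + int j) ` D1 \<inter> (\<lambda>d. d + int 1 * int b) ` D2 \<subseteq> {int b..<int (b + i + j)}"
  proof
    fix z assume "z \<in> (\<lambda>d. d + int i + int j) ` D1 \<inter> (\<lambda>d. d + int 1 * int b) ` D2"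
    then obtain d e where "d \<in> D1" "z = d + int i + int j" "e \<in> D2" "z = e + int b" by auto
    then show "z \<in> {int b..<int (b + i + j)}" using rng[of d] rng[of e] by auto
  qed
  then have "assoc_entry b D1 D2 i j 1 \<le> card {int b..<int (b + i + j)}"
    unfolding assoc_entry_def by (rule card_mono[rotated]) simp
  also have "\<dots> = i + j" by simp
  finally show "assoc_entry b D1 D2 i j 1 \<le> i + j" .
  define E where "E = (\<lambda>d. d + int i + int j) ` D1"
  define E0 E1 E2 where "E0 = E \<inter> (\<lambda>d. d + int 0 * int b) ` D2"
    and "E1 = E \<inter> (\<lambda>d. d + int 1 * int b) ` D2" and "E2 = E - E0 - E1"
  have finE: "finite E" using fin by (simp add: E_def)
  have Er: "E \<subseteq> {int (i + j)..<int (i + j) + int b}" using D1 by (auto simp: E_def)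
  have "card E = card D1" unfolding E_def by (rule card_image) (auto simp: inj_on_def)
  moreover have "E \<subseteq> E0 \<union> E1 \<union> E2" by (auto simp: E2_def)
  then have "card E \<le> card E0 + card E1 + card E2"
  proof -
    assume "E \<subseteq> E0 \<union> E1 \<union> E2"
    then have "card E \<le> card (E0 \<union> E1 \<union> E2)"
      using finE by (intro card_mono) (auto simp: E0_def E1_def E2_def)
    also have "\<dots> \<le> card (E0 \<union> E1) + card E2" by (rule card_Un_le)
    also have "\<dots> \<le> card E0 + card E1 + card E2" using card_Un_le[of E0 E1] by simp
    finally show ?thesis .
  qed
  moreover have "card E2 \<le> card ({0..int b - 1} - D2)"
  proof (rule card_inj_on_le[where f = "\<lambda>x. x mod int b"])
    show "inj_on (\<lambda>x. x mod int b) E2"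
    proof (rule inj_onI)
      fix x y assume "x \<in> E2" "y \<in> E2" and m: "x mod int b = y mod int b"
      then have "x \<in> {int (i + j)..<int (i + j) + int b}" "y \<in> {int (i + j)..<int (i + j) + int b}"
        using Er by (auto simp: E2_def)
      then have "\<bar>x - y\<bar> < int b" by auto
      moreover have "int b dvd x - y" using m by (simp add: mod_eq_dvd_iff)
      ultimately show "x = y" using dvd_imp_le_int[of "x - y" "int b"] by force
    qed
    show "(\<lambda>x. x mod int b) ` E2 \<subseteq> {0..int b - 1} - D2"
    proof
      fix y assume "y \<in> (\<lambda>x. x mod int b) ` E2"
      then obtain x where x: "x \<in> E2" "y = x mod int b" by auto
      have xr: "0 \<le> x" "x < 2 * int b" using x(1) Er ij by (auto simp: E2_def)
      have "y \<notin> D2"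
      proof
        assume y: "y \<in> D2"
        show False
        proof (cases "x < int b")
          case True
          then have "x = y" using xr x(2) by simp
          then have "x \<in> E0" using x(1) y by (auto simp: E0_def E2_def)
          then show False using x(1) by (simp add: E2_def)
        next
          case False
          then have "(x - int b) mod int b = x - int b" using xr by (intro mod_pos_pos_trivial) auto
          then have "x - int b = y" using x(2) by simp
          then have "x \<in> E1" using x(1) y by (force simp: E1_def E2_def)
          then show False using x(1) by (simp add: E2_def)
        qed
      qed
      then show "y \<in> {0..int b - 1} - D2" using x(2) b2 by simp
    qed
  qed simp
  moreover have "card ({0..int b - 1} - D2) = b - card D2"
    using D2 fin by (simp add: card_Diff_subset)
  moreover have "card E0 = assoc_entry b D1 D2 i j 0" "card E1 = assoc_entry b D1 D2 i j 1"
    by (simp_all add: E0_def E1_def E_def assoc_entry_def)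
  ultimately show "b \<le> assoc_entry b D1 D2 i j 0 + assoc_entry b D1 D2 i j 1 + defect"
    using card_le by (simp add: defect_def)
qed

text \<open>These say that every matrix maps the cone spanned by \<open>(3, 1)\<close> and \<open>(1, 3)\<close> strictly into itself.\<close>

lemma cone_inequalities:
  assumes d: "5 * defect + 6 \<le> 2 * b" and i: "i < b"
  defines "p \<equiv> real (assoc_entry b D1 D2 i 0 0)" and "q \<equiv> real (assoc_entry b D1 D2 i 0 1)"
    and "r \<equiv> real (assoc_entry b D1 D2 i 1 0)" and "s \<equiv> real (assoc_entry b D1 D2 i 1 1)"
  shows "p + 3 * q + 1 \<le> 3 * r + 9 * s" "r + 3 * s + 1 \<le> 3 * p + 9 * q"
    "3 * p + q + 1 \<le> 9 * r + 3 * s" "3 * r + s + 1 \<le> 9 * p + 3 * q"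
    "p + q \<le> real b" "r + s \<le> real b"
proof -
  let ?p = "int (assoc_entry b D1 D2 i 0 0)" and ?q = "int (assoc_entry b D1 D2 i 0 1)"
  let ?r = "int (assoc_entry b D1 D2 i 1 0)" and ?s = "int (assoc_entry b D1 D2 i 1 1)"
  have 0: "?p \<le> int b - int i" "?q \<le> int i" "int b \<le> ?p + ?q + int defect"
    using entry_bounds[of i 0] i by (simp_all add: of_nat_diff)
  have 1: "?r \<le> int b - int i - 1" "?s \<le> int i + 1" "int b \<le> ?r + ?s + int defect"
    using entry_bounds[of i 1] i by (simp_all add: of_nat_diff)
  have 2: "5 * int defect + 6 \<le> 2 * int b" using d by linarith
  have nn: "0 \<le> ?p" "0 \<le> ?q" "0 \<le> ?r" "0 \<le> ?s" by simp_all
  \<comment> \<open>For the first inequality, \<open>p + 3 * q \<le> b + 2 * i\<close>, while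
    \<open>3 * r + 9 * s\<close> is three times \<open>r + s \<ge> b - defect\<close> plus
    \<open>6 * s\<close>. Using \<open>s \<ge> 0\<close> with weight 4 and
    \<open>s \<ge> i + 1 - defect\<close> with weight 2 gives
    \<open>3 * b - 5 * defect + 2 * i + 2\<close>: this is where the factor 5 arises. The other
    three are similar.\<close>
  have "?p + 3 * ?q + 1 \<le> 3 * ?r + 9 * ?s" "?r + 3 * ?s + 1 \<le> 3 * ?p + 9 * ?q"
    "3 * ?p + ?q + 1 \<le> 9 * ?r + 3 * ?s" "3 * ?r + ?s + 1 \<le> 9 * ?p + 3 * ?q"
    "?p + ?q \<le> int b" "?r + ?s \<le> int b"
    using 0 1 2 nn by linarith+
  then show "p + 3 * q + 1 \<le> 3 * r + 9 * s" "r + 3 * s + 1 \<le> 3 * p + 9 * q"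
    "3 * p + q + 1 \<le> 9 * r + 3 * s" "3 * r + s + 1 \<le> 9 * p + 3 * q"
    "p + q \<le> real b" "r + s \<le> real b"
    unfolding p_def q_def r_def s_def by linarith+
qed

end

section \<open>Hausdorff measure of the intersections\<close>

text \<open>Levels with a parent map replace a tree. Good vertices are those with descendants on all
  later levels; finiteness provides a good root and a good child of every good vertex.\<close>

lemma konig:
  fixes L :: "nat \<Rightarrow> 'a set"
  assumes fin: "\<And>n. finite (L n)" and ne: "\<And>n. L n \<noteq> {}"
    and par: "\<And>n x. x \<in> L (Suc n) \<Longrightarrow> p x \<in> L n"
  obtains f where "\<And>n. f n \<in> L n" "\<And>n. p (f (Suc n)) = f n"
proof -
  define good where "good = (\<lambda>n x. x \<in> L n \<and> (\<forall>m. \<exists>y\<in>L (n + m). (p ^^ m) y = x))"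
  have pm: "(p ^^ m) y \<in> L n" if "y \<in> L (n + m)" for n m y
    using that
  proof (induction m arbitrary: y)
    case (Suc m)
    then have "p y \<in> L (n + m)" using par by simp
    then show ?case using Suc.IH by (simp add: funpow_swap1)
  qed simp
  \<comment> \<open>If every element of the finite set failed at some depth, then by monotonicity
    all would fail at the largest of these depths.\<close>
  have pick: "\<exists>x\<in>S. \<forall>m. P x m"
    if S: "finite S" and ex: "\<And>m. \<exists>x\<in>S. P x m" and mono: "\<And>x m m'. m \<le> m' \<Longrightarrow> P x m' \<Longrightarrow> P x m"
    for S :: "'a set" and P :: "'a \<Rightarrow> nat \<Rightarrow> bool"
  proof (rule ccontr)
    assume "\<not> (\<exists>x\<in>S. \<forall>m. P x m)"
    then obtain g where g: "\<And>x. x \<in> S \<Longrightarrow> \<not> P x (g x)" by metis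
    obtain x where x: "x \<in> S" "P x (Max (g ` S))" using ex by blast
    then have "g x \<le> Max (g ` S)" using S by simp
    then show False using mono x g by blast
  qed
  have root: "\<exists>x. good 0 x"
  proof -
    have "\<exists>x\<in>L 0. \<forall>m. \<exists>y\<in>L (0 + m). (p ^^ m) y = x"
    proof (rule pick[OF fin])
      fix m
      obtain y where "y \<in> L (0 + m)" using ne by fastforce
      then show "\<exists>x\<in>L 0. \<exists>y\<in>L (0 + m). (p ^^ m) y = x" using pm by blast
    next
      fix x m m' assume "m \<le> m'" and "\<exists>y\<in>L (0 + m'). (p ^^ m') y = x"
      then obtain y d where y: "y \<in> L (m + d)" "m' = m + d" "(p ^^ m') y = x"
        by (auto simp: le_iff_add)
      then have "(p ^^ m) ((p ^^ d) y) = x" by (simp add: funpow_add)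
      then show "\<exists>y\<in>L (0 + m). (p ^^ m) y = x" using pm[of y m d] y by auto
    qed
    then show ?thesis by (auto simp: good_def)
  qed
  have step: "\<exists>y. good (Suc n) y \<and> p y = x" if gx: "good n x" for n x
  proof -
    have "\<exists>y\<in>L (Suc n). \<forall>m. p y = x \<and> (\<exists>z\<in>L (Suc n + m). (p ^^ m) z = y)"
    proof (rule pick[OF fin])
      fix m
      obtain z where z: "z \<in> L (n + Suc m)" "(p ^^ Suc m) z = x" using gx unfolding good_def by blast
      have "p ((p ^^ m) z) = x" using z by simp
      moreover have "(p ^^ m) z \<in> L (Suc n)" using pm[of z "Suc n" m] z by simp
      ultimately show "\<exists>y\<in>L (Suc n). p y = x \<and> (\<exists>z\<in>L (Suc n + m). (p ^^ m) z = y)"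
        using z by auto
    next
      fix y m m' assume "m \<le> m'" and *: "p y = x \<and> (\<exists>z\<in>L (Suc n + m'). (p ^^ m') z = y)"
      then obtain z d where z: "z \<in> L (Suc n + m + d)" "m' = m + d" "(p ^^ m') z = y"
        by (auto simp: le_iff_add add.assoc)
      then have "(p ^^ m) ((p ^^ d) z) = y" by (simp add: funpow_add)
      then show "p y = x \<and> (\<exists>z\<in>L (Suc n + m). (p ^^ m) z = y)" using pm[of z "Suc n + m" d] z * by auto
    qed
    then show ?thesis by (auto simp: good_def)
  qed
  obtain f where "\<And>n. good n (f n)" "\<And>n. p (f (Suc n)) = f n"
    using dependent_nat_choice[of good "\<lambda>n x y. p y = x"] root step by metis
  then show ?thesis using that[of f] by (simp add: good_def)
qed

text \<open>Covers are sequences by definition, so the finite one is continued by empty sets, which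
  cost nothing.\<close>

lemma hausdorff_premeasure_finite_cover:
  assumes I: "finite I" and cov: "A \<subseteq> (\<Union>i\<in>I. V i)" and s: "s > 0"
    and V: "\<And>i. i \<in> I \<Longrightarrow> bounded (V i)" "\<And>i. i \<in> I \<Longrightarrow> diameter (V i) \<le> d"
    and d: "0 \<le> d" "d \<le> \<delta>"
  shows "hausdorff_premeasure s \<delta> A \<le> ennreal (real (card I) * d powr s)"
proof -
  obtain f where f: "bij_betw f {0..<card I} I" using ex_bij_betw_nat_finite[OF I] by blast
  define U where "U = (\<lambda>n. if n < card I then V (f n) else {})"
  have fI: "f n \<in> I" if "n < card I" for n using f that by (auto simp: bij_betw_def)
  have dU: "bounded (U n)" "diameter (U n) \<le> d" for n
    using V fI[of n] d by (auto simp: U_def)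
  have "A \<subseteq> (\<Union>n. U n)"
  proof
    fix x assume "x \<in> A"
    then obtain i where i: "i \<in> I" "x \<in> V i" using cov by blast
    then obtain n where "n \<in> {0..<card I}" "f n = i"
      using f by (metis bij_betw_imp_surj_on imageE)
    then show "x \<in> (\<Union>n. U n)" using i by (auto simp: U_def)
  qed
  moreover have "\<forall>n. bounded (U n) \<and> diameter (U n) \<le> \<delta>" using dU d order_trans by blast
  ultimately have "hausdorff_premeasure s \<delta> A \<le> (\<Sum>n. hausdorff_gauge s (U n))"
    unfolding hausdorff_premeasure_def by (intro INF_lower) simp
  also have "\<dots> = (\<Sum>n\<in>{0..<card I}. hausdorff_gauge s (U n))"
    by (rule suminf_finite) (auto simp: U_def hausdorff_gauge_def)
  also have "\<dots> \<le> (\<Sum>n\<in>{0..<card I}. ennreal (d powr s))"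
  proof (rule sum_mono)
    fix n
    have "diameter (U n) powr s \<le> d powr s"
      using dU s by (intro powr_mono2) (auto simp: diameter_ge_0)
    then show "hausdorff_gauge s (U n) \<le> ennreal (d powr s)"
      using s by (auto simp: hausdorff_gauge_def intro: ennreal_leI)
  qed
  also have "\<dots> = ennreal (real (card I) * d powr s)"
    by (simp add: ennreal_mult' ennreal_of_nat_eq_real_of_nat)
  finally show ?thesis .
qed

section \<open>b-adic intervals on the circle\<close>

lemma to_circle_rep: "to_circle (rep_circle x) = x"
  by (metis Quotient3_abs_rep Quotient3_circle)

lemma bounded_circle: "bounded (S :: circle set)"
proof -
  have "dist x y \<le> 1" for x y :: circle
  proof -
    obtain u v where uv: "x = to_circle u" "y = to_circle v" by (metis to_circle_rep)
    have "infdist (u - v) \<int> \<le> dist (u - v) (of_int \<lfloor>u - v\<rfloor>)" by (intro infdist_le) simp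
    also have "\<dots> \<le> 1" unfolding dist_real_def by linarith
    finally show ?thesis by (simp add: uv dist_circle.abs_eq)
  qed
  then show ?thesis unfolding bounded_def by blast
qed

lemma to_circle_eq_iff: "to_circle x = to_circle y \<longleftrightarrow> x - y \<in> \<int>"
  using circle.abs_eq_iff by simp

lemma diameter_to_circle_interval:
  assumes "u \<le> v"
  shows "diameter (to_circle ` {u..v}) \<le> v - u"
proof -
  have *: "dist x y \<le> v - u" if "x \<in> to_circle ` {u..v}" "y \<in> to_circle ` {u..v}" for x y
  proof -
    from that obtain a c where ac: "a \<in> {u..v}" "c \<in> {u..v}" "x = to_circle a" "y = to_circle c" by auto
    have "dist x y \<le> dist a c" unfolding ac by (rule dist_to_circle_le)
    also have "\<dots> \<le> v - u" using ac by (auto simp: dist_real_def)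
    finally show ?thesis .
  qed
  have "(SUP (x, y)\<in>to_circle ` {u..v} \<times> to_circle ` {u..v}. dist x y) \<le> v - u"
  proof (rule cSUP_least)
    show "to_circle ` {u..v} \<times> to_circle ` {u..v} \<noteq> {}" using assms by simp
    fix p assume "p \<in> to_circle ` {u..v} \<times> to_circle ` {u..v}"
    then show "(case p of (x, y) \<Rightarrow> dist x y) \<le> v - u" using * by auto
  qed
  then show ?thesis using assms by (simp add: diameter_def)
qed

text \<open>The intervals are closed because the scaled tail of an expansion may be 0 as well as
  1.\<close>

definition badic :: "nat \<Rightarrow> nat \<Rightarrow> int \<Rightarrow> circle set" where
  "badic b n Y = to_circle ` {real_of_int Y / real b ^ n .. (real_of_int Y + 1) / real b ^ n}"

text \<open>After scaling by \<open>b ^ n\<close>, some point of a touching interval is within 1 of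
  a fixed point of \<open>U\<close>, up to a multiple of \<open>b ^ n\<close>. Up to that multiple,
  \<open>Y\<close> lies in a window of length 3, which meets only the four integers from
  \<open>a - 2\<close> to \<open>a + 1\<close>.\<close>

lemma badic_touch_card:
  assumes b: "b > 0" and U: "diameter U \<le> 1 / real b ^ n"
  shows "card {Y \<in> {0..<int b ^ n}. badic b n Y \<inter> U \<noteq> {}} \<le> 4"
proof (cases "U = {}")
  case False
  then obtain u where u: "u \<in> U" by blast
  obtain \<pi> where \<pi>: "u = to_circle \<pi>" by (metis to_circle_rep)
  have bn: "real b ^ n > 0" using b by simp
  define a where "a = \<lfloor>real b ^ n * \<pi>\<rfloor>"
  have "{Y \<in> {0..<int b ^ n}. badic b n Y \<inter> U \<noteq> {}} \<subseteq> (\<lambda>w. w mod int b ^ n) ` {a - 2..a + 1}"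
  proof
    fix Y assume "Y \<in> {Y \<in> {0..<int b ^ n}. badic b n Y \<inter> U \<noteq> {}}"
    then obtain \<eta> where Y: "Y \<in> {0..<int b ^ n}"
      and \<eta>: "real_of_int Y / real b ^ n \<le> \<eta>" "\<eta> \<le> (real_of_int Y + 1) / real b ^ n" "to_circle \<eta> \<in> U"
      by (auto simp: badic_def)
    have "dist (to_circle \<eta>) (to_circle \<pi>) \<le> diameter U"
      using \<eta>(3) u unfolding \<pi> by (intro diameter_bounded_bound bounded_circle)
    then have "infdist (\<eta> - \<pi>) \<int> \<le> 1 / real b ^ n" using U by (simp add: dist_circle.abs_eq)
    moreover obtain z where z: "z \<in> (\<int> :: real set)" "infdist (\<eta> - \<pi>) \<int> = dist (\<eta> - \<pi>) z"
      using infdist_attains_inf[OF closed_Ints, of "\<eta> - \<pi>"] Ints_0 by blast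
    moreover obtain i where i: "z = real_of_int i" using z(1) by (auto elim: Ints_cases)
    ultimately have "\<bar>\<eta> - \<pi> - i\<bar> \<le> 1 / real b ^ n" by (simp add: dist_real_def)
    then have "real b ^ n * \<bar>\<eta> - \<pi> - i\<bar> \<le> real b ^ n * (1 / real b ^ n)"
      using bn by (intro mult_left_mono) auto
    then have "\<bar>real b ^ n * (\<eta> - \<pi> - i)\<bar> \<le> 1" using b by (simp add: abs_mult)
    moreover have "real_of_int Y \<le> real b ^ n * \<eta>" "real b ^ n * \<eta> \<le> real_of_int Y + 1"
      using \<eta> bn by (simp_all add: pos_divide_le_eq pos_le_divide_eq mult.commute)
    moreover have "real b ^ n * (\<eta> - \<pi> - i) = real b ^ n * \<eta> - real b ^ n * \<pi> - real_of_int (int b ^ n * i)"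
      by (simp add: algebra_simps)
    ultimately have "real b ^ n * \<pi> - 2 \<le> real_of_int (Y - int b ^ n * i)"
      "real_of_int (Y - int b ^ n * i) \<le> real b ^ n * \<pi> + 1" by linarith+
    then have "Y - int b ^ n * i \<in> {a - 2..a + 1}" unfolding a_def atLeastAtMost_iff by linarith
    moreover have "Y = (Y - int b ^ n * i) mod int b ^ n"
    proof -
      have "(Y - int b ^ n * i) mod int b ^ n = Y mod int b ^ n"
        by (metis minus_mult_right mod_mult_self2 uminus_add_conv_diff add.commute)
      then show ?thesis using Y by simp
    qed
    ultimately show "Y \<in> (\<lambda>w. w mod int b ^ n) ` {a - 2..a + 1}" by blast
  qed
  then have "card {Y \<in> {0..<int b ^ n}. badic b n Y \<inter> U \<noteq> {}} \<le> card ((\<lambda>w. w mod int b ^ n) ` {a - 2..a + 1})"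
    by (intro card_mono) auto
  also have "\<dots> \<le> card {a - 2..a + 1}" by (intro card_image_le) simp
  finally show ?thesis by simp
qed simp

section \<open>Prefixes of expansions and the covering bound\<close>

context digit_pair
begin

abbreviation "B \<equiv> real b"

lemma digit_series:
  assumes d: "\<And>n. n \<ge> 1 \<Longrightarrow> d n \<in> D" and D: "D \<subseteq> {0..int b - 1}"
  shows "summable (\<lambda>n. real_of_int (d (Suc n)) / B ^ Suc n)"
    "0 \<le> (\<Sum>n. real_of_int (d (Suc n)) / B ^ Suc n)" "(\<Sum>n. real_of_int (d (Suc n)) / B ^ Suc n) \<le> 1"
proof -
  have dr: "0 \<le> real_of_int (d (Suc n))" "real_of_int (d (Suc n)) \<le> B - 1" for n
    using d[of "Suc n"] D by (auto simp: subset_iff)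
  have "(\<lambda>n. (1 / B) ^ n) sums (1 / (1 - 1 / B))" using b2 by (intro geometric_sums) simp
  then have "(\<lambda>n. ((B - 1) / B) * (1 / B) ^ n) sums (((B - 1) / B) * (1 / (1 - 1 / B)))"
    by (rule sums_mult)
  moreover have "((B - 1) / B) * (1 / (1 - 1 / B)) = 1"
  proof -
    have "B \<noteq> 0" "B - 1 \<noteq> 0" using b2 by auto
    moreover have "1 - 1 / B = (B - 1) / B" using b2 by (simp add: diff_divide_distrib)
    ultimately show ?thesis by simp
  qed
  moreover have "((B - 1) / B) * (1 / B) ^ n = (B - 1) / B ^ Suc n" for n
    by (simp add: power_divide)
  ultimately have sums1: "(\<lambda>n. (B - 1) / B ^ Suc n) sums 1" by (simp only:)
  have le: "real_of_int (d (Suc n)) / B ^ Suc n \<le> (B - 1) / B ^ Suc n" for n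
    using dr[of n] by (intro divide_right_mono) auto
  show sm: "summable (\<lambda>n. real_of_int (d (Suc n)) / B ^ Suc n)"
    by (rule summable_comparison_test'[OF sums_summable[OF sums1], of 0]) (use le dr in auto)
  show "0 \<le> (\<Sum>n. real_of_int (d (Suc n)) / B ^ Suc n)" using dr by (intro suminf_nonneg sm) auto
  show "(\<Sum>n. real_of_int (d (Suc n)) / B ^ Suc n) \<le> 1"
    using suminf_le[OF le sm sums_summable[OF sums1]] sums_unique[OF sums1] by simp
qed

text \<open>Scaled by \<open>b ^ n\<close>, the series is the integer prefix plus the series of the
  shifted digits, which again lies in \<open>[0, 1]\<close>.\<close>

lemma prefix_bounds:
  assumes X0: "X 0 = 0" and X: "\<And>n. X (Suc n) = int b * X n + d (Suc n)"
    and d: "\<And>n. n \<ge> 1 \<Longrightarrow> d n \<in> D" and D: "D \<subseteq> {0..int b - 1}"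
  shows "real_of_int (X n) \<le> B ^ n * (\<Sum>n. real_of_int (d (Suc n)) / B ^ Suc n)"
    "B ^ n * (\<Sum>n. real_of_int (d (Suc n)) / B ^ Suc n) \<le> real_of_int (X n) + 1"
proof -
  have bp: "B > 0" using b2 by simp
  have part: "B ^ n * (\<Sum>i<n. real_of_int (d (Suc i)) / B ^ Suc i) = real_of_int (X n)" for n
  proof (induction n)
    case (Suc n)
    have "B ^ Suc n * (\<Sum>i<Suc n. real_of_int (d (Suc i)) / B ^ Suc i)
        = B * (B ^ n * (\<Sum>i<n. real_of_int (d (Suc i)) / B ^ Suc i)) + real_of_int (d (Suc n))"
      using bp by (simp add: algebra_simps)
    then show ?case unfolding Suc by (simp add: X)
  qed (simp add: X0)
  have d': "\<And>i. i \<ge> 1 \<Longrightarrow> (\<lambda>i. d (i + n)) i \<in> D" using d by simp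
  have eq: "B ^ n * (\<Sum>i. real_of_int (d (Suc i)) / B ^ Suc i)
      = (\<Sum>i. real_of_int (d (Suc i + n)) / B ^ Suc i) + real_of_int (X n)"
  proof -
    have "(\<Sum>i. real_of_int (d (Suc i)) / B ^ Suc i)
       = (\<Sum>i. real_of_int (d (Suc (i + n))) / B ^ Suc (i + n)) + (\<Sum>i<n. real_of_int (d (Suc i)) / B ^ Suc i)"
      by (rule suminf_split_initial_segment[OF digit_series(1)[OF d D]])
    moreover have "B ^ n * (\<Sum>i. real_of_int (d (Suc (i + n))) / B ^ Suc (i + n))
        = (\<Sum>i. B ^ n * (real_of_int (d (Suc (i + n))) / B ^ Suc (i + n)))"
      using summable_ignore_initial_segment[OF digit_series(1)[OF d D], where k = n]
      by (intro suminf_mult[symmetric]) simp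
    moreover have "B ^ n * (real_of_int (d (Suc (i + n))) / B ^ Suc (i + n)) = real_of_int (d (Suc i + n)) / B ^ Suc i" for i
      using bp by (simp add: power_add)
    ultimately show ?thesis by (simp only: distrib_left part)
  qed
  show "real_of_int (X n) \<le> B ^ n * (\<Sum>n. real_of_int (d (Suc n)) / B ^ Suc n)"
    "B ^ n * (\<Sum>n. real_of_int (d (Suc n)) / B ^ Suc n) \<le> real_of_int (X n) + 1"
    unfolding eq using digit_series(2,3)[where d = "\<lambda>i. d (i + n)", OF d' D] by simp_all
qed

lemma K_prefixes:
  assumes "x \<in> digit_set_K b D" and D: "D \<subseteq> {0..int b - 1}"
  obtains \<eta> X where "x = to_circle \<eta>" "\<And>n. X n \<in> digs b D n" "X 0 = 0"
    "\<And>n. real_of_int (X n) \<le> B ^ n * \<eta>" "\<And>n. B ^ n * \<eta> \<le> real_of_int (X n) + 1"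
proof -
  obtain d where d: "\<And>n. n \<ge> 1 \<Longrightarrow> d n \<in> D"
    and x: "x = to_circle (\<Sum>n. real_of_int (d (Suc n)) / B ^ Suc n)"
    using assms(1) unfolding digit_set_K_def by auto
  define X where "X = rec_nat 0 (\<lambda>n x. int b * x + d (Suc n))"
  have X: "X 0 = 0" "\<And>n. X (Suc n) = int b * X n + d (Suc n)" by (simp_all add: X_def)
  have "X n \<in> digs b D n" for n
  proof (induction n)
    case (Suc n)
    have ds: "d (Suc n) \<in> D" using d by simp
    then have "0 \<le> d (Suc n)" "d (Suc n) < int b" using D by auto
    then have "(int b * X n + d (Suc n)) div int b = X n" "(int b * X n + d (Suc n)) mod int b = d (Suc n)"
      by simp_all
    then show ?case using Suc ds by (simp add: X(2))
  qed (simp add: X)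
  then show ?thesis by (rule that[OF x _ X(1) prefix_bounds[OF X d D]])
qed

lemma K_limit:
  assumes X0: "X 0 = 0" and X: "\<And>n. X (Suc n) div int b = X n" "\<And>n. X (Suc n) mod int b \<in> D"
    and D: "D \<subseteq> {0..int b - 1}"
  obtains \<eta> where "to_circle \<eta> \<in> digit_set_K b D"
    "\<And>n. real_of_int (X n) \<le> B ^ n * \<eta>" "\<And>n. B ^ n * \<eta> \<le> real_of_int (X n) + 1"
proof -
  define d where "d = (\<lambda>n. X n mod int b)"
  have d: "d n \<in> D" if "n \<ge> 1" for n using X(2)[of "n - 1"] that by (simp add: d_def)
  have rec: "X (Suc n) = int b * X n + d (Suc n)" for n
    using mult_div_mod_eq[of "int b" "X (Suc n)"] by (simp add: X(1) d_def)
  have "to_circle (\<Sum>n. real_of_int (d (Suc n)) / B ^ Suc n) \<in> digit_set_K b D"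
    unfolding digit_set_K_def using d by blast
  then show ?thesis using that prefix_bounds[OF X0 rec d D] by blast
qed

definition pre :: "real \<Rightarrow> nat \<Rightarrow> nat" where "pre \<tau> n = nat \<lfloor>B ^ n * \<tau>\<rfloor>"

lemma pre_div: 
  assumes "0 \<le> \<tau>"
  shows "pre \<tau> (n + m) div b ^ m = pre \<tau> n"
proof -
  have nn: "0 \<le> \<lfloor>B ^ (n + m) * \<tau>\<rfloor>" using assms by simp
  have "\<lfloor>B ^ (n + m) * \<tau>\<rfloor> div int (b ^ m) = \<lfloor>B ^ (n + m) * \<tau> / real_of_int (int (b ^ m))\<rfloor>"
    by (rule floor_divide_real_eq_div[symmetric]) simp
  also have "B ^ (n + m) * \<tau> / real_of_int (int (b ^ m)) = B ^ n * \<tau>"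
    using b2 by (simp add: power_add)
  finally show ?thesis unfolding pre_def by (metis nat_div_distrib[OF nn] nat_int)
qed

lemma pre_bounds:
  assumes "0 \<le> \<tau>"
  shows "real (pre \<tau> n) \<le> B ^ n * \<tau>" "B ^ n * \<tau> < real (pre \<tau> n) + 1"
proof -
  have "0 \<le> B ^ n * \<tau>" using assms by simp
  then have "real (pre \<tau> n) = real_of_int \<lfloor>B ^ n * \<tau>\<rfloor>" by (simp add: pre_def)
  then show "real (pre \<tau> n) \<le> B ^ n * \<tau>" "B ^ n * \<tau> < real (pre \<tau> n) + 1" by linarith+
qed

lemma pre_0: "0 \<le> \<tau> \<Longrightarrow> \<tau> < 1 \<Longrightarrow> pre \<tau> 0 = 0"
  by (simp add: pre_def floor_eq_iff)

definition E :: "real \<Rightarrow> circle set" where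
  "E \<tau> = (\<lambda>x. x + to_circle \<tau>) ` digit_set_K b D1 \<inter> digit_set_K b D2"

definition total :: "real \<Rightarrow> nat \<Rightarrow> real" where
  "total \<tau> n = row n (pre \<tau> n) 0 + row n (pre \<tau> n) 1"

lemma E_subset_badic:
  assumes \<tau>: "0 \<le> \<tau>" "\<tau> < 1" and nb: "\<And>n. B ^ n * \<tau> \<notin> \<int>" and y: "y \<in> E \<tau>"
  shows "\<exists>j\<in>{0,1}. \<exists>k\<in>{0,1}. \<exists>(X, Y)\<in>nodes n (pre \<tau> n) j k. y \<in> badic b n Y"
proof -
  obtain x where x: "x \<in> digit_set_K b D1" "y = x + to_circle \<tau>" and y2: "y \<in> digit_set_K b D2"
    using y by (auto simp: E_def)
  obtain \<xi> X where X: "x = to_circle \<xi>" "\<And>n. X n \<in> digs b D1 n" "X 0 = 0"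
    "\<And>n. real_of_int (X n) \<le> B ^ n * \<xi>" "\<And>n. B ^ n * \<xi> \<le> real_of_int (X n) + 1"
    using K_prefixes[OF x(1) D1] by metis
  obtain \<eta> Y where Y: "y = to_circle \<eta>" "\<And>n. Y n \<in> digs b D2 n" "Y 0 = 0"
    "\<And>n. real_of_int (Y n) \<le> B ^ n * \<eta>" "\<And>n. B ^ n * \<eta> \<le> real_of_int (Y n) + 1"
    using K_prefixes[OF y2 D2] by metis
  have "to_circle (\<xi> + \<tau>) = to_circle \<eta>" using x(2) X(1) Y(1) by (simp add: plus_circle.abs_eq)
  then have "\<xi> + \<tau> - \<eta> \<in> \<int>" by (simp add: to_circle_eq_iff)
  then obtain k where "\<xi> + \<tau> - \<eta> = real_of_int k" by (auto elim: Ints_cases)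
  then have keq: "\<xi> + \<tau> = \<eta> + real_of_int k" by simp
  \<comment> \<open>\<open>c n\<close> is the remainder of \<open>\<xi>\<close> plus that of
    \<open>\<tau>\<close> minus that of \<open>\<eta>\<close> after removing the prefixes of length
    \<open>n\<close>. Since \<open>B ^ n * \<tau>\<close> is not an integer, the remainder of
    \<open>\<tau>\<close> lies strictly between 0 and 1, so only the carries 0 and 1 are
    possible.\<close>
  define c where "c = (\<lambda>n. Y n + int b ^ n * k - X n - int (pre \<tau> n))"
  have c01: "c n \<in> {0,1}" for n
  proof -
    have ne: "real (pre \<tau> n) \<noteq> B ^ n * \<tau>" using nb[of n] by (metis Ints_of_nat)
    have "B ^ n * (\<xi> + \<tau>) = B ^ n * (\<eta> + real_of_int k)" using keq by simp
    then have eq: "B ^ n * \<xi> + B ^ n * \<tau> = B ^ n * \<eta> + real_of_int (int b ^ n * k)"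
      by (simp add: distrib_left)
    have "real_of_int (c n) = real_of_int (Y n) + real_of_int (int b ^ n * k) - real_of_int (X n) - real (pre \<tau> n)"
      by (simp add: c_def)
    then have "real_of_int (c n) > -1" "real_of_int (c n) < 2"
      using eq X(4,5)[of n] Y(4,5)[of n] pre_bounds[OF \<tau>(1), of n] ne by linarith+
    then show ?thesis by auto
  qed
  \<comment> \<open>At level 0 all prefixes vanish, so \<open>c 0 = k\<close>.\<close>
  have k01: "k \<in> {0,1}" using c01[of 0] X(3) Y(3) pre_0[OF \<tau>] by (simp add: c_def)
  have "(X n, Y n) \<in> nodes n (pre \<tau> n) (c n) k"
    using X(2) Y(2) by (simp add: nodes_def c_def)
  moreover have "y \<in> badic b n (Y n)"
  proof -
    have "B ^ n > 0" using b2 by simp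
    then have "\<eta> \<in> {real_of_int (Y n) / B ^ n .. (real_of_int (Y n) + 1) / B ^ n}"
      using Y(4,5)[of n] by (simp add: pos_divide_le_eq pos_le_divide_eq mult.commute)
    then show ?thesis unfolding badic_def Y(1) by (rule imageI)
  qed
  ultimately show ?thesis using c01[of n] k01 by blast
qed

lemma badic_diameter: "diameter (badic b n Y) \<le> 1 / B ^ n"
proof -
  have "real_of_int Y / B ^ n \<le> (real_of_int Y + 1) / B ^ n" by (intro divide_right_mono) auto
  then have "diameter (badic b n Y) \<le> (real_of_int Y + 1) / B ^ n - real_of_int Y / B ^ n"
    unfolding badic_def by (rule diameter_to_circle_interval)
  then show ?thesis by (simp flip: diff_divide_distrib)
qed

lemma hausdorff_measure_zero:
  assumes \<tau>: "0 \<le> \<tau>" "\<tau> < 1" and nb: "\<And>n. B ^ n * \<tau> \<notin> \<int>" and s: "s > 0"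
    and lim: "(\<lambda>n. total \<tau> n * (1 / B ^ n) powr s) \<longlonglongrightarrow> 0"
  shows "hausdorff_measure s (E \<tau>) = 0"
proof -
  have "hausdorff_premeasure s \<delta> (E \<tau>) = 0" if \<delta>: "\<delta> > 0" for \<delta>
  proof -
    define I where "I = (\<lambda>n. SIGMA j:{0,1::int}. SIGMA k:{0,1::int}. nodes n (pre \<tau> n) j k)"
    have fin: "finite (I n)" for n unfolding I_def by (intro finite_SigmaI) (auto simp: nodes_finite)
    have cardI: "real (card (I n)) = total \<tau> n" for n
      unfolding I_def by (simp add: card_SigmaI nodes_finite total_def row_def)
    have bd: "hausdorff_premeasure s \<delta> (E \<tau>) \<le> ennreal (total \<tau> n * (1 / B ^ n) powr s)"
      if "1 / B ^ n \<le> \<delta>" for n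
    proof -
      have "E \<tau> \<subseteq> (\<Union>i\<in>I n. badic b n (snd (snd (snd i))))"
      proof
        fix y assume "y \<in> E \<tau>"
        then obtain j k X Y where "j \<in> {0,1}" "k \<in> {0,1}" "(X, Y) \<in> nodes n (pre \<tau> n) j k" "y \<in> badic b n Y"
          using E_subset_badic[OF \<tau> nb, of y n] by blast
        then have "(j, k, X, Y) \<in> I n" "y \<in> badic b n (snd (snd (snd (j, k, X, Y))))"
          by (simp_all add: I_def)
        then show "y \<in> (\<Union>i\<in>I n. badic b n (snd (snd (snd i))))" by blast
      qed
      from hausdorff_premeasure_finite_cover[OF fin this s bounded_circle badic_diameter _ that]
      show ?thesis by (simp add: cardI)
    qed
    have "(\<lambda>n. (1 / B) ^ n) \<longlonglongrightarrow> 0" using b2 by (intro LIMSEQ_realpow_zero) auto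
    then have "\<forall>\<^sub>F n in sequentially. (1 / B) ^ n < \<delta>" using \<delta> by (rule order_tendstoD)
    then have ev: "\<forall>\<^sub>F n in sequentially. hausdorff_premeasure s \<delta> (E \<tau>) \<le> ennreal (total \<tau> n * (1 / B ^ n) powr s)"
      by (auto elim!: eventually_mono intro!: bd simp: power_divide)
    have "(\<lambda>n. ennreal (total \<tau> n * (1 / B ^ n) powr s)) \<longlonglongrightarrow> ennreal 0"
      using lim by (intro tendsto_ennrealI)
    then have "hausdorff_premeasure s \<delta> (E \<tau>) \<le> ennreal 0"
      by (rule tendsto_lowerbound[OF _ ev]) simp
    then show ?thesis by simp
  qed
  then show ?thesis by (simp add: hausdorff_measure_def)
qed

end

section \<open>Lower bound for the Hausdorff measure\<close>

context digit_pair
begin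

text \<open>A positive diameter is replaced by a b-adic scale coarser by at most a factor
  \<open>b\<close>. Diameter 0 admits no such scale; there a sufficiently deep level costs less than
  \<open>\<eta>\<close>, which can be chosen summable over a cover.\<close>

lemma level_choice:
  assumes d: "0 \<le> d" "d \<le> 1" and s: "s > 0" and \<eta>: "\<eta> > 0"
  shows "\<exists>N. d \<le> 1 / B ^ N \<and> (1 / B ^ N) powr s \<le> B powr s * d powr s + \<eta>"
proof (cases "d = 0")
  case True
  have "(1 / B) powr s < 1 powr s" using b2 s by (intro powr_less_mono2) auto
  then have "(1 / B) powr s < 1" by simp
  then obtain N where N: "((1 / B) powr s) ^ N < \<eta>" using real_arch_pow_inv[OF \<eta>] by blast
  have "(1 / B ^ N) powr s = ((1 / B) powr s) ^ N"
    using b2 by (simp add: powr_power power_one_over powr_powr powr_realpow[symmetric] mult.commute powr_divide)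
  then show ?thesis using N True by (intro exI[of _ N]) simp
next
  case False
  have small: "\<exists>M. (1 / B) ^ M < d" using real_arch_pow_inv[of d "1 / B"] False d b2 by simp
  define M where "M = (LEAST M. (1 / B) ^ M < d)"
  have M: "(1 / B) ^ M < d" unfolding M_def by (rule LeastI_ex[OF small])
  \<comment> \<open>Because \<open>d \<le> 1\<close>, level 0 is not yet below \<open>d\<close>;
    hence a preceding level exists, and it is the finest one not below \<open>d\<close>.\<close>
  have "M \<noteq> 0" using M d by (cases M) auto
  then obtain N where N: "M = Suc N" using not0_implies_Suc by blast
  have "\<not> (1 / B) ^ N < d" using not_less_Least[of N "\<lambda>M. (1 / B) ^ M < d"] N by (simp add: M_def)
  then have 1: "d \<le> 1 / B ^ N" by (simp add: power_one_over)
  have "1 / B ^ N \<le> B * d"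
  proof -
    have "B * (1 / B) ^ M = 1 / B ^ N" using b2 by (simp add: N power_one_over)
    moreover have "B * (1 / B) ^ M \<le> B * d" using M b2 by (intro mult_left_mono) auto
    ultimately show ?thesis by simp
  qed
  then have "(1 / B ^ N) powr s \<le> (B * d) powr s" using s by (intro powr_mono2) auto
  also have "\<dots> = B powr s * d powr s" using d by (simp add: powr_mult)
  finally show ?thesis using 1 \<eta> by (intro exI[of _ N]) simp
qed

text \<open>Once the shift and both carries are fixed, \<open>Y\<close> determines
  \<open>X\<close>.\<close>

lemma card_nodes_filter_le:
  "card {p \<in> nodes n t l k. R (snd p)} \<le> card {Y \<in> {0..<int b ^ n}. R Y}"
proof (rule card_inj_on_le[where f = snd])
  show "inj_on snd {p \<in> nodes n t l k. R (snd p)}"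
    by (rule inj_onI) (auto simp: nodes_def)
  show "snd ` {p \<in> nodes n t l k. R (snd p)} \<subseteq> {Y \<in> {0..<int b ^ n}. R Y}"
    using digs_range[OF D2, of n] by (auto simp: nodes_def subset_iff)
  show "finite {Y \<in> {0..<int b ^ n}. R Y}" by (rule finite_subset[of _ "{0..<int b ^ n}"]) auto
qed

lemma row_nonneg: "0 \<le> row n t j"
  by (simp add: row_def sum_nonneg)

text \<open>\<open>W\<close> is counted in two ways. At most four prefixes are selected for each
  pair of carries, which bounds the sum by \<open>8 * S\<close>; by the cone condition every entry
  of \<open>W\<close> contributes to \<open>total \<tau> M\<close> with a weight of at least a
  quarter of \<open>total \<tau> N\<close>. This gives 32.\<close>

lemma descendants_bound:
  assumes \<tau>: "0 \<le> \<tau>" and NM: "N \<le> M" and R: "card {Y \<in> {0..<int b ^ N}. R Y} \<le> 4"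
    and cone: "\<And>l. l \<in> {0,1} \<Longrightarrow> row N (pre \<tau> N) l \<ge> total \<tau> N / 4"
    and pos: "total \<tau> N > 0"
  shows "(\<Sum>j\<in>{0,1}. \<Sum>k\<in>{0,1}. real (card {p \<in> nodes M (pre \<tau> M) j k. R (snd p div int b ^ (M - N))}))
      \<le> 32 * total \<tau> M / total \<tau> N"
proof -
  define m where "m = M - N"
  have M: "M = N + m" using NM by (simp add: m_def)
  define W where "W = (\<lambda>j l. real (card (nodes m (pre \<tau> M mod b ^ m) j l)))"
  have pd: "pre \<tau> M div b ^ m = pre \<tau> N" unfolding M by (rule pre_div[OF \<tau>])
  define S where "S = W 0 0 + W 0 1 + W 1 0 + W 1 1"
  have le: "real (card {p \<in> nodes M (pre \<tau> M) j k. R (snd p div int b ^ m)}) \<le> 4 * W j 0 + 4 * W j 1"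
    if j: "j \<in> {0,1}" for j k
  proof -
    have c4: "real (card {p \<in> nodes N (pre \<tau> N) l k. R (snd p)}) \<le> 4" for l
      using card_nodes_filter_le[of N "pre \<tau> N" l k R] R by linarith
    have "real (card {p \<in> nodes M (pre \<tau> M) j k. R (snd p div int b ^ m)})
      = W j 0 * real (card {p \<in> nodes N (pre \<tau> N) 0 k. R (snd p)})
        + W j 1 * real (card {p \<in> nodes N (pre \<tau> N) 1 k. R (snd p)})"
      using nodes_split_filter[OF j, of N m "pre \<tau> M" k R] by (simp add: W_def pd M[symmetric])
    also have "\<dots> \<le> W j 0 * 4 + W j 1 * 4"
      using c4 by (intro add_mono mult_left_mono) (auto simp: W_def)
    finally show ?thesis by simp
  qed
  have "(\<Sum>j\<in>{0,1}. \<Sum>k\<in>{0,1}. real (card {p \<in> nodes M (pre \<tau> M) j k. R (snd p div int b ^ m)})) \<le> 8 * S"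
    using le[of 0 0] le[of 0 1] le[of 1 0] le[of 1 1] by (simp add: S_def)
  moreover have "S * (total \<tau> N / 4) \<le> total \<tau> M"
  proof -
    have Wle: "W j l * (total \<tau> N / 4) \<le> W j l * row N (pre \<tau> N) l" if "l \<in> {0,1}" for j l
      using cone[OF that] by (intro mult_left_mono) (auto simp: W_def)
    then have "S * (total \<tau> N / 4) \<le> (W 0 0 * row N (pre \<tau> N) 0 + W 0 1 * row N (pre \<tau> N) 1)
        + (W 1 0 * row N (pre \<tau> N) 0 + W 1 1 * row N (pre \<tau> N) 1)"
    proof -
      have "W 0 0 * (total \<tau> N / 4) \<le> W 0 0 * row N (pre \<tau> N) 0"
        "W 0 1 * (total \<tau> N / 4) \<le> W 0 1 * row N (pre \<tau> N) 1"
        "W 1 0 * (total \<tau> N / 4) \<le> W 1 0 * row N (pre \<tau> N) 0"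
        "W 1 1 * (total \<tau> N / 4) \<le> W 1 1 * row N (pre \<tau> N) 1"
        by (rule Wle, simp)+
      then show ?thesis unfolding S_def distrib_right by linarith
    qed
    also have "\<dots> = total \<tau> M"
      using row_split[of 0 N m "pre \<tau> M"] row_split[of 1 N m "pre \<tau> M"]
      by (simp add: total_def W_def pd M[symmetric])
    finally show ?thesis .
  qed
  then have "8 * S \<le> 32 * total \<tau> M / total \<tau> N" using pos by (simp add: pos_le_divide_eq)
  ultimately show ?thesis by (simp add: m_def)
qed

lemma half_powers_sum: "finite F \<Longrightarrow> (\<Sum>n\<in>F. (1/2) ^ Suc n) \<le> (1::real)"
proof -
  assume "finite F"
  then have "(\<Sum>n\<in>F. (1/2) ^ Suc n) \<le> (\<Sum>n. (1/2) ^ Suc n :: real)"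
    using power_half_series by (intro sum_le_suminf) (auto simp: sums_iff)
  then show ?thesis using power_half_series by (simp add: sums_iff)
qed

theorem hausdorff_measure_nonzero:
  assumes \<tau>: "0 \<le> \<tau>" "\<tau> < 1" and s: "s > 0" and c: "c > 0"
    and tot: "\<And>n. total \<tau> n * (1 / B ^ n) powr s \<ge> c"
    and cone: "\<And>n l. l \<in> {0,1} \<Longrightarrow> row n (pre \<tau> n) l \<ge> total \<tau> n / 4"
  shows "hausdorff_measure s (E \<tau>) \<noteq> 0"
proof
  assume H0: "hausdorff_measure s (E \<tau>) = 0"
  have tpos: "total \<tau> n > 0" for n
  proof (rule ccontr)
    assume "\<not> total \<tau> n > 0"
    moreover have "total \<tau> n \<ge> 0" by (simp add: total_def row_nonneg)
    ultimately show False using tot[of n] c by simp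
  qed
  \<comment> \<open>With the factor 32 of \<open>descendants_bound\<close>, the bad prefixes of any
    level then make up at most 32 / 64 of the total.\<close>
  define \<epsilon> where "\<epsilon> = c / (64 * (B powr s + 1))"
  have Bs: "B powr s + 1 > 0" by (simp add: add_nonneg_pos)
  have \<epsilon>: "\<epsilon> > 0" using c Bs by (simp add: \<epsilon>_def)
  have "hausdorff_premeasure s 1 (E \<tau>) \<le> hausdorff_measure s (E \<tau>)"
    unfolding hausdorff_measure_def by (rule SUP_upper) simp
  then have "hausdorff_premeasure s 1 (E \<tau>) < ennreal \<epsilon>" using H0 \<epsilon> by simp
  then obtain U where cov: "E \<tau> \<subseteq> (\<Union>n. U n)" and U1: "\<And>n. diameter (U n) \<le> 1"
    and sumU: "(\<Sum>n. hausdorff_gauge s (U n)) < ennreal \<epsilon>"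
    unfolding hausdorff_premeasure_def INF_less_iff by auto
  have dge: "0 \<le> diameter (U n)" for n by (rule diameter_ge_0[OF bounded_circle])
  have gauge: "hausdorff_gauge s (U n) = ennreal (diameter (U n) powr s)" for n
    using s by (simp add: hausdorff_gauge_def)
  have sumF: "(\<Sum>n\<in>F. diameter (U n) powr s) \<le> \<epsilon>" if F: "finite F" for F
  proof -
    have "ennreal (\<Sum>n\<in>F. diameter (U n) powr s) = (\<Sum>n\<in>F. hausdorff_gauge s (U n))"
      by (simp add: gauge sum_ennreal)
    also have "\<dots> \<le> (\<Sum>n. hausdorff_gauge s (U n))" by (intro sum_le_suminf F) auto
    finally have "ennreal (\<Sum>n\<in>F. diameter (U n) powr s) < ennreal \<epsilon>" using sumU by simp
    then show ?thesis using \<epsilon> by (simp add: ennreal_less_iff sum_nonneg)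
  qed
  have "\<forall>n. \<exists>N. diameter (U n) \<le> 1 / B ^ N \<and>
      (1 / B ^ N) powr s \<le> B powr s * diameter (U n) powr s + \<epsilon> * (1/2) ^ Suc n"
    using level_choice[OF dge U1 s] \<epsilon> by simp
  then obtain N where N: "\<And>n. diameter (U n) \<le> 1 / B ^ N n"
    "\<And>n. (1 / B ^ N n) powr s \<le> B powr s * diameter (U n) powr s + \<epsilon> * (1/2) ^ Suc n" by metis
  have sumN: "(\<Sum>n\<in>F. (1 / B ^ N n) powr s) \<le> (B powr s + 1) * \<epsilon>" if F: "finite F" for F
  proof -
    have "(\<Sum>n\<in>F. (1 / B ^ N n) powr s) \<le> (\<Sum>n\<in>F. B powr s * diameter (U n) powr s + \<epsilon> * (1/2) ^ Suc n)"
      by (intro sum_mono N)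
    also have "\<dots> = B powr s * (\<Sum>n\<in>F. diameter (U n) powr s) + \<epsilon> * (\<Sum>n\<in>F. (1/2) ^ Suc n)"
      by (simp only: sum.distrib sum_distrib_left)
    also have "\<dots> \<le> B powr s * \<epsilon> + \<epsilon> * 1"
      using sumF[OF F] half_powers_sum[OF F] \<epsilon> by (intro add_mono mult_left_mono) auto
    finally show ?thesis by (simp add: algebra_simps)
  qed
  define touch where "touch = (\<lambda>n Y. badic b (N n) Y \<inter> U n \<noteq> {})"
  \<comment> \<open>A prefix is bad if its ancestor at the level \<open>N n\<close> chosen for some
    \<open>U n\<close> has an interval meeting \<open>U n\<close>. Badness passes to all extensions,
    so the prefixes that are not bad form a tree.\<close>
  define bad where "bad = (\<lambda>M Y. \<exists>n. N n \<le> M \<and> touch n (Y div int b ^ (M - N n)))"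
  \<comment> \<open>The outgoing carry \<open>k\<close> belongs to the vertex, because the limit
    needs one integer \<open>k\<close> along the whole path; the incoming carry may vary with the
    level.\<close>
  define L where "L = (\<lambda>M. {(k, X, Y). k \<in> {0,1::int} \<and>
      (\<exists>j\<in>{0,1}. (X, Y) \<in> nodes M (pre \<tau> M) j k) \<and> \<not> bad M Y})"
  define p where "p = (\<lambda>(k::int, X, Y). (k, X div int b, Y div int b))"
  have finL: "finite (L M)" for M
  proof (rule finite_subset)
    show "L M \<subseteq> {0,1} \<times> digs b D1 M \<times> digs b D2 M" by (auto simp: L_def nodes_def)
    show "finite ({0,1::int} \<times> digs b D1 M \<times> digs b D2 M)" by (simp add: digs_finite D1 D2)
  qed
  have neL: "L M \<noteq> {}" for M
  proof
    assume empty: "L M = {}"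
    define badY where "badY = {Y \<in> digs b D2 M. bad M Y}"
    have "\<forall>Y\<in>badY. \<exists>n. N n \<le> M \<and> touch n (Y div int b ^ (M - N n))"
      by (auto simp: badY_def bad_def)
    \<comment> \<open>One covering set is selected per bad prefix, so the union bound runs over a
      finite index set although the cover is infinite.\<close>
    then obtain h where h: "\<And>Y. Y \<in> badY \<Longrightarrow> N (h Y) \<le> M \<and> touch (h Y) (Y div int b ^ (M - N (h Y)))"
      by metis
    define F where "F = h ` badY"
    have F: "finite F" unfolding F_def badY_def by (simp add: digs_finite[OF D2])
    define C where "C = (\<lambda>n j k. {p \<in> nodes M (pre \<tau> M) j k. touch n (snd p div int b ^ (M - N n))})"
    have sub: "nodes M (pre \<tau> M) j k \<subseteq> (\<Union>n\<in>F. C n j k)" if "j \<in> {0,1}" "k \<in> {0,1}" for j k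
    proof
      fix q assume q: "q \<in> nodes M (pre \<tau> M) j k"
      obtain X Y where XY: "q = (X, Y)" by (cases q)
      have "(k, X, Y) \<notin> L M" using empty by simp
      then have "bad M Y" using that q XY by (auto simp: L_def)
      then have "Y \<in> badY" using q XY by (auto simp: badY_def nodes_def)
      then have "q \<in> C (h Y) j k" "h Y \<in> F" using h[of Y] q XY by (auto simp: C_def F_def)
      then show "q \<in> (\<Union>n\<in>F. C n j k)" by blast
    qed
    have cardle: "real (card (nodes M (pre \<tau> M) j k)) \<le> (\<Sum>n\<in>F. real (card (C n j k)))"
      if "j \<in> {0,1}" "k \<in> {0,1}" for j k
    proof -
      have "card (nodes M (pre \<tau> M) j k) \<le> card (\<Union>n\<in>F. C n j k)"
        using sub[OF that] F by (intro card_mono finite_UN_I) (auto simp: C_def nodes_finite)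
      also have "\<dots> \<le> (\<Sum>n\<in>F. card (C n j k))" by (rule card_UN_le[OF F])
      finally have "real (card (nodes M (pre \<tau> M) j k)) \<le> real (\<Sum>n\<in>F. card (C n j k))" by (simp only: of_nat_le_iff)
      then show ?thesis by simp
    qed
    have "total \<tau> M = (\<Sum>j\<in>{0,1}. \<Sum>k\<in>{0,1}. real (card (nodes M (pre \<tau> M) j k)))"
      by (simp add: total_def row_def)
    also have "\<dots> \<le> (\<Sum>j\<in>{0,1}. \<Sum>k\<in>{0,1}. \<Sum>n\<in>F. real (card (C n j k)))"
      by (intro sum_mono cardle)
    also have "\<dots> = (\<Sum>n\<in>F. \<Sum>j\<in>{0,1}. \<Sum>k\<in>{0,1}. real (card (C n j k)))"
      by (simp add: sum.distrib)
    also have "\<dots> \<le> (\<Sum>n\<in>F. 32 * total \<tau> M / c * (1 / B ^ N n) powr s)"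
    proof (rule sum_mono)
      fix n assume "n \<in> F"
      then have NM: "N n \<le> M" using h by (auto simp: F_def)
      have "(\<Sum>j\<in>{0,1}. \<Sum>k\<in>{0,1}. real (card (C n j k))) \<le> 32 * total \<tau> M / total \<tau> (N n)"
        unfolding C_def
      proof (rule descendants_bound[OF \<tau>(1) NM _ cone tpos])
        show "card {Y \<in> {0..<int b ^ N n}. touch n Y} \<le> 4"
          unfolding touch_def using b2 by (intro badic_touch_card N) simp
      qed
      also have "\<dots> \<le> 32 * total \<tau> M / c * (1 / B ^ N n) powr s"
      proof -
        have "1 / total \<tau> (N n) \<le> (1 / B ^ N n) powr s / c"
          using tot[of "N n"] tpos[of "N n"] c by (simp add: field_simps)
        then have "32 * total \<tau> M * (1 / total \<tau> (N n)) \<le> 32 * total \<tau> M * ((1 / B ^ N n) powr s / c)"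
          using tpos[of M] by (intro mult_left_mono) auto
        then show ?thesis by simp
      qed
      finally show "(\<Sum>j\<in>{0,1}. \<Sum>k\<in>{0,1}. real (card (C n j k))) \<le> 32 * total \<tau> M / c * (1 / B ^ N n) powr s" .
    qed
    also have "\<dots> = 32 * total \<tau> M / c * (\<Sum>n\<in>F. (1 / B ^ N n) powr s)" by (simp add: sum_distrib_left)
    also have "\<dots> \<le> 32 * total \<tau> M / c * ((B powr s + 1) * \<epsilon>)"
      using sumN[OF F] tpos[of M] c by (intro mult_left_mono) auto
    also have "(B powr s + 1) * \<epsilon> = c / 64"
    proof -
      have "x * (c / (64 * x)) = c / 64" if "x > 0" for x :: real using that by simp
      then show ?thesis unfolding \<epsilon>_def using Bs by blast
    qed
    finally show False using c tpos[of M] by simp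
  qed
  have par: "p x \<in> L n" if "x \<in> L (Suc n)" for n x
  proof -
    obtain k X Y where x: "x = (k, X, Y)" by (cases x)
    have kb: "k \<in> {0,1}" "\<not> bad (Suc n) Y"
      and "\<exists>j\<in>{0,1}. (X, Y) \<in> nodes (n + 1) (pre \<tau> (n + 1)) j k"
      using that by (simp_all add: L_def x)
    then obtain j where j: "j \<in> {0,1}" "(X, Y) \<in> nodes (n + 1) (pre \<tau> (n + 1)) j k"
      by blast
    have "\<exists>l\<in>{0,1}. (X div int b, Y div int b) \<in> nodes n (pre \<tau> n) l k"
      using nodes_div_mod(1,3)[OF j(2,1)] pre_div[OF \<tau>(1), of n 1] by auto
    moreover have "\<not> bad n (Y div int b)"
    proof
      assume "bad n (Y div int b)"
      then obtain i where i: "N i \<le> n" "touch i (Y div int b div int b ^ (n - N i))" by (auto simp: bad_def)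
      moreover have "Y div int b div int b ^ (n - N i) = Y div int b ^ (Suc n - N i)"
        using i(1) by (simp add: Suc_diff_le zdiv_zmult2_eq)
      ultimately have "bad (Suc n) Y" unfolding bad_def by (intro exI[of _ i]) auto
      then show False using kb by simp
    qed
    ultimately show ?thesis using kb by (auto simp: L_def p_def x)
  qed
  obtain f where f: "\<And>n. f n \<in> L n" "\<And>n. p (f (Suc n)) = f n"
    using konig[of L p, OF finL neL par] by blast
  define k X Y where "k = fst (f 0)" and "X = (\<lambda>n. fst (snd (f n)))" and "Y = (\<lambda>n. snd (snd (f n)))"
  have fst_f: "fst (f n) = k" for n
  proof (induction n)
    case (Suc n)
    have "fst (p (f (Suc n))) = fst (f (Suc n))" by (simp add: p_def split: prod.split)
    then show ?case using f(2)[of n] Suc by simp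
  qed (simp add: k_def)
  have fn: "f n = (k, X n, Y n)" for n
    using fst_f[of n] by (simp add: X_def Y_def prod_eq_iff)
  have nd: "\<exists>j\<in>{0,1}. (X n, Y n) \<in> nodes n (pre \<tau> n) j k" and nbad: "\<not> bad n (Y n)" for n
    using f(1)[of n] by (auto simp: fn L_def)
  have dv: "X (Suc n) div int b = X n" "Y (Suc n) div int b = Y n" for n
    using f(2)[of n] by (auto simp: fn p_def)
  have "X n \<in> digs b D1 n" "Y n \<in> digs b D2 n" for n using nd[of n] by (auto simp: nodes_def)
  from this[of 0] this[of "Suc _"] have z: "X 0 = 0" "Y 0 = 0"
    and md: "\<And>n. X (Suc n) mod int b \<in> D1" "\<And>n. Y (Suc n) mod int b \<in> D2" by auto
  obtain \<xi> where \<xi>: "to_circle \<xi> \<in> digit_set_K b D1" "\<And>n. real_of_int (X n) \<le> B ^ n * \<xi>"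
    "\<And>n. B ^ n * \<xi> \<le> real_of_int (X n) + 1"
    using K_limit[OF z(1) dv(1) md(1) D1] by blast
  obtain \<eta> where \<eta>: "to_circle \<eta> \<in> digit_set_K b D2" "\<And>n. real_of_int (Y n) \<le> B ^ n * \<eta>"
    "\<And>n. B ^ n * \<eta> \<le> real_of_int (Y n) + 1"
    using K_limit[OF z(2) dv(2) md(2) D2] by blast
  \<comment> \<open>The errors of the three prefixes and the incoming carry are bounded, so the
    discrepancy in \<open>\<xi> + \<tau> = \<eta> + k\<close> is at most \<open>4 / B ^ n\<close>
    for every \<open>n\<close>, hence 0.\<close>
  have bound: "B ^ n * \<bar>\<xi> + \<tau> - \<eta> - k\<bar> \<le> 4" for n
  proof -
    obtain j where j: "j \<in> {0,1}" "(X n, Y n) \<in> nodes n (pre \<tau> n) j k" using nd by blast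
    then have "X n + int (pre \<tau> n) + j = Y n + int b ^ n * k" by (simp add: nodes_def)
    then have "real_of_int (X n + int (pre \<tau> n) + j) = real_of_int (Y n + int b ^ n * k)" by (simp only:)
    then have "real_of_int (X n) + real (pre \<tau> n) + real_of_int j = real_of_int (Y n) + B ^ n * k" by simp
    moreover have "0 \<le> real_of_int j" "real_of_int j \<le> 1" using j by auto
    ultimately have "\<bar>B ^ n * \<xi> + B ^ n * \<tau> - B ^ n * \<eta> - B ^ n * k\<bar> \<le> 4"
      using \<xi>(2,3)[of n] \<eta>(2,3)[of n] pre_bounds[OF \<tau>(1), of n] by linarith
    then have "\<bar>B ^ n * (\<xi> + \<tau> - \<eta> - k)\<bar> \<le> 4" by (simp add: algebra_simps)
    then show ?thesis by (simp add: abs_mult)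
  qed
  have "\<xi> + \<tau> - \<eta> - k = 0"
  proof (rule ccontr)
    assume "\<xi> + \<tau> - \<eta> - k \<noteq> 0"
    then have pos: "\<bar>\<xi> + \<tau> - \<eta> - k\<bar> > 0" by simp
    obtain n where "4 / \<bar>\<xi> + \<tau> - \<eta> - k\<bar> < B ^ n"
      using real_arch_pow[of B "4 / \<bar>\<xi> + \<tau> - \<eta> - k\<bar>"] b2 by auto
    then have "4 < B ^ n * \<bar>\<xi> + \<tau> - \<eta> - k\<bar>" using pos by (simp only: pos_divide_less_eq)
    then show False using bound[of n] by simp
  qed
  then have "to_circle \<eta> = to_circle \<xi> + to_circle \<tau>"
    by (simp add: plus_circle.abs_eq to_circle_eq_iff) (metis Ints_minus Ints_of_int minus_diff_eq add_diff_eq diff_eq_eq right_minus_eq)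
  then have "to_circle \<eta> \<in> E \<tau>" using \<xi>(1) \<eta>(1) by (auto simp: E_def)
  then obtain n where n: "to_circle \<eta> \<in> U n" using cov by blast
  have "to_circle \<eta> \<in> badic b (N n) (Y (N n))"
  proof -
    have "B ^ N n > 0" using b2 by simp
    then have "\<eta> \<in> {real_of_int (Y (N n)) / B ^ N n .. (real_of_int (Y (N n)) + 1) / B ^ N n}"
      using \<eta>(2,3)[of "N n"] by (simp add: pos_divide_le_eq pos_le_divide_eq mult.commute)
    then show ?thesis unfolding badic_def by (rule imageI)
  qed
  then have "touch n (Y (N n))" using n by (auto simp: touch_def)
  then have "bad (N n) (Y (N n))" unfolding bad_def by (intro exI[of _ n]) simp
  then show False using nbad by blast
qed

end

section \<open>The invariant cone and arc\<close>

lemma matrix_mult_2: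
  fixes A B :: "real^2^2"
  shows "(A ** B) $ i $ j = A $ i $ 1 * B $ 1 $ j + A $ i $ 2 * B $ 2 $ j"
  by (simp add: matrix_matrix_mult_def sum_2)

lemma F_matrix_entries:
  "F_matrix M $ 1 $ 1 = (M$1$1 - M$1$2 - M$2$1 + M$2$2) / 2"
  "F_matrix M $ 1 $ 2 = (M$1$1 + M$1$2 - M$2$1 - M$2$2) / 2"
  "F_matrix M $ 2 $ 1 = (M$1$1 - M$1$2 + M$2$1 - M$2$2) / 2"
  "F_matrix M $ 2 $ 2 = (M$1$1 + M$1$2 + M$2$1 + M$2$2) / 2"
  by (simp_all add: F_matrix_def Let_def)

text \<open>Sends \<open>(3, 1)\<close> and \<open>(1, 3)\<close> to multiples of the unit vectors,
  hence the invariant cone to the positive quadrant. On \<open>(1 + x, 1 - x)\<close> it doubles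
  \<open>x\<close>, up to a scalar.\<close>

definition cone_matrix :: "real^2^2" where
  "cone_matrix = vector [vector [3, -1], vector [-1, 3]]"

lemma cone_matrix_inverse:
  defines "R \<equiv> (vector [vector [3/8, 1/8], vector [1/8, 3/8]] :: real^2^2)"
  shows "cone_matrix ** R = mat 1" "R ** cone_matrix = mat 1"
  by (simp_all add: vec_eq_iff forall_2 matrix_mult_2 cone_matrix_def R_def mat_def)

lemma cone_matrix_invertible: "invertible cone_matrix"
  using cone_matrix_inverse unfolding invertible_def by blast

text \<open>\<open>matrix_inv\<close> is a choice among two-sided inverses, so its value follows
  from their uniqueness.\<close>

lemma matrix_inv_cone_matrix: "matrix_inv cone_matrix = vector [vector [3/8, 1/8], vector [1/8, 3/8]]"
proof -
  let ?R = "vector [vector [3/8, 1/8], vector [1/8, 3/8]] :: real^2^2"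
  have "\<exists>A'. cone_matrix ** A' = mat 1 \<and> A' ** cone_matrix = mat 1"
    using cone_matrix_inverse by blast
  then have "cone_matrix ** matrix_inv cone_matrix = mat 1 \<and> matrix_inv cone_matrix ** cone_matrix = mat 1"
    unfolding matrix_inv_def by (rule someI_ex)
  then have li: "matrix_inv cone_matrix ** cone_matrix = mat 1" by simp
  have "matrix_inv cone_matrix = matrix_inv cone_matrix ** (cone_matrix ** ?R)"
    by (simp add: cone_matrix_inverse)
  also have "\<dots> = (matrix_inv cone_matrix ** cone_matrix) ** ?R" by (simp add: matrix_mul_assoc)
  also have "\<dots> = ?R" by (simp add: li)
  finally show ?thesis .
qed

lemma conjugated_entries:
  fixes A :: "real^2^2"
  defines "C \<equiv> cone_matrix ** A ** matrix_inv cone_matrix"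
  shows "C $ 1 $ 1 = (9 * A$1$1 - 3 * A$2$1 + 3 * A$1$2 - A$2$2) / 8"
    "C $ 1 $ 2 = (3 * A$1$1 - A$2$1 + 9 * A$1$2 - 3 * A$2$2) / 8"
    "C $ 2 $ 1 = (9 * A$2$1 - 3 * A$1$1 + 3 * A$2$2 - A$1$2) / 8"
    "C $ 2 $ 2 = (3 * A$2$1 - A$1$1 + 9 * A$2$2 - 3 * A$1$2) / 8"
  unfolding C_def matrix_inv_cone_matrix
  by (simp_all add: matrix_mult_2 cone_matrix_def field_simps)

text \<open>\<open>Some\<close> embeds the line into its one-point compactification and so carries
  connectedness, compactness and the homeomorphism type over.\<close>

lemma closed_arc_interval:
  fixes a c :: real
  assumes "a < c"
  shows "closed_arc (Some ` {a..c})"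
proof -
  have e: "embedding_map euclideanreal real_hat Some" by (rule embedding_map_Some)
  have cm: "continuous_map euclideanreal real_hat Some" by (rule continuous_map_Some)
  have "connectedin euclideanreal {a..c}" "compactin euclideanreal {a..c}" by simp_all
  then have 1: "connectedin real_hat (Some ` {a..c})" "compactin real_hat (Some ` {a..c})"
    using connectedin_continuous_map_image[OF cm] image_compactin[OF _ cm] by blast+
  have "homeomorphic_map (top_of_set {a..c}) (subtopology (subtopology real_hat (range Some)) (Some ` {a..c})) Some"
    using e unfolding embedding_map_def by (intro homeomorphic_map_subtopologies) auto
  moreover have "subtopology (subtopology real_hat (range Some)) (Some ` {a..c}) = subtopology real_hat (Some ` {a..c})"
    unfolding subtopology_subtopology by (rule arg_cong[of _ _ "subtopology real_hat"]) auto
  ultimately have "top_of_set {a..c} homeomorphic_space subtopology real_hat (Some ` {a..c})"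
    using homeomorphic_map_imp_homeomorphic_space by auto
  moreover have "top_of_set {a..c} homeomorphic_space top_of_set {0..1::real}"
  proof -
    have "{a..c} homeomorphic {0..1::real}"
      using homeomorphic_closed_intervals_real[OF assms, of 0 1] by simp
    then show ?thesis
      unfolding homeomorphic_def homeomorphism_def homeomorphic_space_def homeomorphic_maps_def
      by (fastforce simp: continuous_map_subtopology_eu)
  qed
  ultimately have "subtopology real_hat (Some ` {a..c}) homeomorphic_space top_of_set {0..1::real}"
    using homeomorphic_space_sym homeomorphic_space_trans by blast
  then show ?thesis using 1 by (simp add: closed_arc_def)
qed

lemma interior_arc: "Some ` {a<..<c} \<subseteq> real_hat interior_of (Some ` {a..c::real})"
proof (rule interior_of_maximal)
  show "Some ` {a<..<c} \<subseteq> Some ` {a..c}" by auto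
  show "openin real_hat (Some ` {a<..<c})"
    using open_map_Some[of euclideanreal] by (simp add: open_map_def)
qed

section \<open>Dimension of the intersections\<close>

lemma affine_pos:
  fixes a c x h :: real
  assumes "0 < c + a * h" "0 < c - a * h" "\<bar>x\<bar> \<le> h"
  shows "0 < c + a * x"
proof -
  have "\<bar>a * x\<bar> \<le> \<bar>a\<bar> * h" using assms(3) by (simp add: abs_mult mult_left_mono)
  moreover have "\<bar>a\<bar> * h < c" using assms(1,2) by (simp add: abs_if split: if_splits)
  ultimately show ?thesis by (simp add: abs_le_iff)
qed

lemma affine_nonneg:
  fixes a c x h :: real
  assumes "0 \<le> c + a * h" "0 \<le> c - a * h" "\<bar>x\<bar> \<le> h"
  shows "0 \<le> c + a * x"
proof -
  have "\<bar>a * x\<bar> \<le> \<bar>a\<bar> * h" using assms(3) by (simp add: abs_mult mult_left_mono)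
  moreover have "\<bar>a\<bar> * h \<le> c" using assms(1,2) by (simp add: abs_if split: if_splits)
  ultimately show ?thesis by (simp add: abs_le_iff)
qed

text \<open>For exponent 0 every nonempty covering set costs 1, so a cover of cost below 1 consists
  of empty sets.\<close>

lemma hausdorff_measure_0_empty:
  assumes "hausdorff_measure 0 A = 0"
  shows "A = {}"
proof -
  have "hausdorff_premeasure 0 1 A \<le> hausdorff_measure 0 A"
    unfolding hausdorff_measure_def by (rule SUP_upper) simp
  then have "hausdorff_premeasure 0 1 A < 1" using assms by simp
  then obtain U where cov: "A \<subseteq> (\<Union>n. U n)" and sm: "(\<Sum>n. hausdorff_gauge 0 (U n)) < 1"
    unfolding hausdorff_premeasure_def INF_less_iff by auto
  have "U n = {}" for n
  proof (rule ccontr)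
    assume "U n \<noteq> {}"
    then have "1 = (\<Sum>i\<in>{n}. hausdorff_gauge 0 (U i))" by (simp add: hausdorff_gauge_def)
    also have "\<dots> \<le> (\<Sum>n. hausdorff_gauge 0 (U n))" by (intro sum_le_suminf) auto
    finally show False using sm by simp
  qed
  then show ?thesis using cov by auto
qed

lemma hausdorff_measure_empty: "hausdorff_measure s {} = 0"
proof -
  have "hausdorff_premeasure s \<delta> ({} :: 'a set) = 0" if "\<delta> > 0" for \<delta>
  proof -
    have "hausdorff_premeasure s \<delta> ({} :: 'a set) \<le> (\<Sum>n::nat. hausdorff_gauge s ({} :: 'a set))"
      unfolding hausdorff_premeasure_def
      by (rule INF_lower2[where i = "\<lambda>_. {}"]) (use that in auto)
    then show ?thesis by (simp add: hausdorff_gauge_def)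
  qed
  then show ?thesis by (simp add: hausdorff_measure_def)
qed

lemma hausdorff_dim_eqI:
  assumes \<theta>: "0 \<le> \<theta>"
    and upper: "\<And>s. \<theta> < s \<Longrightarrow> hausdorff_measure s A = 0"
    and lower: "\<And>s. 0 < s \<Longrightarrow> s < \<theta> \<Longrightarrow> hausdorff_measure s A \<noteq> 0"
  shows "hausdorff_dim A = ereal \<theta>"
proof (rule antisym)
  show "hausdorff_dim A \<le> ereal \<theta>"
  proof (rule ereal_le_epsilon2)
    fix e :: real assume "0 < e"
    then show "hausdorff_dim A \<le> ereal \<theta> + ereal e"
      unfolding hausdorff_dim_def using upper[of "\<theta> + e"] \<theta> by (intro Inf_lower) auto
  qed
  show "ereal \<theta> \<le> hausdorff_dim A"
    unfolding hausdorff_dim_def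
  proof (rule Inf_greatest)
    fix x assume "x \<in> {ereal s |s. 0 \<le> s \<and> hausdorff_measure s A = 0}"
    then obtain s where s: "x = ereal s" "0 \<le> s" "hausdorff_measure s A = 0" by auto
    have "\<theta> \<le> s"
    proof (rule ccontr)
      assume "\<not> \<theta> \<le> s"
      show False
      \<comment> \<open>Exponent 0 is outside the range of \<open>lower\<close>. Measure 0 there
        would make \<open>A\<close> empty, and then the measure at \<open>\<theta> / 2\<close> would
        vanish too.\<close>
      proof (cases "s = 0")
        case True
        then have "A = {}" using s hausdorff_measure_0_empty by blast
        then show False
          using lower[of "\<theta> / 2"] hausdorff_measure_empty \<open>\<not> \<theta> \<le> s\<close> True by auto
      next
        case False
        then show False using lower[of s] s \<open>\<not> \<theta> \<le> s\<close> by simp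
      qed
    qed
    then show "ereal \<theta> \<le> x" by (simp add: s)
  qed
qed

section \<open>From the unit interval to the circle\<close>

definition circle_frac :: "circle \<Rightarrow> real" where "circle_frac t = frac (rep_circle t)"

lemma to_circle_frac: "to_circle (frac x) = to_circle x"
  by (simp add: to_circle_eq_iff frac_def)

lemma to_circle_circle_frac: "to_circle (circle_frac t) = t"
  by (simp add: circle_frac_def to_circle_frac to_circle_rep)

lemma circle_frac_to_circle: "x \<in> {0..<1} \<Longrightarrow> circle_frac (to_circle x) = x"
proof -
  assume x: "x \<in> {0..<1}"
  have "circle_frac (to_circle x) - x \<in> \<int>"
    using to_circle_circle_frac[of "to_circle x"] by (simp add: to_circle_eq_iff)
  then obtain k where k: "circle_frac (to_circle x) - x = real_of_int k" by (auto elim: Ints_cases)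
  have "0 \<le> circle_frac (to_circle x)" "circle_frac (to_circle x) < 1"
    by (simp_all add: circle_frac_def frac_lt_1)
  then have "k < 1" "-1 < k" using k x by auto
  then show ?thesis using k by simp
qed

text \<open>The section jumps at 0, but for \<open>0 \<le> a\<close> and \<open>a < 1\<close> its
  sublevel set is the image of the compact interval \<open>[0, a]\<close>, hence closed.\<close>

lemma circle_frac_measurable [measurable]: "circle_frac \<in> borel_measurable borel"
proof (rule borel_measurableI_le)
  fix a :: real
  have rng: "0 \<le> circle_frac t" "circle_frac t < 1" for t
    by (simp_all add: circle_frac_def frac_lt_1)
  consider "a < 0" | "0 \<le> a" "a < 1" | "a \<ge> 1" by linarith
  then have "closed {t. circle_frac t \<le> a}"
  proof cases
    case 1
    have "\<not> circle_frac t \<le> a" for t using rng(1)[of t] 1 by linarith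
    then show ?thesis by simp
  next
    case 2
    have "{t. circle_frac t \<le> a} = to_circle ` {0..a}"
    proof (intro equalityI subsetI)
      fix t assume "t \<in> {t. circle_frac t \<le> a}"
      then show "t \<in> to_circle ` {0..a}"
        using rng[of t] to_circle_circle_frac[of t] by (intro image_eqI[of _ _ "circle_frac t"]) auto
    next
      fix t assume "t \<in> to_circle ` {0..a}"
      then show "t \<in> {t. circle_frac t \<le> a}" using circle_frac_to_circle 2 by auto
    qed
    moreover have "compact (to_circle ` {0..a})"
      by (intro compact_continuous_image continuous_on_to_circle) simp
    ultimately show ?thesis by (simp add: compact_imp_closed)
  next
    case 3
    have "circle_frac t \<le> a" for t using rng(2)[of t] 3 by linarith
    then show ?thesis by simp
  qed
  then show "{t \<in> space borel. circle_frac t \<le> a} \<in> sets borel" by simp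
qed

text \<open>The measurable section \<open>circle_frac\<close> pulls a null set of the interval back
  to a measurable set on the circle, whether or not \<open>P\<close> is measurable.\<close>

lemma AE_lebesgue_circleI:
  assumes "AE \<tau> in lborel. \<tau> \<in> {0..<1} \<longrightarrow> P (to_circle \<tau>)"
  shows "AE t in lebesgue_circle. P t"
proof -
  obtain N where N: "{\<tau> \<in> space lborel. \<not> (\<tau> \<in> {0..<1} \<longrightarrow> P (to_circle \<tau>))} \<subseteq> N"
    "emeasure lborel N = 0" "N \<in> sets lborel" using assms by (rule AE_E)
  have Nb: "N \<in> sets borel" using N(3) by simp
  define N' where "N' = circle_frac -` N \<inter> space borel"
  have N': "N' \<in> sets borel" unfolding N'_def by (rule measurable_sets[OF circle_frac_measurable Nb])
  have "emeasure lebesgue_circle N' = emeasure (restrict_space lborel {0..<1}) (to_circle -` N' \<inter> space (restrict_space lborel {0..<1::real}))"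
    unfolding lebesgue_circle_def by (rule emeasure_distr[OF measurable_to_circle N'])
  also have "to_circle -` N' \<inter> space (restrict_space lborel {0..<1::real}) = N \<inter> {0..<1}"
    by (auto simp: N'_def space_restrict_space circle_frac_to_circle)
  also have "emeasure (restrict_space lborel {0..<1}) (N \<inter> {0..<1::real}) = emeasure lborel (N \<inter> {0..<1})"
    by (rule emeasure_restrict_space) auto
  also have "\<dots> \<le> emeasure lborel N" using N(3) by (intro emeasure_mono) auto
  finally have z: "emeasure lebesgue_circle N' = 0" using N(2) by simp
  have "{t \<in> space lebesgue_circle. \<not> P t} \<subseteq> N'"
  proof
    fix t assume "t \<in> {t \<in> space lebesgue_circle. \<not> P t}"
    then have "\<not> P (to_circle (circle_frac t))" by (simp add: to_circle_circle_frac)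
    moreover have "circle_frac t \<in> {0..<1}" by (simp add: circle_frac_def frac_lt_1)
    ultimately show "t \<in> N'" using N(1) by (auto simp: N'_def)
  qed
  then show ?thesis using z N' by (intro AE_I[where N = N']) (auto simp: lebesgue_circle_def)
qed

lemma assoc_operator_cong:
  assumes "\<And>i. i \<in> I \<Longrightarrow> B i = B' i"
  shows "assoc_operator I w B = assoc_operator I w B'" "assoc_vector I w B = assoc_vector I w B'"
  using assms by (auto simp: assoc_operator_def assoc_vector_def fun_eq_iff intro!: sum.cong)

section \<open>The cocycle of a pair with few missing digits\<close>

locale large_digit_pair = digit_pair +
  assumes defect: "5 * defect + 6 \<le> 2 * b"
begin

text \<open>Indices are reduced modulo \<open>b\<close>, so that the bounds below hold for every index.\<close>

definition A :: "nat \<Rightarrow> real^2^2" where "A i = assoc_matrix b D1 D2 (i mod b)"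

lemma A_entries:
  "A i $ 1 $ 1 = real (assoc_entry b D1 D2 (i mod b) 0 0)"
  "A i $ 1 $ 2 = real (assoc_entry b D1 D2 (i mod b) 0 1)"
  "A i $ 2 $ 1 = real (assoc_entry b D1 D2 (i mod b) 1 0)"
  "A i $ 2 $ 2 = real (assoc_entry b D1 D2 (i mod b) 1 1)"
  by (simp_all add: A_def assoc_matrix_def)

lemma A_nonneg: "A i $ j $ k \<ge> 0"
  using exhaust_2[of j] exhaust_2[of k] by (auto simp: A_entries)

lemma A_cone:
  "A i $ 1 $ 1 + 3 * A i $ 1 $ 2 + 1 \<le> 3 * A i $ 2 $ 1 + 9 * A i $ 2 $ 2"
  "A i $ 2 $ 1 + 3 * A i $ 2 $ 2 + 1 \<le> 3 * A i $ 1 $ 1 + 9 * A i $ 1 $ 2"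
  "3 * A i $ 1 $ 1 + A i $ 1 $ 2 + 1 \<le> 9 * A i $ 2 $ 1 + 3 * A i $ 2 $ 2"
  "3 * A i $ 2 $ 1 + A i $ 2 $ 2 + 1 \<le> 9 * A i $ 1 $ 1 + 3 * A i $ 1 $ 2"
  "A i $ 1 $ 1 + A i $ 1 $ 2 \<le> real b" "A i $ 2 $ 1 + A i $ 2 $ 2 \<le> real b"
  using cone_inequalities[OF defect, of "i mod b"] b2 by (simp_all add: A_entries)

lemma strictly_invariant_arc:
  "common_strictly_invariant_arc {..<b} (\<lambda>i. moebius_map (F_matrix (assoc_matrix b D1 D2 i)))"
  unfolding common_strictly_invariant_arc_def
proof (intro exI conjI ballI)
  show "closed_arc (Some ` {-1/2..1/2::real})" by (rule closed_arc_interval) simp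
  fix i assume "i \<in> {..<b}"
  then have Ai: "assoc_matrix b D1 D2 i = A i" by (simp add: A_def)
  have "moebius_map (F_matrix (A i)) (Some x) \<in> Some ` {-1/2<..<1/2}" if x: "x \<in> {-1/2..1/2}" for x
  proof -
    define n d where "n = F_matrix (A i) $ 1 $ 1 * x + F_matrix (A i) $ 1 $ 2"
      and "d = F_matrix (A i) $ 2 $ 1 * x + F_matrix (A i) $ 2 $ 2"
    note c = A_cone[of i] A_nonneg[of i 1 1] A_nonneg[of i 1 2] A_nonneg[of i 2 1] A_nonneg[of i 2 2]
    have x': "\<bar>x\<bar> \<le> 1/2" using x by auto
    \<comment> \<open>The two conditions \<open>2 * n < d\<close> and \<open>- d < 2 * n\<close> are
      affine in \<open>x\<close>; at \<open>x = 1/2\<close> and \<open>x = -1/2\<close> they follow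
      from the four cone inequalities.\<close>
    have "0 < (F_matrix (A i) $ 2 $ 2 - 2 * F_matrix (A i) $ 1 $ 2) + (F_matrix (A i) $ 2 $ 1 - 2 * F_matrix (A i) $ 1 $ 1) * x"
      using c by (intro affine_pos[OF _ _ x']) (simp_all add: F_matrix_entries field_simps)
    then have 1: "2 * n < d" by (simp add: n_def d_def algebra_simps)
    have "0 < (F_matrix (A i) $ 2 $ 2 + 2 * F_matrix (A i) $ 1 $ 2) + (F_matrix (A i) $ 2 $ 1 + 2 * F_matrix (A i) $ 1 $ 1) * x"
      using c by (intro affine_pos[OF _ _ x']) (simp_all add: F_matrix_entries field_simps)
    then have 2: "- d < 2 * n" by (simp add: n_def d_def algebra_simps)
    have d: "d > 0" using 1 2 by simp
    have "moebius_map (F_matrix (A i)) (Some x) = Some (n / d)"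
      using d by (simp add: moebius_map_def moebius_fun_def n_def d_def)
    moreover have "n / d \<in> {-1/2<..<1/2}"
      using 1 2 d by (simp add: pos_divide_less_eq pos_less_divide_eq field_simps)
    ultimately show ?thesis by simp
  qed
  then show "moebius_map (F_matrix (assoc_matrix b D1 D2 i)) ` Some ` {-1/2..1/2}
      \<subseteq> real_hat interior_of (Some ` {-1/2..1/2})"
    unfolding Ai using interior_arc[of "-1/2" "1/2"] by blast
qed

text \<open>The entries of \<^term>\<open>F_matrix\<close> at the conjugate of \<open>A i\<close> by \<^term>\<open>cone_matrix\<close>.\<close>

definition "\<alpha> i = (A i $ 1 $ 1 - A i $ 1 $ 2 - A i $ 2 $ 1 + A i $ 2 $ 2) / 2"
definition "\<beta> i = A i $ 1 $ 1 + A i $ 1 $ 2 - A i $ 2 $ 1 - A i $ 2 $ 2"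
definition "\<gamma> i = (A i $ 1 $ 1 - A i $ 1 $ 2 + A i $ 2 $ 1 - A i $ 2 $ 2) / 4"
definition "\<delta> i = (A i $ 1 $ 1 + A i $ 1 $ 2 + A i $ 2 $ 1 + A i $ 2 $ 2) / 2"

definition P_conj :: "nat \<Rightarrow> real^2^2" where "P_conj i = cone_matrix ** A i ** matrix_inv cone_matrix"

lemma P_conj_positive: "positive_matrix (P_conj i)"
proof -
  note c = A_cone[of i]
  have "P_conj i $ 1 $ 1 > 0" "P_conj i $ 1 $ 2 > 0" "P_conj i $ 2 $ 1 > 0" "P_conj i $ 2 $ 2 > 0"
    unfolding P_conj_def conjugated_entries using c by simp_all
  then show ?thesis by (simp add: positive_matrix_def forall_2)
qed

lemma F_P_conj:
  "F_matrix (P_conj i) $ 1 $ 1 = \<alpha> i" "F_matrix (P_conj i) $ 1 $ 2 = \<beta> i"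
  "F_matrix (P_conj i) $ 2 $ 1 = \<gamma> i" "F_matrix (P_conj i) $ 2 $ 2 = \<delta> i"
  by (simp_all add: F_matrix_entries P_conj_def conjugated_entries \<alpha>_def \<beta>_def \<gamma>_def \<delta>_def field_simps)

text \<open>Everything is affine in \<open>x\<close>, so \<open>x = 1\<close> and
  \<open>x = -1\<close> suffice. There the slack 1 of the cone inequalities leaves a gap of 1/4
  between the absolute numerator and the denominator, which also bounds the denominator below.
  Denominators are at most \<open>3 / 2 * b\<close>, so giving up the fraction
  \<open>1 / (8 * b)\<close> costs at most 3/16, less than the gap.\<close>

sublocale moebius_cocycle b \<alpha> \<beta> \<gamma> \<delta> "1 - 1 / (8 * real b)" "1/4" "2 * real b"
proof
  show "0 < b" "0 \<le> 1 - 1 / (8 * real b)" "1 - 1 / (8 * real b) < 1" "0 < (1/4::real)"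
    using b2 by (simp_all add: field_simps)
  fix i and x :: real assume x: "\<bar>x\<bar> \<le> 1"
  note c = A_cone[of i] A_nonneg[of i 1 1] A_nonneg[of i 1 2] A_nonneg[of i 2 1] A_nonneg[of i 2 2]
  define e where "e = 1 / (8 * real b)"
  have bp: "real b > 0" using b2 by simp
  have gd: "\<delta> i + \<gamma> i = (3 * A i $ 1 $ 1 + A i $ 1 $ 2 + 3 * A i $ 2 $ 1 + A i $ 2 $ 2) / 4"
    "\<delta> i - \<gamma> i = (A i $ 1 $ 1 + 3 * A i $ 1 $ 2 + A i $ 2 $ 1 + 3 * A i $ 2 $ 2) / 4"
    by (simp_all add: \<gamma>_def \<delta>_def field_simps)
  have up: "\<delta> i + \<gamma> i \<le> 3 / 2 * real b" "\<delta> i - \<gamma> i \<le> 3 / 2 * real b" unfolding gd using c by simp_all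
  have e: "e * (\<delta> i + \<gamma> i) \<le> 3 / 16" "e * (\<delta> i - \<gamma> i) \<le> 3 / 16"
    using up bp by (simp_all add: e_def field_simps)
  have ab: "\<bar>\<beta> i + \<alpha> i\<bar> + 1/4 \<le> \<delta> i + \<gamma> i" "\<bar>\<beta> i - \<alpha> i\<bar> + 1/4 \<le> \<delta> i - \<gamma> i"
    unfolding gd using c by (simp_all add: \<alpha>_def \<beta>_def abs_if field_simps)
  have "0 \<le> ((1 - e) * \<delta> i - \<beta> i) + ((1 - e) * \<gamma> i - \<alpha> i) * x"
    using ab e by (intro affine_nonneg[OF _ _ x]) (simp_all add: algebra_simps)
  moreover have "0 \<le> ((1 - e) * \<delta> i + \<beta> i) + ((1 - e) * \<gamma> i + \<alpha> i) * x"
    using ab e by (intro affine_nonneg[OF _ _ x]) (simp_all add: algebra_simps)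
  ultimately show "\<bar>\<alpha> i * x + \<beta> i\<bar> \<le> (1 - 1 / (8 * real b)) * (\<gamma> i * x + \<delta> i)"
    unfolding e_def[symmetric] abs_le_iff by (simp add: algebra_simps)
  have "0 \<le> (\<delta> i - 1/4) + \<gamma> i * x"
    using ab by (intro affine_nonneg[OF _ _ x]) (simp_all add: algebra_simps)
  then show "1/4 \<le> \<gamma> i * x + \<delta> i" by simp
  have "0 \<le> (2 * real b - \<delta> i) + (- \<gamma> i) * x"
    using up bp by (intro affine_nonneg[OF _ _ x]) (simp_all add: algebra_simps)
  then show "\<gamma> i * x + \<delta> i \<le> 2 * real b" by simp
qed

text \<open>The pair of rows is a vector \<open>(1 + x, 1 - x)\<close> up to scale, whereas the
  conjugated cocycle uses the doubled coordinate; hence \<open>Z / 2\<close>. The initial vector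
  \<open>(1, 1)\<close> corresponds to 0.\<close>

lemma row_eq_Q:
  assumes "t < b ^ n"
  shows "row n t 0 = Q (dig b n t) 0 * (1 + Z (dig b n t) 0 / 2)"
    "row n t 1 = Q (dig b n t) 0 * (1 - Z (dig b n t) 0 / 2)"
proof -
  have "row n t 0 = Q (dig b n t) 0 * (1 + Z (dig b n t) 0 / 2) \<and>
    row n t 1 = Q (dig b n t) 0 * (1 - Z (dig b n t) 0 / 2)"
    using assms
  proof (induction n arbitrary: t)
    case 0
    then show ?case by (simp add: row_0)
  next
    case (Suc n)
    define i w where "i = t mod b" and "w = dig b n (t div b)"
    have ib: "i < b" using b2 by (simp add: i_def)
    have "t div b < b ^ n" using Suc.prems b2 by (simp add: less_mult_imp_div_less mult.commute)
    then have IH: "row n (t div b) 0 = Q w 0 * (1 + Z w 0 / 2)" "row n (t div b) 1 = Q w 0 * (1 - Z w 0 / 2)"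
      using Suc.IH by (simp_all add: w_def)
    have ent: "real (card (nodes 1 i 0 0)) = A i $ 1 $ 1" "real (card (nodes 1 i 0 1)) = A i $ 1 $ 2"
      "real (card (nodes 1 i 1 0)) = A i $ 2 $ 1" "real (card (nodes 1 i 1 1)) = A i $ 2 $ 2"
      using assoc_entry_nodes[OF ib, of 0 0] assoc_entry_nodes[OF ib, of 0 1]
        assoc_entry_nodes[OF ib, of 1 0] assoc_entry_nodes[OF ib, of 1 1] ib
      by (simp_all add: A_entries)
    have rows: "row (Suc n) t 0 = A i $ 1 $ 1 * row n (t div b) 0 + A i $ 1 $ 2 * row n (t div b) 1"
      "row (Suc n) t 1 = A i $ 2 $ 1 * row n (t div b) 0 + A i $ 2 $ 2 * row n (t div b) 1"
      using row_split[of 0 n 1 t] row_split[of 1 n 1 t] unfolding power_one_right i_def[symmetric]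
      by (simp_all add: ent[unfolded One_nat_def])
    have d: "den i (Z w 0) > 0" by (intro den_pos Z_bound) simp
    have Q: "Q (dig b (Suc n) t) 0 = den i (Z w 0) * Q w 0" and Z: "Z (dig b (Suc n) t) 0 = num i (Z w 0) / den i (Z w 0)"
      by (simp_all add: i_def w_def g_def)
    have "row (Suc n) t 0 = Q w 0 * (den i (Z w 0) + num i (Z w 0) / 2)"
      "row (Suc n) t 1 = Q w 0 * (den i (Z w 0) - num i (Z w 0) / 2)"
      unfolding rows IH num_def den_def \<alpha>_def \<beta>_def \<gamma>_def \<delta>_def by (simp_all add: field_simps)
    moreover have "den i (Z w 0) * Q w 0 * (1 + num i (Z w 0) / den i (Z w 0) / 2)
        = Q w 0 * (den i (Z w 0) + num i (Z w 0) / 2)"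
      "den i (Z w 0) * Q w 0 * (1 - num i (Z w 0) / den i (Z w 0) / 2)
        = Q w 0 * (den i (Z w 0) - num i (Z w 0) / 2)"
      using d by (simp_all add: field_simps)
    ultimately show ?case unfolding Q Z by (simp only: simp_thms)
  qed
  then show "row n t 0 = Q (dig b n t) 0 * (1 + Z (dig b n t) 0 / 2)"
    "row n t 1 = Q (dig b n t) 0 * (1 - Z (dig b n t) 0 / 2)" by auto
qed

lemma word_eq: "word \<tau> n = dig b n (pre \<tau> n)"
  by (simp add: word_def pre_def)

lemma pre_less:
  assumes "0 \<le> \<tau>" "\<tau> < 1"
  shows "pre \<tau> n < b ^ n"
proof -
  have "B ^ n * \<tau> < B ^ n" using assms b2 by simp
  then have "real (pre \<tau> n) < B ^ n" using pre_bounds(1)[OF assms(1), of n] by linarith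
  then have "real (pre \<tau> n) < real (b ^ n)" by (simp only: of_nat_power)
  then show ?thesis by (simp only: of_nat_less_iff)
qed

lemma total_eq_Q:
  assumes "0 \<le> \<tau>" "\<tau> < 1"
  shows "total \<tau> n = 2 * Q (word \<tau> n) 0"
  using row_eq_Q[OF pre_less[OF assms]] by (simp add: total_def word_eq algebra_simps)

text \<open>In the cone spanned by \<open>(3, 1)\<close> and \<open>(1, 3)\<close> neither
  coordinate is below a quarter of the sum.\<close>

lemma row_ge_total:
  assumes "0 \<le> \<tau>" "\<tau> < 1" "l \<in> {0, 1}"
  shows "total \<tau> n / 4 \<le> row n (pre \<tau> n) l"
proof -
  have q: "Q (word \<tau> n) 0 > 0" by (rule Q_pos) simp
  have z: "\<bar>Z (word \<tau> n) 0\<bar> \<le> 1" by (rule Z_bound) simp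
  have "Q (word \<tau> n) 0 * (1/2) \<le> Q (word \<tau> n) 0 * (1 + Z (word \<tau> n) 0 / 2)"
    "Q (word \<tau> n) 0 * (1/2) \<le> Q (word \<tau> n) 0 * (1 - Z (word \<tau> n) 0 / 2)"
    using q z by (intro mult_left_mono; simp add: abs_le_iff)+
  then show ?thesis
    using row_eq_Q[OF pre_less[OF assms(1,2)], of n] assms(3) by (auto simp: total_eq_Q[OF assms(1,2)] word_eq)
qed

lemma ln_total:
  assumes "0 \<le> \<tau>" "\<tau> < 1"
  shows "ln (total \<tau> n) = ln 2 + log_Q (word \<tau> n)" "total \<tau> n > 0"
  using Q_pos[of 0 "word \<tau> n"] by (simp_all add: total_eq_Q[OF assms] ln_mult log_Q_def)

lemma total_ge_1:
  assumes "0 \<le> \<tau>" "\<tau> < 1"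
  shows "total \<tau> n \<ge> 1"
proof -
  define N where "N = (\<Sum>j\<in>{0,1}. \<Sum>k\<in>{0,1}. card (nodes n (pre \<tau> n) j k))"
  have N: "total \<tau> n = real N" by (simp add: N_def total_def row_def)
  then have "N > 0" using ln_total(2)[OF assms, of n] by simp
  then show ?thesis using N by simp
qed

lemma length_word: "length (word \<tau> n) = n"
  by (simp add: word_def)

lemma weighted_total:
  assumes "0 \<le> \<tau>" "\<tau> < 1"
  shows "total \<tau> n * (1 / B ^ n) powr s = 2 * exp (Y (word \<tau> n) + real n * (lyap - s * ln B))"
proof -
  have bp: "B > 0" using b2 by simp
  have "(1 / B ^ n) powr s = exp (- (s * (real n * ln B)))"
    using bp by (simp add: powr_def ln_div ln_realpow)
  moreover have "total \<tau> n = 2 * exp (log_Q (word \<tau> n))"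
    using ln_total[OF assms, of n] Q_pos[of 0 "word \<tau> n"] by (simp add: total_eq_Q[OF assms] log_Q_def)
  ultimately show ?thesis by (simp add: Y_def length_word algebra_simps flip: exp_add)
qed

text \<open>\<open>total\<close> is a positive count, thus at least 1, while a negative exponent
  would eventually push it below 1.\<close>

lemma lyap_nonneg:
  assumes \<tau>: "0 \<le> \<tau>" "\<tau> < 1"
    and dev: "\<And>\<epsilon>. \<epsilon> > 0 \<Longrightarrow> \<forall>\<^sub>F n in sequentially. \<bar>Y (word \<tau> n)\<bar> < \<epsilon> * real n"
  shows "0 \<le> lyap / ln B"
proof -
  have lnb: "ln B > 0" using b2 by simp
  show ?thesis
  proof (rule ccontr)
    assume "\<not> 0 \<le> lyap / ln B"
    then have neg: "lyap < 0" using lnb by (simp add: field_simps not_le)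
    have "\<forall>\<^sub>F n in sequentially. ln 2 / (- lyap / 2) < real n" 
      using filterlim_real_sequentially unfolding filterlim_at_top_dense by blast
    moreover have "\<forall>\<^sub>F n in sequentially. \<bar>Y (word \<tau> n)\<bar> < (- lyap / 2) * real n" using neg by (intro dev) simp
    ultimately have "\<forall>\<^sub>F n in sequentially. False"
    proof eventually_elim
      case (elim n)
      have "0 < - lyap / 2" using neg by simp
      then have "ln 2 < real n * (- lyap / 2)" using elim(1) by (simp only: pos_divide_less_eq)
      moreover have "0 \<le> ln (total \<tau> n)" using total_ge_1[OF \<tau>, of n] by simp
      ultimately show False
        using elim(2) unfolding ln_total(1)[OF \<tau>] by (simp add: Y_def length_word algebra_simps abs_less_iff)
    qed
    then show False by simp
  qed
qed

theorem hausdorff_dim_E: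
  assumes \<tau>: "0 \<le> \<tau>" "\<tau> < 1" and nb: "\<And>n. B ^ n * \<tau> \<notin> \<int>"
    and dev: "\<And>\<epsilon>. \<epsilon> > 0 \<Longrightarrow> \<forall>\<^sub>F n in sequentially. \<bar>Y (word \<tau> n)\<bar> < \<epsilon> * real n"
  shows "hausdorff_dim (E \<tau>) = ereal (lyap / ln B)"
proof (rule hausdorff_dim_eqI)
  show "0 \<le> lyap / ln B" by (rule lyap_nonneg[OF \<tau> dev])
next
  fix s assume s: "lyap / ln B < s"
  have lnb: "ln B > 0" using b2 by simp
  \<comment> \<open>Half of the gap: a deviation of at most \<open>\<epsilon> * n\<close> then still
    leaves decay at rate \<open>\<epsilon>\<close>.\<close>
  define \<epsilon> where "\<epsilon> = (s * ln B - lyap) / 2"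
  have \<epsilon>: "\<epsilon> > 0" using s lnb by (simp add: \<epsilon>_def pos_divide_less_eq)
  have lim: "(\<lambda>n. total \<tau> n * (1 / B ^ n) powr s) \<longlonglongrightarrow> 0"
  proof (rule tendsto_sandwich[of "\<lambda>_. 0" _ _ "\<lambda>n. 2 * exp (- \<epsilon>) ^ n"])
    show "\<forall>\<^sub>F n in sequentially. 0 \<le> total \<tau> n * (1 / B ^ n) powr s"
      by (intro always_eventually allI mult_nonneg_nonneg less_imp_le[OF ln_total(2)[OF \<tau>]]) simp
    show "\<forall>\<^sub>F n in sequentially. total \<tau> n * (1 / B ^ n) powr s \<le> 2 * exp (- \<epsilon>) ^ n"
      using dev[OF \<epsilon>]
    proof eventually_elim
      case (elim n)
      have "lyap - s * ln B = - 2 * \<epsilon>" by (simp add: \<epsilon>_def)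
      then have "Y (word \<tau> n) + real n * (lyap - s * ln B) \<le> \<epsilon> * real n + real n * (- 2 * \<epsilon>)"
        using elim by (simp add: abs_less_iff)
      also have "\<dots> = real n * (- \<epsilon>)" by (simp add: algebra_simps)
      finally show ?case unfolding weighted_total[OF \<tau>] exp_of_nat_mult[symmetric] by simp
    qed
    have "(\<lambda>n. exp (- \<epsilon>) ^ n) \<longlonglongrightarrow> 0" using \<epsilon> by (intro LIMSEQ_realpow_zero) auto
    then show "(\<lambda>n. 2 * exp (- \<epsilon>) ^ n) \<longlonglongrightarrow> 0" using tendsto_mult_right_zero by blast
  qed simp
  have "0 \<le> lyap / ln B" by (rule lyap_nonneg[OF \<tau> dev])
  then have "s > 0" using s by simp
  then show "hausdorff_measure s (E \<tau>) = 0" by (rule hausdorff_measure_zero[OF \<tau> nb _ lim])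
next
  fix s assume s: "0 < s" "s < lyap / ln B"
  have lnb: "ln B > 0" using b2 by simp
  define \<epsilon> where "\<epsilon> = lyap - s * ln B"
  have \<epsilon>: "\<epsilon> > 0" using s lnb by (simp add: \<epsilon>_def pos_less_divide_eq)
  define f where "f = (\<lambda>n. total \<tau> n * (1 / B ^ n) powr s)"
  have "\<forall>\<^sub>F n in sequentially. 1 \<le> f n"
    using dev[OF \<epsilon>]
  proof eventually_elim
    case (elim n)
    have "0 \<le> Y (word \<tau> n) + real n * (lyap - s * ln B)"
      using elim by (simp add: \<epsilon>_def abs_less_iff algebra_simps)
    then have "1 \<le> exp (Y (word \<tau> n) + real n * (lyap - s * ln B))" by simp
    then show ?case unfolding f_def weighted_total[OF \<tau>] by linarith
  qed
  then obtain n0 where n0: "\<And>n. n \<ge> n0 \<Longrightarrow> 1 \<le> f n" unfolding eventually_sequentially by blast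
  have fpos: "f n > 0" for n unfolding f_def weighted_total[OF \<tau>] by simp
  \<comment> \<open>\<open>hausdorff_measure_nonzero\<close> asks for a bound at every level; the
    finitely many levels before \<open>n0\<close> enter through the minimum.\<close>
  define c where "c = Min (insert 1 (f ` {..<n0}))"
  have c: "c > 0" unfolding c_def using fpos by (subst Min_gr_iff) auto
  have "c \<le> f n" for n
  proof (cases "n < n0")
    case True
    then show ?thesis unfolding c_def by (intro Min_le) auto
  next
    case False
    have "c \<le> 1" unfolding c_def by (intro Min_le) auto
    then show ?thesis using n0[of n] False by simp
  qed
  then show "hausdorff_measure s (E \<tau>) \<noteq> 0"
    unfolding f_def by (intro hausdorff_measure_nonzero[OF \<tau> s(1) c] row_ge_total[OF \<tau>])
qed

end

lemma AE_not_badic: "b > 0 \<Longrightarrow> AE \<tau> in lborel. \<forall>n. real b ^ n * \<tau> \<notin> \<int>"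
  unfolding AE_all_countable
proof
  fix n assume b: "b > 0"
  have "{\<tau>. real b ^ n * \<tau> \<in> \<int>} \<subseteq> (\<lambda>z. z / real b ^ n) ` \<int>"
  proof
    fix \<tau> assume "\<tau> \<in> {\<tau>. real b ^ n * \<tau> \<in> \<int>}"
    then show "\<tau> \<in> (\<lambda>z. z / real b ^ n) ` \<int>" using b by (intro image_eqI[of _ _ "real b ^ n * \<tau>"]) auto
  qed
  moreover have "countable (\<int> :: real set)" unfolding Ints_def by (intro countable_image) simp
  ultimately have "countable {\<tau>. real b ^ n * \<tau> \<in> \<int>}" by (meson countable_image countable_subset)
  then have "{\<tau>. real b ^ n * \<tau> \<in> \<int>} \<in> null_sets lborel" by (rule countable_imp_null_set_lborel)
  then show "AE \<tau> in lborel. real b ^ n * \<tau> \<notin> \<int>"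
    by (rule AE_I') auto
qed

lemma (in large_digit_pair) AE_hausdorff_dim:
  "AE t in lebesgue_circle. hausdorff_dim ((\<lambda>x. x + t) ` digit_set_K b D1 \<inter> digit_set_K b D2)
     = ereal (lyap / ln B)"
proof (rule AE_lebesgue_circleI)
  have "b > 0" using b2 by simp
  from AE_not_badic[OF this] AE_strong_law
  show "AE \<tau> in lborel. \<tau> \<in> {0..<1} \<longrightarrow>
      hausdorff_dim ((\<lambda>x. x + to_circle \<tau>) ` digit_set_K b D1 \<inter> digit_set_K b D2) = ereal (lyap / ln B)"
  proof eventually_elim
    case (elim \<tau>)
    show ?case
      unfolding E_def[symmetric] using elim by (intro impI hausdorff_dim_E) auto
  qed
qed

theorem proposition1p13:
  fixes b :: nat and D1 D2 :: "int set"
  assumes "b \<ge> 3"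
    and "D1 \<subseteq> {0..int b - 1}" and "D2 \<subseteq> {0..int b - 1}"
    and "int (card D1) \<ge> int b - \<lfloor>(real b - 3) / 5\<rfloor>"
    and "int (card D2) \<ge> int b - \<lfloor>(real b - 3) / 5\<rfloor>"
  shows "(degenerate_pair b D1 D2 \<or>
            common_strictly_invariant_arc {..<b} (\<lambda>i. moebius_map (F_matrix (assoc_matrix b D1 D2 i)))) \<and>
         (\<not> degenerate_pair b D1 D2 \<longrightarrow>
           (\<exists>P :: real^2^2. invertible P \<and>
             (let B = (\<lambda>i. P ** assoc_matrix b D1 D2 i ** matrix_inv P);
                  T = assoc_operator {..<b} (\<lambda>i. 1 / real b) B;
                  v = assoc_vector {..<b} (\<lambda>i. 1 / real b) B
              in (\<forall>i<b. positive_matrix (B i)) \<and>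
                 (\<forall>n k. summable (\<lambda>m. T k m * (mat_apply T ^^ n) v m)) \<and>
                 summable (\<lambda>n. (mat_apply T ^^ n) v 0) \<and>
                 (AE t in lebesgue_circle.
                    hausdorff_dim (((\<lambda>x. x + t) ` digit_set_K b D1) \<inter> digit_set_K b D2) =
                      ereal (1 / ln (real b) * (\<Sum>n. (mat_apply T ^^ n) v 0))))))"
proof -
  interpret digit_pair b D1 D2 using assms(1-3) by unfold_locales auto
  interpret large_digit_pair b D1 D2
  proof
    \<comment> \<open>Each digit set lacks at most \<open>(b - 3) / 5\<close> digits, so
      \<open>5 * defect \<le> 2 * (b - 3)\<close>.\<close>
    have "real_of_int \<lfloor>(real b - 3) / 5\<rfloor> \<le> (real b - 3) / 5" by (rule of_int_floor_le)
    then have "real_of_int (5 * \<lfloor>(real b - 3) / 5\<rfloor>) \<le> real_of_int (int b - 3)" by simp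
    then have "5 * \<lfloor>(real b - 3) / 5\<rfloor> \<le> int b - 3" by (simp only: of_int_le_iff)
    moreover have "int defect = (int b - int (card D1)) + (int b - int (card D2))"
      using card_le by (simp add: defect_def of_nat_diff)
    ultimately show "5 * defect + 6 \<le> 2 * b" using assms(4,5) by linarith
  qed
  show ?thesis
  proof (intro conjI impI)
    show "degenerate_pair b D1 D2 \<or>
        common_strictly_invariant_arc {..<b} (\<lambda>i. moebius_map (F_matrix (assoc_matrix b D1 D2 i)))"
      using strictly_invariant_arc ..
    assume nondeg: "\<not> degenerate_pair b D1 D2"
    interpret moebius_operator b \<alpha> \<beta> \<gamma> \<delta> "1 - 1 / (8 * real b)" "1/4" "2 * real b" P_conj
    proof
      fix i
      \<comment> \<open>Neither the conjugation nor \<open>F_matrix\<close> changes the determinant,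
        so nondegeneracy gives the nonzero determinant required for
        \<open>log_const_B\<close>.\<close>
      have "invertible (A i)" using nondeg assms(1) by (simp add: degenerate_pair_def A_def)
      then have "A i $ 1 $ 1 * A i $ 2 $ 2 - A i $ 1 $ 2 * A i $ 2 $ 1 \<noteq> 0"
        by (simp add: invertible_det_nz det_2)
      moreover have "\<alpha> i * \<delta> i - \<beta> i * \<gamma> i = A i $ 1 $ 1 * A i $ 2 $ 2 - A i $ 1 $ 2 * A i $ 2 $ 1"
        by (simp add: \<alpha>_def \<beta>_def \<gamma>_def \<delta>_def field_simps)
      ultimately show "\<alpha> i * \<delta> i - \<beta> i * \<gamma> i \<noteq> 0" by simp
    qed (rule F_P_conj)+
    define C where "C = (\<lambda>i. cone_matrix ** assoc_matrix b D1 D2 i ** matrix_inv cone_matrix)"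
    \<comment> \<open>\<open>P_conj\<close> reduces its index modulo \<open>b\<close>; the operator
      and the vector only see indices below \<open>b\<close>, where both families agree.\<close>
    have C: "C i = P_conj i" if "i < b" for i using that by (simp add: C_def P_conj_def A_def)
    have T: "assoc_operator {..<b} (\<lambda>i. 1 / real b) C = T" "assoc_vector {..<b} (\<lambda>i. 1 / real b) C = v"
      unfolding T_def v_def using C by (intro assoc_operator_cong; simp)+
    have "(\<forall>i<b. positive_matrix (C i)) \<and>
        (\<forall>n k. summable (\<lambda>m. T k m * (mat_apply T ^^ n) v m)) \<and>
        summable (\<lambda>n. (mat_apply T ^^ n) v 0) \<and>
        (AE t in lebesgue_circle.
          hausdorff_dim (((\<lambda>x. x + t) ` digit_set_K b D1) \<inter> digit_set_K b D2) =
            ereal (1 / ln (real b) * (\<Sum>n. (mat_apply T ^^ n) v 0)))"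
      using AE_hausdorff_dim T_summable sums_summable[OF T_series_sums]
      by (simp add: C P_conj_positive sums_unique[OF T_series_sums, symmetric])
    then show "\<exists>P :: real^2^2. invertible P \<and>
             (let B = (\<lambda>i. P ** assoc_matrix b D1 D2 i ** matrix_inv P);
                  T = assoc_operator {..<b} (\<lambda>i. 1 / real b) B;
                  v = assoc_vector {..<b} (\<lambda>i. 1 / real b) B
              in (\<forall>i<b. positive_matrix (B i)) \<and>
                 (\<forall>n k. summable (\<lambda>m. T k m * (mat_apply T ^^ n) v m)) \<and>
                 summable (\<lambda>n. (mat_apply T ^^ n) v 0) \<and>
                 (AE t in lebesgue_circle.
                    hausdorff_dim (((\<lambda>x. x + t) ` digit_set_K b D1) \<inter> digit_set_K b D2) =
                      ereal (1 / ln (real b) * (\<Sum>n. (mat_apply T ^^ n) v 0))))"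
      unfolding Let_def T[symmetric] C_def using cone_matrix_invertible by blast
  qed
qed

end
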